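(* Let $r,l,m,n$ be positive integers with $r\le l<\min(m,n)$, $n>36r$ and $l>22(r-1)$. Let $G$ be an $r\times n$ Gaussian matrix, and let $H\in\mathbb R^{n\times l}$, $A\in\mathbb R^{m\times r}$ and $E\in\mathbb R^{m\times n}$ be constant matrices, where $A$ has full rank $r$. Let $B:=\frac1{\sqrt n}G$, $\tilde M:=AB$, and $M:=\tilde M+E$. Let $T$ be a nonsingular $l\times l$ matrix and let $X:=MHT^{-1}$, $Y:=X^+M$. (i) Suppose that $H$ has orthonormal columns and that $\|E\|_F\le\dfrac{\sigma_r(A)}{48\sqrt{n/l}+6}$. Then $$|||M-XY|||\,/\,\tau_{r+1}(M)\le\sqrt{1+100n/l}$$ with a probability no less than $1-\exp(-\frac{l-r}{20})-\exp(-\frac{n-r}{20})-\exp(-\frac n{72})$. (ii) Suppose that $H$ has full rank and that $\|E\|_F\le\dfrac{\sigma_r(A)}{12}\min\Big(1,\dfrac1{4\sqrt{n/l}\cdot\sigma_l(H)+0.5}\Big)$, and let $\kappa(H)=\|H\|_2\|H^+\|_2$. Then $$|||M-XY|||\,/\,\tau_{r+1}(M)\le\sqrt{1+100\kappa^2(H)n/l}$$ with a probability no less than $1-\exp(-\frac{l-r}{20})-\exp(-\frac{n-r}{20})-\exp(-\frac n{72})$.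
   Context: All matrices are real. A Gaussian matrix is one filled with independent identically distributed standard normal random variables; constant matrices are non-random. $\|\cdot\|_2$ is the spectral norm, $\|\cdot\|_F$ the Frobenius norm, and $|||\cdot|||$ denotes either of the two (the claim is for each of them). $\sigma_j(A)$ is the $j$-th largest singular value of $A$. $\tau_{r+1}(M):=\min_{N:\,\operatorname{rank}(N)\le r}|||M-N|||$, i.e. $\sigma_{r+1}(M)$ for the spectral norm and $\sqrt{\sum_{j>r}\sigma_j^2(M)}$ for the Frobenius norm. An inequality $a/\tau_{r+1}(M)\le b$ is read as $a\le b\,\tau_{r+1}(M)$. $A^+$ is the Moore–Penrose pseudo inverse. $X,Y$ are the output of the paper's Range Finder (column sketching) algorithm applied to $M$ with test matrix $H$; $M$ is called a perturbed right factor-Gaussian matrix. *)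

theory Defs
  imports "HOL-Probability.Probability"
begin

text \<open>An \<open>m \<times> n\<close> real matrix has type \<open>real^'n^'m\<close>: the row index comes last.\<close>

definition gaussian_matrix :: "'a measure \<Rightarrow> ('a \<Rightarrow> real^'n^'m) \<Rightarrow> bool" where
  "gaussian_matrix P G \<longleftrightarrow>
     prob_space.indep_vars P (\<lambda>_. borel) (\<lambda>(i, j) \<omega>. G \<omega> $ i $ j) UNIV \<and>
     (\<forall>i j. distributed P lborel (\<lambda>\<omega>. G \<omega> $ i $ j) std_normal_density)"

definition spectral_norm :: "real^'n^'m \<Rightarrow> real" where
  "spectral_norm A = onorm ((*v) A)"

definition frobenius_norm :: "real^'n^'m \<Rightarrow> real" where
  "frobenius_norm A = sqrt (\<Sum>i\<in>UNIV. \<Sum>j\<in>UNIV. (A $ i $ j)\<^sup>2)"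

lemma frobenius_norm_eq_norm: "frobenius_norm A = norm A"
  by (simp add: frobenius_norm_def norm_vec_def L2_set_def sum_nonneg)

text \<open>
  The singular values are the square roots of the eigenvalues of \<open>A\<^sup>T A\<close>, each repeated
  according to its multiplicity (algebraic and geometric multiplicity agree, as \<open>A\<^sup>T A\<close> is
  symmetric). For \<open>A\<close> of size \<open>m \<times> n\<close> this gives \<open>n\<close> values; if \<open>m < n\<close>, the last \<open>n - m\<close>
  of them in decreasing order are zero.
\<close>

definition singular_values :: "real^'n^'m \<Rightarrow> real multiset" where
  "singular_values A =
     (\<Sum>c\<in>{c. \<exists>v. v \<noteq> 0 \<and> (transpose A ** A) *v v = c *\<^sub>R v}.
        replicate_mset (dim {v. (transpose A ** A) *v v = c *\<^sub>R v}) (sqrt c))"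

text \<open>Singular values are numbered from \<open>1\<close>.\<close>

definition singular_value :: "nat \<Rightarrow> real^'n^'m \<Rightarrow> real" where
  "singular_value j A = rev (sorted_list_of_multiset (singular_values A)) ! (j - 1)"

definition is_pinv :: "real^'n^'m \<Rightarrow> real^'m^'n \<Rightarrow> bool" where
  "is_pinv A P \<longleftrightarrow>
     A ** P ** A = A \<and> P ** A ** P = P \<and>
     transpose (A ** P) = A ** P \<and> transpose (P ** A) = P ** A"

definition pinv :: "real^'n^'m \<Rightarrow> real^'m^'n" where
  "pinv A = (THE P. is_pinv A P)"

definition orthonormal_columns :: "real^'n^'m \<Rightarrow> bool" where
  "orthonormal_columns A \<longleftrightarrow>
     (\<forall>i. norm (column i A) = 1) \<and>
     (\<forall>i j. i \<noteq> j \<longrightarrow> orthogonal (column i A) (column j A))"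

definition cond_number :: "real^'n^'m \<Rightarrow> real" where
  "cond_number A = spectral_norm A * spectral_norm (pinv A)"

text \<open>
  The smallest error, in the norm \<open>nrm\<close>, of an approximation of \<open>M\<close> by a matrix of rank
  less than \<open>k\<close>; thus \<open>tau nrm (r + 1) M\<close> ranges over rank at most \<open>r\<close>. The infimum is a
  minimum for either of the norms above.
\<close>

definition tau :: "(real^'n^'m \<Rightarrow> real) \<Rightarrow> nat \<Rightarrow> real^'n^'m \<Rightarrow> real" where
  "tau nrm k M = Inf {nrm (M - N) | N. rank N < k}"

end

theory Submission
  imports Defs
begin

text \<open>
  Write \<open>\<sigma>\<close> for \<open>\<sigma>\<^sub>r(A)\<close>. The bounds on \<open>E\<close> in both parts give \<open>\<parallel>E\<parallel> \<le> \<sigma> / 12\<close> in the Frobenius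
  norm, and both error bounds are at least \<open>10 \<surd>(n/l) \<tau>\<close> with \<open>\<tau> = \<tau>\<^sub>r\<^sub>+\<^sub>1(M)\<close>, because
  \<open>\<kappa>(H) \<ge> 1\<close>. So it suffices to bound the error by \<open>10 \<surd>(n/l) \<tau>\<close> for \<open>H\<close> of full rank and
  \<open>\<parallel>E\<parallel> \<le> \<sigma> / 12\<close>.

  The matrix \<open>X Y = X X\<^sup>+ M\<close> is the orthogonal projection of \<open>M\<close> to the range of \<open>M H\<close>, so the
  error is at most \<open>|||M - M H N|||\<close> for every \<open>N\<close>. Split \<open>E = A Z + F\<close> with
  \<open>A\<^sup>T F = 0\<close>. Then \<open>M = A C + F\<close> with \<open>C = B + Z\<close>, where \<open>Z\<close> and \<open>F / \<sigma>\<close> have norm at most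
  \<open>1/12\<close>. Two deterministic estimates carry the proof.

  \<^item> Upper bound for the error (\<open>sketch_error_le\<close>). Inside the range of \<open>H\<close> there is a subspace of
    dimension \<open>l - r\<close> on which \<open>Z\<close> vanishes. Let \<open>H N\<close> be the oblique projection along the
    kernel of \<open>C\<close> to a part of that subspace. As \<open>C H N = C\<close>, the term \<open>A C\<close> drops out:
    \<open>M - M H N = F - F H N\<close>. The norm of \<open>H N\<close> is at most \<open>\<parallel>C\<parallel> / c\<close>, where \<open>c\<close> is the smallest
    singular value of \<open>B\<close> compressed to the subspace, and \<open>c\<close> is of order \<open>\<surd>(l/n)\<close>.

  \<^item> Lower bound for \<open>\<tau>\<close> (\<open>best_low_rank_error_ge\<close>): \<open>|||F||| \<le> 2 \<tau>\<close>. A matrix \<open>N\<close> of rank at most \<open>r\<close> that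
    approximates \<open>M\<close> too well must capture the row space of \<open>C\<close>, and then it has no rank left
    for \<open>F\<close>, whose rows are nearly orthogonal to those of the random matrix \<open>C\<close>.

  What is needed from \<open>B = G / \<surd>n\<close> is that it is well conditioned, that its compression to a fixed
  subspace of dimension \<open>l - r\<close> has a smallest singular value of order \<open>\<surd>(l/n)\<close>, and that \<open>B F'\<^sup>T\<close>
  is small for a fixed matrix \<open>F'\<close>. All three concern Gaussian quadratic forms. For
  a single form, the exponential moments follow from independence of the entries
  (\<open>nn_integral_exp_quadratic_gaussian\<close>). The first two claims concern all \<open>y\<close> on the unit
  sphere of \<open>r\<close>-space at once; there the exponential is integrated over a shell around the sphere,
  instead of taking a union bound over a net (\<open>random_exp_cover_bound\<close>). The price is a factor \<open>(1 + 1/\<epsilon>)\<^sup>r\<close>, which \<open>n > 36 r\<close> and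
  \<open>l > 22 (r - 1)\<close> make affordable.
\<close>

section \<open>Norms, pseudo-inverses and orthogonal projections\<close>

lemma matrix_diff_ldistrib: "(A::real^'n^'m) ** (B - C) = A ** B - A ** C"
  by (simp add: vec_eq_iff matrix_matrix_mult_def right_diff_distrib sum_subtractf)

lemma matrix_diff_rdistrib: "((A::real^'n^'m) - B) ** C = A ** C - B ** C"
  by (simp add: vec_eq_iff matrix_matrix_mult_def left_diff_distrib sum_subtractf)

lemma matrix_add_rdistrib: "((A::real^'n^'m) + B) ** C = A ** C + B ** C"
  by (simp add: vec_eq_iff matrix_matrix_mult_def distrib_right sum.distrib)

lemma norm_matrix_sq: "(norm (A::real^'n^'m))\<^sup>2 = (\<Sum>i\<in>UNIV. (norm (A $ i))\<^sup>2)"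
  by (simp add: power2_norm_eq_inner inner_vec_def)

lemma norm_transpose: "norm (transpose (A::real^'n^'m)) = norm A"
proof -
  have "frobenius_norm (transpose A) = frobenius_norm A"
    unfolding frobenius_norm_def transpose_def by (subst sum.swap) simp
  then show ?thesis
    by (simp add: frobenius_norm_eq_norm)
qed

lemma row_matrix_mul: "((A::real^'n^'m) ** B) $ i = (A $ i) v* B"
  by (simp add: vec_eq_iff matrix_matrix_mult_def vector_matrix_mult_def mult.commute)

lemma axis_vector_matrix_mul: "axis i 1 v* (A::real^'n^'m) = A $ i"
proof -
  have "(mat 1 :: real^'m^'m) $ i = axis i 1" by (simp add: mat_def axis_def vec_eq_iff)
  then show ?thesis using row_matrix_mul[of "mat 1" A i] by simp
qed

lemma norm_matrix_mul_right_le: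
  fixes A :: "real^'n^'m" and B :: "real^'p^'n"
  assumes "\<And>x. norm (x v* B) \<le> c * norm x" and "c \<ge> 0"
  shows "norm (A ** B) \<le> c * norm A"
proof (rule power2_le_imp_le)
  have "(norm (A ** B))\<^sup>2 = (\<Sum>i\<in>UNIV. (norm ((A $ i) v* B))\<^sup>2)"
    by (simp add: norm_matrix_sq row_matrix_mul)
  also have "\<dots> \<le> (\<Sum>i\<in>UNIV. (c * norm (A $ i))\<^sup>2)"
    by (intro sum_mono power_mono assms) auto
  also have "\<dots> = (c * norm A)\<^sup>2"
    by (simp add: power_mult_distrib norm_matrix_sq sum_distrib_left)
  finally show "(norm (A ** B))\<^sup>2 \<le> (c * norm A)\<^sup>2" .
qed (use assms in auto)

lemma norm_matrix_mul_right_ge: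
  fixes A :: "real^'n^'m" and B :: "real^'p^'n"
  assumes "\<And>i. c * norm (A $ i) \<le> norm ((A $ i) v* B)" and "c \<ge> 0"
  shows "c * norm A \<le> norm (A ** B)"
proof (rule power2_le_imp_le)
  have "(c * norm A)\<^sup>2 = (\<Sum>i\<in>UNIV. (c * norm (A $ i))\<^sup>2)"
    by (simp add: power_mult_distrib norm_matrix_sq sum_distrib_left)
  also have "\<dots> \<le> (\<Sum>i\<in>UNIV. (norm ((A $ i) v* B))\<^sup>2)"
    by (intro sum_mono power_mono assms mult_nonneg_nonneg) auto
  also have "\<dots> = (norm (A ** B))\<^sup>2"
    by (simp add: norm_matrix_sq row_matrix_mul)
  finally show "(c * norm A)\<^sup>2 \<le> (norm (A ** B))\<^sup>2" .
qed auto

lemma norm_matrix_mul_left_le: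
  fixes A :: "real^'n^'m" and B :: "real^'p^'n"
  assumes "\<And>x. norm (A *v x) \<le> c * norm x" and "c \<ge> 0"
  shows "norm (A ** B) \<le> c * norm B"
  using norm_matrix_mul_right_le[of "transpose A" c "transpose B"] assms
  by (metis matrix_transpose_mul norm_transpose vector_transpose_matrix)

lemma norm_matrix_mul_left_ge:
  fixes A :: "real^'n^'m" and B :: "real^'p^'n"
  assumes "\<And>x. c * norm x \<le> norm (A *v x)" and "c \<ge> 0"
  shows "c * norm B \<le> norm (A ** B)"
  using norm_matrix_mul_right_ge[of c "transpose B" "transpose A"] assms
  by (metis matrix_transpose_mul norm_transpose vector_transpose_matrix)

lemma norm_vector_matrix_mul_le: "norm (x v* (A::real^'n^'m)) \<le> norm A * norm x"
proof -
  have "norm (matrix_vector_mult A y) \<le> norm A * norm y" for A :: "real^'a^'b" and y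
  proof (rule power2_le_imp_le)
    have "(norm (A *v y))\<^sup>2 = (\<Sum>i\<in>UNIV. ((A $ i) \<bullet> y)\<^sup>2)"
      unfolding power2_norm_eq_inner inner_vec_def[of "A *v y"] matrix_vector_mul_component
      by (simp add: power2_eq_square)
    also have "\<dots> \<le> (\<Sum>i\<in>UNIV. (norm (A $ i) * norm y)\<^sup>2)"
      by (intro sum_mono) (simp add: abs_le_square_iff[symmetric] Cauchy_Schwarz_ineq2 abs_mult)
    also have "\<dots> = (norm A * norm y)\<^sup>2"
      by (simp add: power_mult_distrib norm_matrix_sq sum_distrib_right)
    finally show "(norm (A *v y))\<^sup>2 \<le> (norm A * norm y)\<^sup>2" .
  qed auto
  from this[of "transpose A" x] show ?thesis by (simp add: norm_transpose)
qed

lemma norm_matrix_vector_mul_le: "norm ((A::real^'n^'m) *v x) \<le> norm A * norm x"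
  using norm_vector_matrix_mul_le[of x "transpose A"] by (simp add: norm_transpose)

text \<open>This rests on \<open>\<parallel>A\<^sup>T y\<parallel>\<^sup>2 = \<langle>y, A A\<^sup>T y\<rangle>\<close>; the first case shows \<open>c \<ge> 0\<close>.\<close>

lemma norm_vector_matrix_mul_le_onorm:
  fixes A :: "real^'n^'m"
  assumes "\<And>x. norm (A *v x) \<le> c * norm x"
  shows "norm (y v* A) \<le> c * norm y"
proof (cases "y v* A = 0")
  case True
  have "0 \<le> norm (A *v (\<chi> i. 1))" by simp
  also have "\<dots> \<le> c * norm ((\<chi> i. 1)::real^'n)" by (rule assms)
  finally have "0 \<le> c * norm ((\<chi> i. 1)::real^'n)" .
  moreover have "norm ((\<chi> i. 1)::real^'n) > 0" by (simp add: vec_eq_iff)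
  ultimately have "c \<ge> 0" by (simp add: zero_le_mult_iff)
  with True show ?thesis by simp
next
  case False
  let ?z = "y v* A"
  have "norm ?z * norm ?z = ?z \<bullet> ?z"
    by (simp add: dot_square_norm power2_eq_square)
  also have "\<dots> = y \<bullet> (A *v ?z)" by (rule dot_lmul_matrix)
  also have "\<dots> \<le> norm y * norm (A *v ?z)" by (rule norm_cauchy_schwarz)
  also have "\<dots> \<le> norm y * (c * norm ?z)" by (intro mult_left_mono assms) auto
  finally have "norm ?z * norm ?z \<le> (c * norm y) * norm ?z" by (simp add: mult_ac)
  with False show ?thesis by simp
qed

lemma spectral_norm_bound: "norm (A *v x) \<le> spectral_norm A * norm x"
  unfolding spectral_norm_def by (rule onorm) simp

lemma spectral_norm_le: "(\<And>x. norm (A *v x) \<le> c * norm x) \<Longrightarrow> spectral_norm A \<le> c"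
  unfolding spectral_norm_def by (rule onorm_le)

lemma spectral_norm_nonneg: "0 \<le> spectral_norm A"
  unfolding spectral_norm_def by (rule onorm_pos_le) simp

lemma spectral_le_frobenius: "spectral_norm A \<le> norm A"
  by (rule spectral_norm_le) (rule norm_matrix_vector_mul_le)

definition spectral_or_frobenius :: "(real^'n^'m \<Rightarrow> real) \<Rightarrow> bool" where
  "spectral_or_frobenius nrm \<longleftrightarrow> nrm = spectral_norm \<or> nrm = frobenius_norm"

lemma nrm_nonneg: "spectral_or_frobenius nrm \<Longrightarrow> 0 \<le> nrm A"
  by (auto simp: spectral_or_frobenius_def spectral_norm_nonneg frobenius_norm_eq_norm)

lemma nrm_triangle: 
  assumes "spectral_or_frobenius nrm" shows "nrm (A + B) \<le> nrm A + nrm B"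
  using assms unfolding spectral_or_frobenius_def
proof
  assume n: "nrm = spectral_norm"
  show ?thesis unfolding n
    using onorm_triangle[of "(*v) A" "(*v) B"]
    by (simp add: spectral_norm_def matrix_vector_mult_add_rdistrib[abs_def])
qed (simp add: frobenius_norm_eq_norm norm_triangle_ineq)

lemma nrm_minus: "spectral_or_frobenius nrm \<Longrightarrow> nrm (- A) = nrm A"
proof -
  have "(*v) (-A) = (\<lambda>x. - (A *v x))"
    by (auto simp: fun_eq_iff vec_eq_iff matrix_vector_mult_def sum_negf)
  then have "spectral_norm (-A) = spectral_norm A"
    by (simp add: spectral_norm_def onorm_neg)
  then show "spectral_or_frobenius nrm \<Longrightarrow> nrm (- A) = nrm A"
    by (auto simp: spectral_or_frobenius_def frobenius_norm_eq_norm)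
qed

lemma nrm_le_norm: "spectral_or_frobenius nrm \<Longrightarrow> nrm A \<le> norm A"
  by (auto simp: spectral_or_frobenius_def frobenius_norm_eq_norm spectral_le_frobenius)

lemma spectral_le_nrm: "spectral_or_frobenius nrm \<Longrightarrow> spectral_norm A \<le> nrm A"
  by (auto simp: spectral_or_frobenius_def frobenius_norm_eq_norm spectral_le_frobenius)

lemma nrm_bound: "spectral_or_frobenius nrm \<Longrightarrow> norm (A *v x) \<le> nrm A * norm x"
  by (rule order_trans[OF spectral_norm_bound mult_right_mono[OF spectral_le_nrm]]) auto

lemma nrm_diff_le:
  assumes "spectral_or_frobenius nrm" shows "\<bar>nrm A - nrm B\<bar> \<le> norm (A - B)"
  using nrm_triangle[OF assms, of B "A - B"] nrm_triangle[OF assms, of A "-(A - B)"]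
    nrm_minus[OF assms, of "A - B"] nrm_le_norm[OF assms, of "A - B"]
  by (simp add: abs_le_iff)

lemma continuous_nrm:
  assumes "spectral_or_frobenius nrm" shows "continuous_on UNIV nrm"
proof -
  have "1-lipschitz_on UNIV nrm"
    by (rule lipschitz_onI) (use nrm_diff_le[OF assms] in \<open>auto simp: dist_norm\<close>)
  then show ?thesis by (rule lipschitz_on_continuous_on)
qed

lemma nrm_mul_right_le:
  assumes nrm: "spectral_or_frobenius nrm" and "\<And>x. norm (P *v x) \<le> c * norm x" "c \<ge> 0"
  shows "nrm (A ** P) \<le> c * nrm A"
  using nrm unfolding spectral_or_frobenius_def
proof
  assume n: "nrm = spectral_norm"
  show ?thesis unfolding n
  proof (rule spectral_norm_le)
    fix x
    have "norm (A *v (P *v x)) \<le> spectral_norm A * (c * norm x)"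
      by (rule order_trans[OF spectral_norm_bound mult_left_mono]) 
        (auto simp: assms spectral_norm_nonneg)
    then show "norm ((A ** P) *v x) \<le> c * spectral_norm A * norm x"
      by (simp add: matrix_vector_mul_assoc mult_ac)
  qed
next
  assume n: "nrm = frobenius_norm"
  show ?thesis unfolding n frobenius_norm_eq_norm
    by (intro norm_matrix_mul_right_le norm_vector_matrix_mul_le_onorm assms)
qed

lemma nrm_mul_left_le:
  assumes nrm: "spectral_or_frobenius nrm" and "\<And>x. norm (P *v x) \<le> c * norm x" "c \<ge> 0"
  shows "nrm (P ** A) \<le> c * nrm A"
  using nrm unfolding spectral_or_frobenius_def
proof
  assume n: "nrm = spectral_norm"
  show ?thesis unfolding n
  proof (rule spectral_norm_le)
    fix x
    have "norm (P *v (A *v x)) \<le> c * (spectral_norm A * norm x)"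
      by (rule order_trans[OF assms(2) mult_left_mono[OF spectral_norm_bound]]) (rule assms)
    then show "norm ((P ** A) *v x) \<le> c * spectral_norm A * norm x"
      by (simp add: matrix_vector_mul_assoc mult_ac)
  qed
next
  assume n: "nrm = frobenius_norm"
  show ?thesis unfolding n frobenius_norm_eq_norm
    by (intro norm_matrix_mul_left_le assms)
qed

text \<open>Symmetric idempotents are the orthogonal projections.\<close>

definition orth_proj :: "real^'n^'n \<Rightarrow> bool" where
  "orth_proj P \<longleftrightarrow> transpose P = P \<and> P ** P = P"

lemma orth_proj_vector_matrix: "orth_proj P \<Longrightarrow> x v* P = P *v x"
  by (metis orth_proj_def vector_transpose_matrix)

lemma orth_proj_inner: "orth_proj P \<Longrightarrow> x \<bullet> (P *v y) = (P *v x) \<bullet> y"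
  by (metis dot_lmul_matrix orth_proj_vector_matrix)

lemma orth_proj_idem: "orth_proj P \<Longrightarrow> P *v (P *v x) = P *v x"
  by (simp add: matrix_vector_mul_assoc orth_proj_def)

lemma orth_proj_pythagoras:
  assumes "orth_proj P"
  shows "(norm x)\<^sup>2 = (norm (P *v x))\<^sup>2 + (norm (x - P *v x))\<^sup>2"
  using orth_proj_inner[OF assms, of x "P *v x"] orth_proj_idem[OF assms, of x]
  by (simp add: power2_norm_eq_inner inner_diff_left inner_diff_right inner_commute)

lemma orth_proj_norm_le: "orth_proj P \<Longrightarrow> norm (P *v x) \<le> norm x"
  using orth_proj_pythagoras[of P x] by (simp add: power2_le_imp_le)

lemma orth_proj_compl: "orth_proj P \<Longrightarrow> orth_proj (mat 1 - P)"
proof -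
  assume P: "orth_proj P"
  have "transpose (mat 1 - P) = mat 1 - transpose P"
    by (auto simp: vec_eq_iff transpose_def mat_def)
  moreover have "(mat 1 - P) ** (mat 1 - P) = mat 1 - P"
    by (simp add: matrix_eq matrix_vector_mul_assoc[symmetric] matrix_vector_mult_diff_rdistrib
        matrix_vector_mult_diff_distrib orth_proj_idem[OF P])
  ultimately show ?thesis
    using P by (simp add: orth_proj_def)
qed

lemma orth_proj_compl_apply: "(mat 1 - P) *v x = x - P *v (x::real^'n)"
  by (simp add: matrix_vector_mult_diff_rdistrib)

lemma norm_sq_split_orth_proj:
  fixes A :: "real^'n^'m"
  assumes "orth_proj P"
  shows "(norm A)\<^sup>2 = (norm (A ** P))\<^sup>2 + (norm (A ** (mat 1 - P)))\<^sup>2"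
  unfolding norm_matrix_sq row_matrix_mul orth_proj_vector_matrix[OF assms]
    orth_proj_vector_matrix[OF orth_proj_compl[OF assms]] orth_proj_compl_apply sum.distrib[symmetric]
  by (intro sum.cong refl orth_proj_pythagoras assms)

text \<open>
  The products \<open>P A\<close> and \<open>Q A\<close> are symmetric and each absorbs the other, so they agree; likewise
  \<open>A P = A Q\<close>. Then \<open>P = P A P = Q A Q = Q\<close>.
\<close>

lemma is_pinv_unique:
  fixes A :: "real^'n^'m"
  assumes "is_pinv A P" "is_pinv A Q"
  shows "P = Q"
proof -
  note p = assms(1)[unfolded is_pinv_def] and q = assms(2)[unfolded is_pinv_def]
  have "P ** A = transpose (Q ** A ** (P ** A))" 
  proof -
    have "transpose (Q ** A ** (P ** A)) = P ** A ** (Q ** A)"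
      using p q by (simp add: matrix_transpose_mul)
    also have "\<dots> = P ** (A ** Q ** A)" by (simp add: matrix_mul_assoc)
    finally show ?thesis using q by simp
  qed
  also have "Q ** A ** (P ** A) = Q ** (A ** P ** A)" by (simp add: matrix_mul_assoc)
  also have "transpose \<dots> = Q ** A" using p q by simp
  finally have 1: "P ** A = Q ** A" .
  have "A ** P = transpose (A ** P ** (A ** Q))"
  proof -
    have "transpose (A ** P ** (A ** Q)) = A ** Q ** (A ** P)"
      using p q by (simp add: matrix_transpose_mul)
    also have "\<dots> = (A ** Q ** A) ** P" by (simp add: matrix_mul_assoc)
    finally show ?thesis using q by simp
  qed
  also have "A ** P ** (A ** Q) = (A ** P ** A) ** Q" by (simp add: matrix_mul_assoc)
  also have "transpose \<dots> = A ** Q" using p q by simp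
  finally have 2: "A ** P = A ** Q" .
  have "P = (P ** A) ** P" using p by simp
  also have "\<dots> = Q ** (A ** P)" by (simp add: 1 matrix_mul_assoc)
  also have "\<dots> = Q" using 2 q by (simp add: matrix_mul_assoc)
  finally show ?thesis .
qed

lemma orth_proj_onto:
  fixes S :: "(real^'n) set"
  assumes "subspace S"
  obtains P where "orth_proj P" "\<And>x. P *v x \<in> S" "\<And>x. x \<in> S \<Longrightarrow> P *v x = x"
proof -
  obtain B where B: "B \<subseteq> S" "pairwise orthogonal B" "\<And>x. x \<in> B \<Longrightarrow> norm x = 1" "independent B"
    "span B = S" using orthonormal_basis_subspace[OF assms] by metis
  have fin: "finite B" using B(4) independent_imp_finite by blast
  define f where "f x = (\<Sum>e\<in>B. (e \<bullet> x) *\<^sub>R e)" for x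
  have lin: "linear f"
    by (rule linearI) (auto simp: f_def inner_right_distrib algebra_simps sum.distrib scaleR_sum_right)
  have fb: "f e = e" if "e \<in> B" for e
  proof -
    have "f e = (\<Sum>d\<in>B. if d = e then e else 0)" unfolding f_def
      by (intro sum.cong refl) (use B that in \<open>auto simp: pairwise_def orthogonal_def norm_eq_1\<close>)
    then show ?thesis using fin that by simp
  qed
  have inS: "f x \<in> S" for x
    unfolding f_def using B assms by (intro subspace_sum) (auto intro: subspace_scale)
  have fS: "f x = x" if "x \<in> S" for x
    using that unfolding B(5)[symmetric]
    by (induction rule: span_induct_alt) (auto simp: linear_0[OF lin] linear_add[OF lin] linear_scale[OF lin] fb)
  have sym: "x \<bullet> f y = f x \<bullet> y" for x y
    by (simp add: f_def inner_sum_left inner_sum_right inner_commute mult.commute)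
  define P where "P = matrix f"
  have Pf: "P *v x = f x" for x by (simp add: P_def lin matrix_works)
  show ?thesis
  proof
    have "x \<bullet> (transpose P *v y) = x \<bullet> (P *v y)" for x y
      using sym[of x y] by (simp add: Pf inner_commute[of x] dot_lmul_matrix) (simp add: inner_commute)
    then have "transpose P *v y = P *v y" for y by (metis vector_eq_rdot inner_commute)
    then have "transpose P = P" by (simp add: matrix_eq)
    moreover have "P ** P = P"
      by (simp add: matrix_eq matrix_vector_mul_assoc[symmetric] Pf fS inS)
    ultimately show "orth_proj P" by (simp add: orth_proj_def)
  qed (auto simp: Pf inS fS)
qed

text \<open>
  \<open>A\<close> maps the orthogonal complement \<open>S\<close> of its kernel bijectively to its range. The pseudo-inverse
  is the inverse of this bijection, after orthogonal projection to the range.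
\<close>

lemma pinv_exists: "\<exists>P. is_pinv (A::real^'n^'m) P"
proof -
  obtain K where K: "orth_proj K" "\<And>x. K *v x \<in> {k. A *v k = 0}"
    "\<And>x. x \<in> {k. A *v k = 0} \<Longrightarrow> K *v x = x"
    using orth_proj_onto[OF linear_subspace_kernel[OF matrix_vector_mul_linear[of A]]] by metis
  define Q where "Q = mat 1 - K"
  define S where "S = {x. K *v x = 0}"
  have Q: "orth_proj Q" "\<And>x. Q *v x \<in> S" "\<And>x. x \<in> S \<Longrightarrow> Q *v x = x"
    using orth_proj_compl[OF K(1)] orth_proj_idem[OF K(1)]
    by (auto simp: Q_def S_def orth_proj_compl_apply matrix_vector_mult_diff_distrib)
  have subS: "subspace S" unfolding S_def by (rule linear_subspace_kernel) simp
  have AQ: "A *v (Q *v x) = A *v x" for x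
    using K(2)[of x] by (simp add: Q_def orth_proj_compl_apply matrix_vector_mult_diff_distrib)
  have inj: "inj_on ((*v) A) S"
  proof (rule inj_onI)
    fix x y assume xy: "x \<in> S" "y \<in> S" "A *v x = A *v y"
    then have "K *v (x - y) = x - y" by (intro K(3)) (simp add: matrix_vector_mult_diff_distrib)
    then show "x = y" using xy by (simp add: S_def matrix_vector_mult_diff_distrib)
  qed
  obtain g where g: "range g \<subseteq> S" "linear g" "\<And>v. v \<in> S \<Longrightarrow> g (A *v v) = v"
    using linear_exists_left_inverse_on[OF matrix_vector_mul_linear[of A] subS inj] by blast
  obtain R where R: "orth_proj R" "\<And>x. R *v x \<in> range ((*v) A)" "\<And>x. R *v (A *v x) = A *v x"
    using orth_proj_onto[of "range ((*v) A)"] by (metis linear_subspace_image matrix_vector_mul_linear rangeI subspace_UNIV)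
  define P where "P = matrix g ** R"
  have gA: "matrix g *v (A *v x) = Q *v x" for x
    using g(3)[OF Q(2), of x] AQ[of x] by (simp add: g(2) matrix_works)
  have PA: "P ** A = Q"
    by (simp add: matrix_eq P_def matrix_vector_mul_assoc[symmetric] R gA)
  have AP: "A ** P = R"
  proof (simp add: matrix_eq P_def matrix_vector_mul_assoc[symmetric], rule allI)
    fix x obtain y where y: "R *v x = A *v y" using R(2) by blast
    show "A *v (matrix g *v (R *v x)) = R *v x" unfolding y gA AQ ..
  qed
  have "A ** P ** A = A" unfolding AP by (simp add: matrix_eq matrix_vector_mul_assoc[symmetric] R)
  moreover have "P ** A ** P = P" unfolding PA
    using Q(3) g(1) by (auto simp: matrix_eq P_def matrix_vector_mul_assoc[symmetric] g(2) matrix_works)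
  ultimately have "is_pinv A P"
    using Q(1) R(1) unfolding is_pinv_def PA AP orth_proj_def by simp
  then show ?thesis ..
qed

lemma is_pinv_pinv: "is_pinv A (pinv A)"
  unfolding pinv_def by (rule theI') (metis pinv_exists is_pinv_unique)

lemma pinv_mul_mul: "A ** pinv A ** A = A"
  using is_pinv_pinv[of A] by (simp add: is_pinv_def)

lemma orth_proj_range: "orth_proj (A ** pinv A)"
  using is_pinv_pinv[of A] by (simp add: is_pinv_def orth_proj_def matrix_mul_assoc)

lemma orth_proj_corange: "orth_proj (pinv A ** A)"
  using is_pinv_pinv[of A] by (simp add: is_pinv_def orth_proj_def matrix_mul_assoc)

section \<open>The deterministic error bound\<close>

text \<open>
  \<open>1 - X X\<^sup>+\<close> is a contraction that annihilates \<open>X N\<close>.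
\<close>

lemma range_finder_error_le:
  assumes "spectral_or_frobenius nrm"
  shows "nrm (M - X ** (pinv X ** M)) \<le> nrm (M - X ** N)"
proof -
  let ?J = "mat 1 - X ** pinv X"
  have "M - X ** (pinv X ** M) = ?J ** (M - X ** N)"
    by (simp add: matrix_diff_ldistrib matrix_diff_rdistrib matrix_mul_assoc pinv_mul_mul)
  moreover have "nrm (?J ** (M - X ** N)) \<le> 1 * nrm (M - X ** N)"
    using orth_proj_norm_le[OF orth_proj_compl[OF orth_proj_range[of X]]]
    by (intro nrm_mul_left_le assms) auto
  ultimately show ?thesis by simp
qed

lemma
  fixes A :: "real^'n^'n"
  assumes "invertible A"
  shows matrix_inv_right_id: "A ** matrix_inv A = mat 1"
    and matrix_inv_left_id: "matrix_inv A ** A = mat 1"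
  using someI_ex[OF assms[unfolded invertible_def]] unfolding matrix_inv_def by auto

text \<open>
  The factor \<open>T\<^sup>-\<^sup>1\<close> leaves the range of the sketch unchanged: \<open>M H N = X (T N)\<close>.
\<close>

lemma range_finder_error_le_sketch:
  fixes T :: "real^'l^'l"
  assumes "spectral_or_frobenius nrm" and "invertible T" and X: "X = M ** H ** matrix_inv T"
  shows "nrm (M - X ** (pinv X ** M)) \<le> nrm (M - M ** H ** N)"
proof -
  have "X ** (T ** N) = M ** H ** (matrix_inv T ** T) ** N"
    by (simp add: X matrix_mul_assoc)
  then show ?thesis
    using range_finder_error_le[OF assms(1), of M X "T ** N"]
    by (simp add: matrix_inv_left_id[OF assms(2)])
qed

lemma bessel:
  fixes D :: "'a::real_inner set"
  assumes "finite D" "pairwise orthogonal D" "\<And>e. e \<in> D \<Longrightarrow> norm e = 1"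
  shows "(\<Sum>e\<in>D. (e \<bullet> x)\<^sup>2) \<le> (norm x)\<^sup>2"
proof -
  define y where "y = (\<Sum>e\<in>D. (e \<bullet> x) *\<^sub>R e)"
  have ye: "e \<bullet> y = e \<bullet> x" if "e \<in> D" for e
  proof -
    have "e \<bullet> y = (\<Sum>d\<in>D. if d = e then e \<bullet> x else 0)"
      unfolding y_def inner_sum_right
      by (intro sum.cong refl) (use assms that in \<open>auto simp: pairwise_def orthogonal_def norm_eq_1\<close>)
    then show ?thesis using assms that by simp
  qed
  have "y \<bullet> x = (\<Sum>e\<in>D. (e \<bullet> x)\<^sup>2)"
    by (simp add: y_def inner_sum_left power2_eq_square)
  moreover have "y \<bullet> y = (\<Sum>e\<in>D. (e \<bullet> x)\<^sup>2)"
    by (subst (1) y_def) (simp add: inner_sum_left power2_eq_square ye)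
  moreover have "0 \<le> (x - y) \<bullet> (x - y)" by simp
  ultimately show ?thesis
    by (simp add: power2_norm_eq_inner inner_diff_left inner_diff_right inner_commute)
qed

text \<open>
  \<open>P R\<close> is the oblique projection along the kernel of \<open>C\<close>, with \<open>R = B\<^sup>T (B P B\<^sup>T)\<^sup>-\<^sup>1 C\<close>. Since \<open>C\<close>
  and \<open>B\<close> agree on the range of \<open>P\<close>, the Gram matrix \<open>B P B\<^sup>T\<close> only sees the unperturbed factor \<open>B\<close>,
  and its smallest eigenvalue is at least \<open>c\<^sup>2\<close>.
\<close>

lemma oblique_projection:
  fixes B C :: "real^'n^'r" and P :: "real^'n^'n"
  assumes P: "orth_proj P" and CB: "C ** P = B ** P"
    and c: "c > 0" "\<And>y. c * norm y \<le> norm (P *v (y v* B))"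
    and b: "\<And>x. norm (C *v x) \<le> b * norm x"
  obtains R where "C ** (P ** R) = C" "\<And>x. norm ((P ** R) *v x) \<le> b / c * norm x"
proof
  define W where "W = B ** P ** transpose B"
  have W: "W *v y = B *v (P *v (y v* B))" for y
    by (simp add: W_def matrix_vector_mul_assoc[symmetric])
  have WP: "y \<bullet> (W *v y) = (norm (P *v (y v* B)))\<^sup>2" for y
    using orth_proj_inner[OF P, of "y v* B" "P *v (y v* B)"] orth_proj_idem[OF P]
    by (simp add: W dot_lmul_matrix[symmetric] power2_norm_eq_inner)
  have "inj ((*v) W)"
    unfolding linear_injective_0[OF matrix_vector_mul_linear]
  proof safe
    fix y assume "W *v y = 0"
    then have "P *v (y v* B) = 0" using WP[of y] by simp
    with c(2)[of y] c(1) show "y = 0" by (simp add: mult_le_0_iff)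
  qed
  then have inv: "invertible W"
    by (simp add: invertible_left_inverse matrix_left_invertible_injective)
  define R where "R = transpose B ** matrix_inv W ** C"
  have "C ** (P ** R) = (C ** P) ** R" by (simp add: matrix_mul_assoc)
  also have "\<dots> = (W ** matrix_inv W) ** C"
    unfolding CB R_def W_def by (simp add: matrix_mul_assoc)
  finally show "C ** (P ** R) = C" by (simp add: matrix_inv_right_id[OF inv])
  fix x
  define z where "z = matrix_inv W *v (C *v x)"
  let ?p = "norm (P *v (z v* B))"
  have "W *v z = C *v x"
    by (simp add: z_def matrix_vector_mul_assoc matrix_mul_assoc matrix_inv_right_id[OF inv])
  then have "?p\<^sup>2 = z \<bullet> (C *v x)" using WP[of z] by simp
  also have "\<dots> \<le> norm z * norm (C *v x)" by (rule norm_cauchy_schwarz)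
  also have "\<dots> \<le> (?p / c) * (b * norm x)"
    using c(2)[of z] c(1) by (intro mult_mono b) (auto simp: field_simps)
  finally have "?p * ?p \<le> ?p * (b / c * norm x)" by (simp add: power2_eq_square)
  moreover have "0 \<le> b / c * norm x"
    using order_trans[OF norm_ge_zero b[of x]] c(1) by (simp add: field_simps)
  ultimately have "?p \<le> b / c * norm x"
    by (cases "?p = 0") (simp, metis mult_le_cancel_left_pos norm_ge_zero order_le_less)
  then show "norm ((P ** R) *v x) \<le> b / c * norm x"
    by (simp add: R_def z_def matrix_vector_mul_assoc[symmetric])
qed

text \<open>
  Let \<open>W\<close> be the projection to the kernel of \<open>N\<close> and \<open>P = 1 - W\<close>, of rank at most \<open>r\<close>. Suppose the
  error \<open>t\<close> is below \<open>\<phi> / 2\<close>. Since \<open>(A C + F) W\<close> has norm at most \<open>t\<close> and the columns of \<open>A\<close> and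
  \<open>F\<close> are orthogonal, both \<open>C W\<close> and \<open>F' W\<close> are small, where \<open>F' = J F\<close>. So most of \<open>F'\<close> is in \<open>F' P\<close>.
  As \<open>C W\<close> is small, \<open>P C\<^sup>T\<close> is bounded below, hence onto the range of \<open>P\<close> by dimension, and
  \<open>F' P C\<^sup>T\<close> has to be large. But \<open>F' P C\<^sup>T = F' B\<^sup>T + F' Z\<^sup>T - F' W C\<^sup>T\<close> is a sum of three small
  terms. The factor \<open>J\<close> allows the comparison to be made in the Frobenius norm for either norm.
\<close>

lemma best_low_rank_error_ge:
  fixes A :: "real^'r^'m" and B Z :: "real^'n^'r" and F N :: "real^'n^'m" and J :: "real^'m^'m"
  defines "C \<equiv> B + Z"
  defines "\<phi> \<equiv> norm (J ** F)"
  assumes nrm: "spectral_or_frobenius nrm"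
    and A: "\<sigma> > 0" "\<And>x. \<sigma> * norm x \<le> norm (A *v x)"
    and F: "transpose A ** F = 0" and \<phi>: "\<phi> \<le> \<sigma> / 12"
    and J: "J ** A = 0" "\<And>X::real^'n^'m. norm (J ** X) \<le> nrm X"
    and Z: "norm Z \<le> 1 / 12"
    and Blow: "\<And>y. 4 / 10 * (norm y)\<^sup>2 \<le> (norm (y v* B))\<^sup>2"
    and BF: "(norm (B ** transpose (J ** F)))\<^sup>2 \<le> 13 / 100 * \<phi>\<^sup>2"
    and N: "rank N \<le> CARD('r)"
  shows "\<phi> / 2 \<le> nrm (A ** C + F - N)"
proof (rule ccontr)
  define M where "M = A ** C + F"
  define t where "t = nrm (M - N)"
  assume "\<not> ?thesis"
  then have t: "t < \<phi> / 2" by (simp add: t_def M_def)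
  have t0: "0 \<le> t" unfolding t_def by (rule nrm_nonneg[OF nrm])
  with t have \<phi>0: "\<phi> > 0" by simp
  define P where "P = pinv N ** N"
  define W where "W = mat 1 - P"
  have P: "orth_proj P" unfolding P_def by (rule orth_proj_corange)
  have W: "orth_proj W" unfolding W_def by (rule orth_proj_compl[OF P])
  have Wx: "W *v x = x - P *v x" for x unfolding W_def by (rule orth_proj_compl_apply)
  have "N *v (W *v x) = 0" for x
    using arg_cong[OF pinv_mul_mul[of N], of "\<lambda>A. A *v x"]
    by (simp add: Wx P_def matrix_vector_mult_diff_distrib matrix_vector_mul_assoc matrix_mul_assoc)
  then have "M ** W = (M - N) ** W"
    by (simp add: matrix_eq matrix_vector_mul_assoc[symmetric] matrix_vector_mult_diff_rdistrib)
  then have MW: "nrm (M ** W) \<le> t"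
    using nrm_mul_right_le[OF nrm, of W 1 "M - N"] orth_proj_norm_le[OF W] by (simp add: t_def)
  have CW: "norm (C *v (W *v x)) \<le> 1 / 24 * norm x" for x
  proof -
    let ?u = "C *v (W *v x)" and ?v = "W *v x"
    have "(A *v ?u) \<bullet> (F *v ?v) = ?u \<bullet> (transpose A *v (F *v ?v))"
      using dot_lmul_matrix[of "F *v ?v" A ?u] by (simp add: inner_commute)
    also have "transpose A *v (F *v ?v) = 0"
      by (simp only: matrix_vector_mul_assoc[of "transpose A" F] F matrix_vector_mult_0)
    finally have orth: "orthogonal (A *v ?u) (F *v ?v)" unfolding orthogonal_def by simp
    have "norm (A *v ?u) \<le> norm (A *v ?u + F *v ?v)"
      by (rule power2_le_imp_le) (simp_all only: norm_add_Pythagorean[OF orth] le_add_same_cancel1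
          zero_le_power2 norm_ge_zero)
    also have "A *v ?u + F *v ?v = (M ** W) *v x"
      by (simp add: M_def matrix_vector_mult_add_rdistrib matrix_vector_mul_assoc[symmetric])
    also have "norm \<dots> \<le> nrm (M ** W) * norm x" by (rule nrm_bound[OF nrm])
    also have "\<dots> \<le> (\<sigma> / 24) * norm x"
      by (intro mult_right_mono) (use MW t \<phi> in auto)
    finally have "\<sigma> * norm ?u \<le> \<sigma> * (1 / 24 * norm x)"
      using A(2)[of ?u] by simp
    then show ?thesis using A(1) by simp
  qed
  define F' where "F' = J ** F"
  have nF': "norm F' = \<phi>" by (simp add: F'_def \<phi>_def)
  have "F' = J ** M"
    by (simp add: F'_def M_def matrix_add_ldistrib matrix_mul_assoc J(1))
  then have F'W: "norm (F' ** W) \<le> t"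
    using J(2)[of "M ** W"] MW by (simp add: matrix_mul_assoc)
  \<comment> \<open>\<open>866/1000\<close> is just below \<open>\<surd>(1 - 1/4)\<close>.\<close>
  have F'P: "866 / 1000 * \<phi> \<le> norm (F' ** P)"
  proof (rule power2_le_imp_le)
    have "(norm (F' ** W))\<^sup>2 \<le> (\<phi> / 2)\<^sup>2"
      using F'W t by (intro power_mono) auto
    then have "3 / 4 * \<phi>\<^sup>2 \<le> (norm (F' ** P))\<^sup>2"
      using norm_sq_split_orth_proj[OF P, of F'] unfolding nF' W_def[symmetric] power_divide by simp
    then show "(866 / 1000 * \<phi>)\<^sup>2 \<le> (norm (F' ** P))\<^sup>2"
      unfolding power_mult_distrib
      by (rule order_trans[rotated]) (intro mult_right_mono, auto simp: power2_eq_square)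
  qed simp
  \<comment> \<open>\<open>549/1000 < \<surd>(4/10) - 1/12\<close>, and \<open>547/1000\<close> remains after the loss of \<open>1/24\<close> by Pythagoras.\<close>
  have CP: "547 / 1000 * norm y \<le> norm (P *v (y v* C))" for y
  proof (rule power2_le_imp_le)
    have "6324 / 10000 * norm y \<le> norm (y v* B)"
    proof (rule power2_le_imp_le)
      show "(6324 / 10000 * norm y)\<^sup>2 \<le> (norm (y v* B))\<^sup>2"
        unfolding power_mult_distrib
        by (rule order_trans[OF _ Blow]) (intro mult_right_mono, auto simp: power2_eq_square)
    qed simp
    moreover have "norm (y v* Z) \<le> 1 / 12 * norm y"
      by (rule order_trans[OF norm_vector_matrix_mul_le mult_right_mono[OF Z]]) simp
    ultimately have "549 / 1000 * norm y \<le> norm (y v* B + y v* Z)"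
      using norm_diff_ineq[of "y v* B" "y v* Z"] norm_ge_zero[of y] by linarith
    then have "549 / 1000 * norm y \<le> norm (y v* C)"
      by (simp add: C_def vector_matrix_mult_add_rdistrib)
    then have 1: "(549 / 1000 * norm y)\<^sup>2 \<le> (norm (y v* C))\<^sup>2"
      by (intro power_mono) auto
    have "norm (y v* (C ** W)) \<le> 1 / 24 * norm y"
      by (rule norm_vector_matrix_mul_le_onorm) (use CW in \<open>simp add: matrix_vector_mul_assoc\<close>)
    then have "(norm (W *v (y v* C)))\<^sup>2 \<le> (1 / 24 * norm y)\<^sup>2"
      by (intro power_mono) (auto simp: vector_matrix_mul_assoc[symmetric] orth_proj_vector_matrix[OF W])
    then have 2: "(norm (y v* C - P *v (y v* C)))\<^sup>2 \<le> 1 / 576 * (norm y)\<^sup>2"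
      by (simp add: Wx power_mult_distrib power_divide)
    have "301401 / 1000000 * (norm y)\<^sup>2 \<le> (norm (y v* C))\<^sup>2"
      using 1 by (simp add: power_mult_distrib power_divide)
    moreover have "(547 / 1000 * norm y)\<^sup>2 = 299209 / 1000000 * (norm y)\<^sup>2"
      by (simp add: power_mult_distrib power_divide)
    ultimately show "(547 / 1000 * norm y)\<^sup>2 \<le> (norm (P *v (y v* C)))\<^sup>2"
      using 2 orth_proj_pythagoras[OF P, of "y v* C"] zero_le_power2[of "norm y"] by linarith
  qed simp
  have C_low: "547 / 1000 * norm v \<le> norm (C *v v)" if v: "P *v v = v" for v
  proof -
    define f where "f y = P *v (y v* C)" for y
    have f: "f = (*v) (P ** transpose C)"
      by (simp add: f_def fun_eq_iff matrix_vector_mul_assoc[symmetric])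
    have lin: "linear f" unfolding f by simp
    have inj: "inj f" unfolding linear_injective_0[OF lin]
    proof safe
      fix y assume "f y = 0"
      with CP[of y] show "y = 0" by (simp add: f_def)
    qed
    have "dim (range f) = CARD('r)"
      using dim_image_eq[OF lin, of UNIV] inj by simp
    moreover have "dim (range ((*v) P)) \<le> CARD('r)"
      using rank_mul_le_right[of "pinv N" N] N by (simp add: rank_dim_range P_def)
    moreover have "range f \<subseteq> range ((*v) P)" by (auto simp: f_def)
    moreover have "subspace (range f)" "subspace (range ((*v) P))"
      using lin by (auto intro: linear_subspace_image)
    ultimately have "range f = range ((*v) P)" by (intro subspace_dim_equal) auto
    with v obtain y where y: "v = f y" by (metis rangeE rangeI)
    have "norm v * norm v = v \<bullet> (P *v (y v* C))"
      using y by (simp add: f_def power2_eq_square[symmetric] power2_norm_eq_inner)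
    also have "\<dots> = y \<bullet> (C *v v)"
      unfolding orth_proj_inner[OF P] v inner_commute[of v] by (rule dot_lmul_matrix)
    also have "\<dots> \<le> norm y * norm (C *v v)" by (rule norm_cauchy_schwarz)
    also have "\<dots> \<le> (norm v * (1000 / 547)) * norm (C *v v)"
      using CP[of y] by (intro mult_right_mono) (auto simp: y f_def)
    finally have "norm v * (547 / 1000 * norm v) \<le> norm v * norm (C *v v)"
      by (simp add: mult_ac)
    then show ?thesis by (cases "v = 0") auto
  qed
  \<comment> \<open>The contradiction: \<open>0.866 \<sqdot> 0.547 > 0.3606 + 1/12 + 1/48\<close>, where \<open>0.3606 > \<surd>(13/100)\<close>.\<close>
  have "866 / 1000 * 547 / 1000 * \<phi> \<le> 547 / 1000 * norm (F' ** P)"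
    using F'P by simp
  also have "\<dots> \<le> norm (F' ** P ** transpose C)"
  proof (rule norm_matrix_mul_right_ge)
    fix i
    have "P *v ((F' ** P) $ i) = (F' ** P) $ i"
      by (simp add: row_matrix_mul orth_proj_vector_matrix[OF P] orth_proj_idem[OF P])
    from C_low[OF this] show "547 / 1000 * norm ((F' ** P) $ i) \<le> norm (((F' ** P) $ i) v* transpose C)"
      by simp
  qed simp
  also have "F' ** P ** transpose C = F' ** transpose B + F' ** transpose Z - (F' ** W) ** (W ** transpose C)"
  proof -
    have "transpose C = transpose B + transpose Z" by (simp add: C_def vec_eq_iff transpose_def)
    moreover have "(F' ** W) ** (W ** transpose C) = F' ** (W ** W) ** transpose C"
      by (simp add: matrix_mul_assoc)
    moreover have "W ** W = W" using W by (simp add: orth_proj_def)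
    moreover have "F' ** W ** transpose C = F' ** transpose C - F' ** P ** transpose C"
      by (simp add: W_def matrix_diff_ldistrib matrix_diff_rdistrib)
    ultimately show ?thesis by (simp add: matrix_add_ldistrib)
  qed
  also have "norm \<dots> \<le> norm (F' ** transpose B) + norm (F' ** transpose Z) + norm ((F' ** W) ** (W ** transpose C))"
    by (rule order_trans[OF norm_triangle_ineq4 add_right_mono[OF norm_triangle_ineq]])
  also have "norm (F' ** transpose B) \<le> 3606 / 10000 * \<phi>"
  proof (rule power2_le_imp_le)
    have "norm (F' ** transpose B) = norm (B ** transpose F')"
      by (metis matrix_transpose_mul norm_transpose transpose_transpose)
    then have "(norm (F' ** transpose B))\<^sup>2 \<le> 13 / 100 * \<phi>\<^sup>2"
      using BF by (simp add: F'_def)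
    then show "(norm (F' ** transpose B))\<^sup>2 \<le> (3606 / 10000 * \<phi>)\<^sup>2"
      unfolding power_mult_distrib
      by (rule order_trans) (intro mult_right_mono, auto simp: power2_eq_square)
  qed (use \<phi>0 in simp)
  also have "norm (F' ** transpose Z) \<le> 1 / 12 * \<phi>"
    using norm_matrix_mul_right_le[of "transpose Z" "1/12" F'] nF'
      order_trans[OF norm_matrix_vector_mul_le mult_right_mono[OF Z]] by simp
  also have "norm ((F' ** W) ** (W ** transpose C)) \<le> 1 / 24 * norm (F' ** W)"
    by (intro norm_matrix_mul_right_le)
       (use CW in \<open>auto simp: vector_matrix_mul_assoc[symmetric] orth_proj_vector_matrix[OF W]\<close>)
  finally show False using \<phi>0 F'W t by simp
qed

lemma dim_kernel_ge:
  fixes A :: "real^'l^'r"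
  shows "CARD('l) - CARD('r) \<le> dim {x. A *v x = 0}"
proof -
  let ?S = "range (\<lambda>x. x v* A)"
  have lin: "linear (\<lambda>x. x v* A)"
    using matrix_vector_mul_linear[of "transpose A"] by simp
  have "{y \<in> UNIV. \<forall>x\<in>?S. orthogonal x y} = {x. A *v x = 0}"
    by (auto simp: orthogonal_def dot_lmul_matrix) (metis inner_eq_zero_iff)
  moreover have "dim {y \<in> UNIV. \<forall>x\<in>?S. orthogonal x y} + dim ?S = dim (UNIV :: (real^'l) set)"
    by (rule dim_subspace_orthogonal_to_vectors) (auto intro: linear_subspace_image[OF lin])
  moreover have "dim ?S \<le> dim (UNIV :: (real^'r) set)"
    by (rule dim_image_le[OF lin])
  ultimately show ?thesis by simp
qed

text \<open>
  On these directions \<open>B\<close> and \<open>B + Z\<close> agree, so that the sketch of the perturbed factor is Gaussian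
  there. The price is \<open>r\<close> of the \<open>l\<close> dimensions.
\<close>

lemma orthonormal_family_in_kernel:
  fixes H :: "real^'l^'n" and Z :: "real^'n^'r"
  assumes "inj ((*v) H)"
  obtains D where "finite D" "pairwise orthogonal D" "\<And>e. e \<in> D \<Longrightarrow> norm e = 1"
    "card D = CARD('l) - CARD('r)" "D \<subseteq> range ((*v) H)" "\<And>e. e \<in> D \<Longrightarrow> Z *v e = 0"
proof -
  define K where "K = (*v) H ` {x. (Z ** H) *v x = 0}"
  have "subspace {x. (Z ** H) *v x = 0}" by (rule linear_subspace_kernel) simp
  then have subK: "subspace K" unfolding K_def by (intro linear_subspace_image) auto
  have "dim K = dim {x. (Z ** H) *v x = 0}"
    unfolding K_def using assms by (intro dim_image_eq) (auto intro: inj_on_subset)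
  then have dimK: "CARD('l) - CARD('r) \<le> dim K" using dim_kernel_ge[of "Z ** H"] by simp
  obtain D' where D': "D' \<subseteq> K" "pairwise orthogonal D'" "\<And>e. e \<in> D' \<Longrightarrow> norm e = 1"
    "card D' = dim K" "independent D'"
    using orthonormal_basis_subspace[OF subK] by metis
  from dimK D'(4) obtain D where D: "D \<subseteq> D'" "card D = CARD('l) - CARD('r)"
    by (metis obtain_subset_with_card_n)
  show ?thesis
  proof
    show "finite D" using D(1) D'(5) independent_imp_finite finite_subset by metis
    show "pairwise orthogonal D" using D'(2) D(1) pairwise_mono by blast
  qed (use D D' in \<open>auto simp: K_def matrix_vector_mul_assoc[symmetric]\<close>)
qed

text \<open>
  The oblique projection \<open>P R\<close> has its range in the span of \<open>D\<close>, hence in the range of \<open>H\<close>, and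
  \<open>C (P R) = C\<close> removes \<open>A C\<close> from the error: what remains is \<open>F - F (P R)\<close>.
\<close>

lemma sketch_error_le:
  fixes A :: "real^'r^'m" and B Z :: "real^'n^'r" and F :: "real^'n^'m" and H :: "real^'l^'n"
  defines "C \<equiv> B + Z"
  assumes nrm: "spectral_or_frobenius nrm"
    and D: "finite D" "pairwise orthogonal D" "\<And>e. e \<in> D \<Longrightarrow> norm e = 1"
      "D \<subseteq> range ((*v) H)" "\<And>e. e \<in> D \<Longrightarrow> Z *v e = 0"
    and c: "c > 0" "\<And>y. (c * norm y)\<^sup>2 \<le> (\<Sum>e\<in>D. (e \<bullet> (y v* B))\<^sup>2)"
    and b: "\<And>x. norm (C *v x) \<le> b * norm x" "b \<ge> 0"
  shows "\<exists>N. nrm ((A ** C + F) - (A ** C + F) ** H ** N) \<le> nrm F * (1 + b / c)"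
proof -
  obtain P where P: "orth_proj P" "\<And>x. P *v x \<in> span D" "\<And>x. x \<in> span D \<Longrightarrow> P *v x = x"
    using orth_proj_onto[OF subspace_span[of D]] by metis
  have "span D \<subseteq> {x. Z *v x = 0}"
    by (intro span_minimal linear_subspace_kernel) (use D in auto)
  then have ZP: "Z ** P = 0"
    using P(2) by (auto simp: matrix_eq matrix_vector_mul_assoc[symmetric])
  have "span D \<subseteq> range ((*v) H)"
    by (intro span_minimal linear_subspace_image) (use D in auto)
  then have HP: "H ** pinv H ** P = P"
  proof -
    assume sub: "span D \<subseteq> range ((*v) H)"
    have "(H ** pinv H) *v (P *v x) = P *v x" for x
    proof -
      obtain z where "P *v x = H *v z" using sub P(2)[of x] by blast
      then show ?thesis by (simp add: matrix_vector_mul_assoc pinv_mul_mul)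
    qed
    then show ?thesis by (simp add: matrix_eq matrix_vector_mul_assoc[symmetric])
  qed
  have "c * norm y \<le> norm (P *v (y v* B))" for y
  proof (rule power2_le_imp_le)
    have "(c * norm y)\<^sup>2 \<le> (\<Sum>e\<in>D. (e \<bullet> (y v* B))\<^sup>2)" by (rule c(2))
    also have "\<dots> = (\<Sum>e\<in>D. (e \<bullet> (P *v (y v* B)))\<^sup>2)"
      by (intro sum.cong refl) (simp add: orth_proj_inner[OF P(1)] P(3) span_base)
    also have "\<dots> \<le> (norm (P *v (y v* B)))\<^sup>2" by (intro bessel D)
    finally show "(c * norm y)\<^sup>2 \<le> (norm (P *v (y v* B)))\<^sup>2" .
  qed simp
  moreover have "C ** P = B ** P" by (simp add: C_def matrix_add_rdistrib ZP)
  ultimately obtain R where R: "C ** (P ** R) = C" "\<And>x. norm ((P ** R) *v x) \<le> b / c * norm x"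
    using oblique_projection[OF P(1) _ c(1) _ b(1)] by metis
  have "(A ** C) ** (P ** R) = A ** C" using R(1) by (simp add: matrix_mul_assoc[symmetric])
  then have "(A ** C + F) - (A ** C + F) ** H ** (pinv H ** P ** R) = F + - (F ** (P ** R))"
    using HP by (simp add: matrix_add_rdistrib matrix_mul_assoc[symmetric])
      (simp add: matrix_mul_assoc)
  moreover have "nrm (F + - (F ** (P ** R))) \<le> nrm F + nrm (F ** (P ** R))"
    using nrm_triangle[OF nrm, of F "- (F ** (P ** R))"] nrm_minus[OF nrm] by simp
  moreover have "nrm (F ** (P ** R)) \<le> b / c * nrm F"
    using b c by (intro nrm_mul_right_le nrm R(2)) auto
  ultimately have "nrm ((A ** C + F) - (A ** C + F) ** H ** (pinv H ** P ** R)) \<le> nrm F * (1 + b / c)"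
    by (simp only: ring_distribs mult_1_right mult.commute[of "nrm F"])
  then show ?thesis by blast
qed

lemma spectral_norm_attained:
  fixes F :: "real^'n^'m"
  obtains v where "norm v = 1" "norm (F *v v) = spectral_norm F"
proof -
  have "compact (sphere (0::real^'n) 1)" by simp
  moreover have "sphere (0::real^'n) 1 \<noteq> {}" by simp
  moreover have "continuous_on (sphere 0 1) (\<lambda>v. norm (F *v v))"
    by (intro continuous_intros linear_continuous_on) simp
  ultimately obtain v where v: "v \<in> sphere 0 1"
    "\<And>w. w \<in> sphere 0 1 \<Longrightarrow> norm (F *v w) \<le> norm (F *v v)"
    using continuous_attains_sup[of "sphere (0::real^'n) 1" "\<lambda>v. norm (F *v v)"] by auto
  have "norm (F *v x) \<le> norm (F *v v) * norm x" for x
  proof (cases "x = 0")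
    case False
    then have "norm (F *v (x /\<^sub>R norm x)) \<le> norm (F *v v)" by (intro v(2)) simp
    then show ?thesis using False by (simp add: matrix_vector_mult_scaleR field_simps)
  qed simp
  then have "spectral_norm F \<le> norm (F *v v)" by (rule spectral_norm_le)
  moreover have "norm (F *v v) \<le> spectral_norm F" using spectral_norm_bound[of F v] v(1) by simp
  ultimately show ?thesis using v(1) that by auto
qed

lemma rank_one_projection:
  fixes u :: "real^'m"
  assumes "norm u = 1"
  obtains J where "orth_proj J" "\<And>x. J *v x = (u \<bullet> x) *\<^sub>R u"
proof
  define J where "J = matrix (\<lambda>x. (u \<bullet> x) *\<^sub>R u)"
  show J: "J *v x = (u \<bullet> x) *\<^sub>R u" for x
  proof -
    have "linear (\<lambda>x. (u \<bullet> x) *\<^sub>R u)"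
      by (rule linearI) (auto simp: inner_right_distrib algebra_simps)
    then show ?thesis unfolding J_def by (simp add: matrix_works)
  qed
  have uu: "u \<bullet> u = 1" using assms by (simp add: norm_eq_1)
  have "(transpose J *v y) \<bullet> x = (J *v y) \<bullet> x" for x y
    using dot_lmul_matrix[of y J x] by (simp add: J inner_commute mult.commute)
  then have "transpose J *v y = J *v y" for y by (metis vector_eq_rdot)
  then have "transpose J = J" unfolding matrix_eq by blast
  moreover have "J ** J = J" by (simp add: matrix_eq matrix_vector_mul_assoc[symmetric] J uu)
  ultimately show "orth_proj J" by (simp add: orth_proj_def)
qed

text \<open>
  The projection \<open>J\<close> turns lower bounds in either norm into lower bounds in the Frobenius norm. For
  the Frobenius norm it projects to the orthogonal complement of the range of \<open>A\<close>. For the spectral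
  norm it projects to the line of a left singular vector of \<open>F\<close> for the largest singular value.
\<close>

lemma norm_compressing_projection:
  fixes A :: "real^'r^'m" and F :: "real^'n^'m"
  assumes nrm: "spectral_or_frobenius nrm" and AF: "transpose A ** F = 0"
  obtains J where "orth_proj J" "J ** A = 0" "\<And>X::real^'n^'m. norm (J ** X) \<le> nrm X"
    "nrm F \<le> norm (J ** F)"
  using nrm unfolding spectral_or_frobenius_def
proof
  assume n: "nrm = frobenius_norm"
  let ?J = "mat 1 - A ** pinv A"
  have J: "orth_proj ?J" by (rule orth_proj_compl[OF orth_proj_range])
  show ?thesis
  proof (rule that)
    show "?J ** A = 0" by (simp add: matrix_diff_rdistrib pinv_mul_mul)
    show "norm (?J ** X) \<le> nrm X" for X :: "real^'n^'m"
      using norm_matrix_mul_left_le[of ?J 1 X] orth_proj_norm_le[OF J]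
      by (simp add: n frobenius_norm_eq_norm)
    have "A ** pinv A = transpose (pinv A) ** transpose A"
      using orth_proj_range[of A] by (metis matrix_transpose_mul orth_proj_def)
    then have "A ** pinv A ** F = 0"
      using AF by (simp add: matrix_mul_assoc[symmetric])
    then show "nrm F \<le> norm (?J ** F)"
      by (simp add: n frobenius_norm_eq_norm matrix_diff_rdistrib)
  qed (rule J)
next
  assume n: "nrm = spectral_norm"
  show ?thesis
  proof (cases "F = 0")
    case True
    show ?thesis
    proof (rule that[of 0])
      show "nrm F \<le> norm (0 ** F)"
        unfolding n True by (rule spectral_norm_le) simp
    qed (auto simp: n spectral_norm_nonneg orth_proj_def transpose_def vec_eq_iff)
  next
    case False
    obtain v where v: "norm v = 1" "norm (F *v v) = spectral_norm F"
      by (rule spectral_norm_attained)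
    have "F *v v \<noteq> 0"
    proof
      assume "F *v v = 0"
      then have "F *v x = 0" for x using spectral_norm_bound[of F x] v(2) by simp
      then show False using False by (simp add: matrix_eq)
    qed
    define u where "u = (F *v v) /\<^sub>R norm (F *v v)"
    have u: "norm u = 1" using \<open>F *v v \<noteq> 0\<close> by (simp add: u_def)
    obtain J where J: "orth_proj J" "\<And>x. J *v x = (u \<bullet> x) *\<^sub>R u"
      using rank_one_projection[OF u] by metis
    have uA: "u v* A = 0"
      using arg_cong[OF AF, of "\<lambda>X. X *v v"]
      by (simp add: u_def matrix_vector_mul_assoc[symmetric])
        (simp add: vec_eq_iff vector_matrix_mult_def sum_distrib_left[symmetric] mult_ac)
    show ?thesis
    proof (rule that)
      show "J ** A = 0"
        by (simp add: matrix_eq matrix_vector_mul_assoc[symmetric] J(2) dot_lmul_matrix[symmetric] uA)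
      show "norm (J ** X) \<le> nrm X" for X :: "real^'n^'m"
      proof -
        have JX: "(J ** X) *v x = ((u v* X) \<bullet> x) *\<^sub>R u" for x
          by (simp add: matrix_vector_mul_assoc[symmetric] J(2) dot_lmul_matrix)
        have "x v* (J ** X) = (x \<bullet> u) *\<^sub>R (u v* X)" for x
        proof -
          have "(x v* (J ** X)) \<bullet> y = ((x \<bullet> u) *\<^sub>R (u v* X)) \<bullet> y" for y
            unfolding dot_lmul_matrix[of x] JX by simp
          then show ?thesis by (metis vector_eq_rdot)
        qed
        then have row: "(J ** X) $ i = (u $ i) *\<^sub>R (u v* X)" for i
          by (metis axis_vector_matrix_mul cart_eq_inner_axis inner_commute)
        have "(norm (J ** X))\<^sup>2 = (norm u)\<^sup>2 * (norm (u v* X))\<^sup>2"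
        proof -
          have "(norm u)\<^sup>2 = (\<Sum>i\<in>UNIV. (u $ i)\<^sup>2)"
            unfolding power2_norm_eq_inner inner_vec_def by (simp add: power2_eq_square)
          then show ?thesis
            by (simp add: norm_matrix_sq row power_mult_distrib sum_distrib_right)
        qed
        then have "norm (J ** X) = norm (u v* X)" using u by (simp add: power2_eq_iff_nonneg)
        also have "\<dots> \<le> nrm X"
          using norm_vector_matrix_mul_le_onorm[OF spectral_norm_bound, of u X] u by (simp add: n)
        finally show ?thesis .
      qed
      have "spectral_norm F = norm ((J ** F) *v v)"
      proof -
        have "F *v v = norm (F *v v) *\<^sub>R u" using \<open>F *v v \<noteq> 0\<close> by (simp add: u_def)
        moreover have "J *v (c *\<^sub>R u) = c *\<^sub>R u" for c using u by (simp add: J(2) norm_eq_1)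
        ultimately have "J *v (F *v v) = F *v v" by metis
        then show ?thesis by (simp add: matrix_vector_mul_assoc[symmetric] v(2))
      qed
      also have "\<dots> \<le> norm (J ** F)" using norm_matrix_vector_mul_le[of "J ** F" v] v(1) by simp
      finally show "nrm F \<le> norm (J ** F)" by (simp add: n)
    qed (rule J)
  qed
qed

lemma tau_nonneg: "spectral_or_frobenius nrm \<Longrightarrow> k > 0 \<Longrightarrow> 0 \<le> tau nrm k M"
  unfolding tau_def by (rule cInf_greatest) (auto simp: nrm_nonneg intro!: exI[of _ 0])

text \<open>
  The deterministic part of the proof. \<open>D\<close> and \<open>F'\<close> are obtained before \<open>B\<close> because they have to be
  constant when \<open>B\<close> becomes random. With \<open>\<rho> = \<surd>(n/l) \<ge> 1\<close>, the error is at most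
  \<open>|||F||| (1 + (\<surd>(21/10) + 1/12) \<rho> / \<surd>(15/100)) \<le> 5 \<rho> |||F||| \<le> 10 \<rho> \<tau>\<close>.
\<close>

theorem perturbed_factor_sketch_error:
  fixes A :: "real^'r^'m" and E :: "real^'n^'m" and H :: "real^'l^'n"
  assumes nrm: "spectral_or_frobenius nrm"
    and A: "\<sigma> > 0" "\<And>x. \<sigma> * norm x \<le> norm (A *v x)"
    and E: "norm E \<le> \<sigma> / 12" and H: "inj ((*v) H)" and ln: "CARD('l) \<le> CARD('n)"
  obtains D and F' :: "real^'n^'m" where
    "finite D" "pairwise orthogonal D" "\<And>e. e \<in> D \<Longrightarrow> norm e = 1"
    "card D = CARD('l) - CARD('r)"
    "\<And>B. \<lbrakk>\<And>y. (norm (y v* B))\<^sup>2 \<le> 21 / 10 * (norm y)\<^sup>2;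
         \<And>y. 4 / 10 * (norm y)\<^sup>2 \<le> (norm (y v* B))\<^sup>2;
         \<And>y. 15 / 100 * (real CARD('l) / real CARD('n)) * (norm y)\<^sup>2 \<le> (\<Sum>e\<in>D. (e \<bullet> (y v* B))\<^sup>2);
         (norm (B ** transpose F'))\<^sup>2 \<le> 13 / 100 * (norm F')\<^sup>2\<rbrakk>
       \<Longrightarrow> \<exists>N. nrm ((A ** B + E) - (A ** B + E) ** H ** N)
             \<le> 10 * sqrt (real CARD('n) / real CARD('l)) * tau nrm (CARD('r) + 1) (A ** B + E)"
proof -
  define Z where "Z = pinv A ** E"
  define F where "F = (mat 1 - A ** pinv A) ** E"
  have E_eq: "E = A ** Z + F" by (simp add: Z_def F_def matrix_diff_rdistrib matrix_mul_assoc)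
  have PA: "orth_proj (A ** pinv A)" by (rule orth_proj_range)
  have "transpose A ** (A ** pinv A) = transpose (A ** pinv A ** A)"
    using PA by (simp add: matrix_transpose_mul orth_proj_def)
  then have AF: "transpose A ** F = 0"
    by (simp add: F_def matrix_diff_rdistrib matrix_diff_ldistrib matrix_mul_assoc pinv_mul_mul)
  have nF: "norm F \<le> norm E"
    using norm_matrix_mul_left_le[of "mat 1 - A ** pinv A" 1 E]
      orth_proj_norm_le[OF orth_proj_compl[OF PA]] by (simp add: F_def)
  have "\<sigma> * norm Z \<le> norm (A ** Z)" by (rule norm_matrix_mul_left_ge) (use A in auto)
  also have "\<dots> \<le> norm E"
    using norm_matrix_mul_left_le[of "A ** pinv A" 1 E] orth_proj_norm_le[OF PA]
    by (simp add: Z_def matrix_mul_assoc)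
  also have "\<dots> \<le> \<sigma> * (1 / 12)" using E by simp
  finally have nZ: "norm Z \<le> 1 / 12" using A(1) by simp
  obtain J where J: "orth_proj J" "J ** A = 0" "\<And>X::real^'n^'m. norm (J ** X) \<le> nrm X"
    "nrm F \<le> norm (J ** F)" using norm_compressing_projection[OF nrm AF] by metis
  have JF: "norm (J ** F) \<le> \<sigma> / 12"
    using norm_matrix_mul_left_le[of J 1 F] orth_proj_norm_le[OF J(1)] nF E by simp
  obtain D where D: "finite D" "pairwise orthogonal D" "\<And>e. e \<in> D \<Longrightarrow> norm e = 1"
    "card D = CARD('l) - CARD('r)" "D \<subseteq> range ((*v) H)" "\<And>e. e \<in> D \<Longrightarrow> Z *v e = 0"
    using orthonormal_family_in_kernel[OF H, of Z] by metis
  show ?thesis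
  proof (rule that[OF D(1-4), where F' = "J ** F"])
    fix B :: "real^'n^'r"
    assume Bup: "\<And>y. (norm (y v* B))\<^sup>2 \<le> 21 / 10 * (norm y)\<^sup>2"
      and Blow: "\<And>y. 4 / 10 * (norm y)\<^sup>2 \<le> (norm (y v* B))\<^sup>2"
      and BD: "\<And>y. 15 / 100 * (real CARD('l) / real CARD('n)) * (norm y)\<^sup>2 \<le> (\<Sum>e\<in>D. (e \<bullet> (y v* B))\<^sup>2)"
      and BF: "(norm (B ** transpose (J ** F)))\<^sup>2 \<le> 13 / 100 * (norm (J ** F))\<^sup>2"
    let ?M = "A ** B + E" and ?t = "tau nrm (CARD('r) + 1) (A ** B + E)"
    have M: "?M = A ** (B + Z) + F" by (simp add: E_eq matrix_add_ldistrib)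
    have "norm (J ** F) / 2 \<le> ?t"
      unfolding tau_def
    proof (rule cInf_greatest)
      fix t assume "t \<in> {nrm (?M - N) |N. rank N < CARD('r) + 1}"
      then obtain N where "t = nrm (?M - N)" "rank N \<le> CARD('r)" by auto
      then show "norm (J ** F) / 2 \<le> t"
        unfolding M using best_low_rank_error_ge[OF nrm A AF JF J(2,3) nZ Blow BF] by simp
    qed (auto intro!: exI[of _ 0])
    with J(4) have nt: "nrm F \<le> 2 * ?t" by simp
    define \<rho> where "\<rho> = sqrt (real CARD('n) / real CARD('l))"
    define c where "c = 38729 / 100000 / \<rho>"
    have \<rho>1: "\<rho> \<ge> 1" using ln by (simp add: \<rho>_def)
    then have c0: "c > 0" by (simp add: c_def)
    have "(c * norm y)\<^sup>2 \<le> (\<Sum>e\<in>D. (e \<bullet> (y v* B))\<^sup>2)" for y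
    proof (rule order_trans[OF _ BD])
      have "\<rho>\<^sup>2 = real CARD('n) / real CARD('l)" by (simp add: \<rho>_def)
      then have "c\<^sup>2 = (38729 / 100000)\<^sup>2 * (real CARD('l) / real CARD('n))"
        by (simp add: c_def power_divide)
      also have "\<dots> \<le> 15 / 100 * (real CARD('l) / real CARD('n))"
        by (intro mult_right_mono) (auto simp: power2_eq_square)
      finally show "(c * norm y)\<^sup>2 \<le> 15 / 100 * (real CARD('l) / real CARD('n)) * (norm y)\<^sup>2"
        unfolding power_mult_distrib by (intro mult_right_mono) auto
    qed
    moreover have "norm ((B + Z) *v x) \<le> 15326 / 10000 * norm x" for x
    proof -
      have "norm (y v* B) \<le> 14492 / 10000 * norm y" for y
      proof (rule power2_le_imp_le)
        show "(norm (y v* B))\<^sup>2 \<le> (14492 / 10000 * norm y)\<^sup>2"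
          unfolding power_mult_distrib
          by (rule order_trans[OF Bup]) (intro mult_right_mono, auto simp: power2_eq_square)
      qed simp
      then have "norm (x v* transpose B) \<le> 14492 / 10000 * norm x"
        by (intro norm_vector_matrix_mul_le_onorm) simp
      moreover have "norm (Z *v x) \<le> 1 / 12 * norm x"
        by (rule order_trans[OF norm_matrix_vector_mul_le mult_right_mono[OF nZ]]) simp
      ultimately show ?thesis
        using norm_triangle_ineq[of "B *v x" "Z *v x"] norm_ge_zero[of x]
        unfolding vector_transpose_matrix matrix_vector_mult_add_rdistrib by linarith
    qed
    ultimately obtain N where "nrm (?M - ?M ** H ** N) \<le> nrm F * (1 + (15326 / 10000) / c)"
      using sketch_error_le[OF nrm D(1-3,5,6) c0, of B "15326 / 10000" A F] M by auto
    also have "\<dots> \<le> (2 * ?t) * (5 * \<rho>)"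
    proof (intro mult_mono nt)
      show "1 + 15326 / 10000 / c \<le> 5 * \<rho>"
        using \<rho>1 by (simp add: c_def field_simps)
      show "0 \<le> 2 * ?t" using nt nrm_nonneg[OF nrm, of F] by simp
    qed (use c0 in simp)
    finally show "\<exists>N. nrm (?M - ?M ** H ** N) \<le> 10 * sqrt (real CARD('n) / real CARD('l)) * ?t"
      by (auto simp: \<rho>_def mult_ac)
  qed
qed

section \<open>The smallest singular value\<close>

definition gram_eigenspace :: "real^'r^'m \<Rightarrow> real \<Rightarrow> (real^'r) set" where
  "gram_eigenspace A c = {v. (transpose A ** A) *v v = c *\<^sub>R v}"

definition gram_eigenvalues :: "real^'r^'m \<Rightarrow> real set" where
  "gram_eigenvalues A = {c. \<exists>v. v \<noteq> 0 \<and> (transpose A ** A) *v v = c *\<^sub>R v}"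

lemma singular_values_eq:
  "singular_values A =
     (\<Sum>c\<in>gram_eigenvalues A. replicate_mset (dim (gram_eigenspace A c)) (sqrt c))"
  by (simp add: singular_values_def gram_eigenvalues_def gram_eigenspace_def)

lemma gram_inner: "((transpose A ** A) *v x) \<bullet> y = (A *v x) \<bullet> (A *v y)"
  for A :: "real^'r^'m"
  by (simp add: matrix_vector_mul_assoc[symmetric] dot_lmul_matrix)

lemma gram_inner_commute: "((transpose A ** A) *v x) \<bullet> y = x \<bullet> ((transpose A ** A) *v y)"
  for A :: "real^'r^'m"
  by (metis gram_inner inner_commute)

lemma subspace_gram_eigenspace: "subspace (gram_eigenspace A c)"
  by (auto simp: subspace_def gram_eigenspace_def matrix_vector_right_distrib
      matrix_vector_mult_scaleR scaleR_right_distrib)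

lemma gram_eigenspaces_orthogonal:
  assumes "v \<in> gram_eigenspace A c" "w \<in> gram_eigenspace A d" "c \<noteq> d"
  shows "orthogonal v w"
proof -
  have "c * (v \<bullet> w) = d * (v \<bullet> w)"
    using gram_inner_commute[of A v w] assms(1,2) by (simp add: gram_eigenspace_def)
  then show ?thesis using assms(3) by (simp add: orthogonal_def)
qed

text \<open>
  A minimiser \<open>u\<close> of the Rayleigh quotient on an invariant subspace is an eigenvector: moving from \<open>u\<close>
  against \<open>w = A\<^sup>T A u - c u\<close> would otherwise decrease the quotient to first order.
\<close>

lemma gram_eigenvector_exists:
  fixes A :: "real^'r^'m"
  assumes U: "subspace U" "x0 \<in> U" "x0 \<noteq> 0"
    and inv: "\<And>x. x \<in> U \<Longrightarrow> (transpose A ** A) *v x \<in> U"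
  obtains u c where "u \<in> U" "u \<noteq> 0" "(transpose A ** A) *v u = c *\<^sub>R u" "c \<ge> 0"
    "\<And>x. x \<in> U \<Longrightarrow> c * (norm x)\<^sup>2 \<le> (norm (A *v x))\<^sup>2"
proof -
  let ?S = "transpose A ** A"
  let ?K = "sphere 0 1 \<inter> U"
  have "compact ?K" using U(1) by (intro compact_Int_closed closed_subspace) auto
  moreover have "x0 /\<^sub>R norm x0 \<in> ?K" using U by (auto intro: subspace_scale)
  moreover have "continuous_on ?K (\<lambda>v. (norm (A *v v))\<^sup>2)"
    by (intro continuous_intros linear_continuous_on) simp
  ultimately obtain u where u: "u \<in> ?K"
    and min: "\<And>w. w \<in> ?K \<Longrightarrow> (norm (A *v u))\<^sup>2 \<le> (norm (A *v w))\<^sup>2"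
    using continuous_attains_inf[of ?K "\<lambda>v. (norm (A *v v))\<^sup>2"] by (metis empty_iff)
  define c where "c = (norm (A *v u))\<^sup>2"
  have nu: "norm u = 1" "u \<in> U" using u by auto
  have le: "c * (norm x)\<^sup>2 \<le> (norm (A *v x))\<^sup>2" if "x \<in> U" for x
  proof (cases "x = 0")
    case False
    have "x /\<^sub>R norm x \<in> ?K" using that False U(1) by (auto intro: subspace_scale)
    from min[OF this] show ?thesis
      using False by (simp add: c_def matrix_vector_mult_scaleR power_mult_distrib field_simps)
  qed simp
  have "?S *v u = c *\<^sub>R u"
  proof -
    define w where "w = ?S *v u - c *\<^sub>R u"
    have wU: "w \<in> U" unfolding w_def using inv nu U(1) by (auto intro: subspace_diff subspace_scale)
    define a where "a = w \<bullet> w"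
    define b where "b = (norm (A *v w))\<^sup>2 - c * (norm w)\<^sup>2"
    have quad: "0 \<le> - 2 * t * a + t\<^sup>2 * b" for t
    proof -
      have "u - t *\<^sub>R w \<in> U" using nu wU U(1) by (auto intro: subspace_diff subspace_scale)
      note this = le[OF this]
      moreover have "(norm (A *v (u - t *\<^sub>R w)))\<^sup>2
          = c - 2 * t * ((?S *v u) \<bullet> w) + t\<^sup>2 * (norm (A *v w))\<^sup>2"
        unfolding gram_inner c_def power2_norm_eq_inner
        by (simp add: matrix_vector_mult_diff_distrib
            matrix_vector_mult_scaleR inner_diff_left inner_diff_right inner_commute algebra_simps
            power2_eq_square)
      moreover have "(norm (u - t *\<^sub>R w))\<^sup>2 = 1 - 2 * t * (u \<bullet> w) + t\<^sup>2 * (norm w)\<^sup>2"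
        using nu(1) unfolding power2_norm_eq_inner
        by (simp add: inner_diff_left inner_diff_right
            inner_commute algebra_simps power2_eq_square norm_eq_1)
      ultimately have *: "c * (1 - 2 * t * (u \<bullet> w) + t\<^sup>2 * (norm w)\<^sup>2)
          \<le> c - 2 * t * ((?S *v u) \<bullet> w) + t\<^sup>2 * (norm (A *v w))\<^sup>2" by simp
      have "a = (?S *v u) \<bullet> w - c * (u \<bullet> w)"
        by (simp add: a_def, subst (1) w_def, simp add: inner_diff_left)
      then have "- 2 * t * a + t\<^sup>2 * b
          = (c - 2 * t * ((?S *v u) \<bullet> w) + t\<^sup>2 * (norm (A *v w))\<^sup>2)
            - c * (1 - 2 * t * (u \<bullet> w) + t\<^sup>2 * (norm w)\<^sup>2)"
        by (simp only: b_def) (simp add: algebra_simps)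
      with * show ?thesis by linarith
    qed
    have "a \<ge> 0" by (simp add: a_def)
    have "a = 0"
    proof (rule ccontr)
      assume "a \<noteq> 0"
      with \<open>a \<ge> 0\<close> have a: "a > 0" by simp
      define t where "t = a / (\<bar>b\<bar> + 1)"
      have t: "t > 0" using a by (simp add: t_def)
      have "t * b \<le> t * (\<bar>b\<bar> + 1)" using t by (intro mult_left_mono) auto
      also have "\<dots> = a" by (simp add: t_def)
      finally have "t * (t * b) \<le> t * a" using t by simp
      moreover have "2 * (t * a) \<le> t * (t * b)"
        using quad[of t] by (simp add: power2_eq_square mult.assoc)
      moreover have "0 < t * a" using t a by simp
      ultimately show False by linarith
    qed
    then show ?thesis by (simp add: a_def w_def)
  qed
  moreover have "c \<ge> 0" by (simp add: c_def)
  moreover have "u \<noteq> 0" using nu(1) by auto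
  ultimately show ?thesis using that[OF nu(2)] le by blast
qed

text \<open>
  The spectral theorem for \<open>A\<^sup>T A\<close> as a dimension count. If the eigenspaces did not span, their
  orthogonal complement would be a nonzero invariant subspace and contain an eigenvector.
\<close>

lemma gram_eigenvalues_finite_dims:
  fixes A :: "real^'r^'m"
  shows "finite (gram_eigenvalues A)"
    and "(\<Sum>c\<in>gram_eigenvalues A. dim (gram_eigenspace A c)) = CARD('r)"
proof -
  let ?S = "transpose A ** A" and ?V = "gram_eigenvalues A"
  have "\<exists>b. b \<subseteq> gram_eigenspace A c \<and> pairwise orthogonal b \<and> (\<forall>x\<in>b. norm x = 1)
      \<and> card b = dim (gram_eigenspace A c) \<and> span b = gram_eigenspace A c" for c
    using orthonormal_basis_subspace[OF subspace_gram_eigenspace[of A c]] by metis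
  then obtain b where b: "\<And>c. b c \<subseteq> gram_eigenspace A c" "\<And>c. pairwise orthogonal (b c)"
    "\<And>c x. x \<in> b c \<Longrightarrow> norm x = 1" "\<And>c. card (b c) = dim (gram_eigenspace A c)"
    "\<And>c. span (b c) = gram_eigenspace A c" by metis
  define U where "U = (\<Union>c\<in>?V. b c)"
  have orth: "pairwise orthogonal U"
    unfolding pairwise_def U_def
  proof safe
    fix c d x y assume "x \<in> b c" "y \<in> b d" "x \<noteq> y"
    then show "orthogonal x y"
      using b(1,2) gram_eigenspaces_orthogonal[of x A c y d]
      by (cases "c = d") (auto simp: pairwise_def)
  qed
  have "0 \<notin> U" using b(3) by (force simp: U_def)
  then have ind: "independent U" using orth by (rule pairwise_orthogonal_independent[rotated])
  then have finU: "finite U" using independent_imp_finite by blast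
  have disj: "b c \<inter> b d = {}" if "c \<noteq> d" for c d
  proof (rule ccontr)
    assume "b c \<inter> b d \<noteq> {}"
    then obtain x where "x \<in> b c" "x \<in> b d" by auto
    then have "orthogonal x x" using b(1) gram_eigenspaces_orthogonal[of x A c x d] that by auto
    then show False using b(3)[OF \<open>x \<in> b c\<close>] by (simp add: orthogonal_self)
  qed
  show fin: "finite ?V"
  proof (rule finite_subset)
    show "?V \<subseteq> (\<lambda>v. v \<bullet> (?S *v v)) ` U"
    proof
      fix c assume c: "c \<in> ?V"
      then obtain v where "v \<noteq> 0" "v \<in> span (b c)"
        by (auto simp: b(5) gram_eigenvalues_def gram_eigenspace_def)
      then have "b c \<noteq> {}" by auto
      then obtain x where x: "x \<in> b c" by auto
      then have "?S *v x = c *\<^sub>R x" using b(1)[of c] by (auto simp: gram_eigenspace_def)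
      then have "x \<bullet> (?S *v x) = c" using b(3)[OF x] by (simp add: norm_eq_1)
      moreover have "x \<in> U" using x c by (auto simp: U_def)
      ultimately show "c \<in> (\<lambda>v. v \<bullet> (?S *v v)) ` U" by force
    qed
  qed (use finU in simp)
  have "span U = UNIV"
  proof (rule ccontr)
    define W where "W = {y. \<forall>x\<in>span U. orthogonal x y}"
    assume "span U \<noteq> UNIV"
    then obtain z where z: "z \<notin> span U" by auto
    obtain p q where pq: "p \<in> span U" "\<And>w. w \<in> span U \<Longrightarrow> orthogonal q w" "z = p + q"
      using orthogonal_subspace_decomp_exists[of U z] by metis
    have "q \<noteq> 0" using pq z by auto
    have "q \<in> W" using pq(2) by (auto simp: W_def orthogonal_commute)
    have subW: "subspace W"
      by (auto simp: W_def subspace_def orthogonal_def inner_right_distrib)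
    have Uinv: "?S *v x \<in> span U" if "x \<in> span U" for x
      using that
    proof (induction rule: span_induct_alt)
      case (step k x y)
      then obtain c where "c \<in> ?V" "x \<in> b c" by (auto simp: U_def)
      then have "?S *v x = c *\<^sub>R x" using b(1)[of c] by (auto simp: gram_eigenspace_def)
      with step show ?case
        by (simp add: matrix_vector_right_distrib matrix_vector_mult_scaleR span_add span_scale span_base)
    qed (simp add: span_zero)
    have "?S *v x \<in> W" if "x \<in> W" for x
      using that Uinv by (auto simp: W_def orthogonal_def gram_inner_commute[symmetric])
    then obtain u c where u: "u \<in> W" "u \<noteq> 0" "?S *v u = c *\<^sub>R u"
      using gram_eigenvector_exists[OF subW \<open>q \<in> W\<close> \<open>q \<noteq> 0\<close>, of A] by metis
    then have "c \<in> ?V" "u \<in> span (b c)"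
      by (auto simp: b(5) gram_eigenvalues_def gram_eigenspace_def)
    then have "u \<in> span U" using span_mono[of "b c" U] by (auto simp: U_def)
    with u(1) have "orthogonal u u" by (auto simp: W_def)
    with u(2) show False by (simp add: orthogonal_self)
  qed
  then have "card U = CARD('r)"
    using ind dim_eq_card_independent[OF ind] by (metis dim_UNIV dim_span DIM_cart DIM_real mult.right_neutral)
  moreover have "card U = (\<Sum>c\<in>?V. card (b c))"
    unfolding U_def
    by (rule card_UN_disjoint[OF fin]) (use disj finU in \<open>auto simp: U_def intro: finite_subset\<close>)
  ultimately show "(\<Sum>c\<in>?V. dim (gram_eigenspace A c)) = CARD('r)" by (simp add: b(4))
qed

lemma set_mset_sum: "finite I \<Longrightarrow> set_mset (\<Sum>i\<in>I. f i) = (\<Union>i\<in>I. set_mset (f i))"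
  by (induction I rule: finite_induct) auto

lemma size_mset_sum:
  fixes f :: "'i \<Rightarrow> 'b multiset"
  shows "finite I \<Longrightarrow> size (\<Sum>i\<in>I. f i) = (\<Sum>i\<in>I. size (f i))"
  by (induction I rule: finite_induct) auto

text \<open>
  The dimension count says that the list of singular values has length \<open>r\<close>, so that the value
  numbered \<open>r\<close> is the last and smallest one; it is at most the root of the minimal Rayleigh quotient.
\<close>

lemma last_singular_value_full_rank:
  fixes A :: "real^'r^'m"
  assumes "rank A = CARD('r)"
  shows "singular_value CARD('r) A > 0"
    and "singular_value CARD('r) A * norm x \<le> norm (A *v x)"
proof -
  note fin = gram_eigenvalues_finite_dims(1)[of A]
  have inj: "A *v x = 0 \<Longrightarrow> x = 0" for x
    using assms unfolding full_rank_injective linear_injective_0[OF matrix_vector_mul_linear] by blast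
  let ?xs = "sorted_list_of_multiset (singular_values A)"
  have size: "length ?xs = CARD('r)"
    using gram_eigenvalues_finite_dims(2)[of A] size_mset_sum[OF fin]
    by (metis (mono_tags, lifting) singular_values_eq mset_sorted_list_of_multiset size_mset
        size_replicate_mset sum.cong)
  have ne: "?xs \<noteq> []" using size by (metis list.size(3) zero_less_card_finite less_irrefl)
  then have "singular_value CARD('r) A = ?xs ! 0"
    unfolding singular_value_def using size by (subst rev_nth) auto
  moreover have "?xs ! 0 \<in> set ?xs" using ne by (intro nth_mem) simp
  moreover have "?xs ! 0 \<le> s" if "s \<in> set ?xs" for s
  proof -
    from that obtain j where "j < length ?xs" "s = ?xs ! j" unfolding in_set_conv_nth by blast
    then show ?thesis using sorted_nth_mono[of ?xs 0 j] by simp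
  qed
  ultimately have mem: "singular_value CARD('r) A \<in># singular_values A"
    and le: "\<And>s. s \<in># singular_values A \<Longrightarrow> singular_value CARD('r) A \<le> s"
    by auto
  have set: "set_mset (singular_values A)
      = (\<Union>c\<in>gram_eigenvalues A. if dim (gram_eigenspace A c) = 0 then {} else {sqrt c})"
    unfolding singular_values_eq set_mset_sum[OF fin] by (intro SUP_cong refl) auto
  from mem set obtain c where c: "c \<in> gram_eigenvalues A" "singular_value CARD('r) A = sqrt c"
    by (auto split: if_splits)
  then obtain v where v: "v \<noteq> 0" "(transpose A ** A) *v v = c *\<^sub>R v"
    by (auto simp: gram_eigenvalues_def)
  have "c * (v \<bullet> v) = (norm (A *v v))\<^sup>2"
    using gram_inner[of A v v] v(2) by (simp add: power2_norm_eq_inner)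
  also have "\<dots> > 0" using inj[of v] v(1) by auto
  finally have "0 < c * (v \<bullet> v)" .
  moreover have "0 < v \<bullet> v" using v(1) by simp
  ultimately have "c > 0" by (rule zero_less_mult_pos2)
  then show "singular_value CARD('r) A > 0" using c(2) by simp
  obtain u d where u: "u \<noteq> 0" "(transpose A ** A) *v u = d *\<^sub>R u" "d \<ge> 0"
    "\<And>x. d * (norm x)\<^sup>2 \<le> (norm (A *v x))\<^sup>2"
    using gram_eigenvector_exists[of UNIV "1 :: real^'r" A] by auto
  have "dim (gram_eigenspace A d) \<noteq> 0"
    using u by (auto simp: gram_eigenspace_def)
  moreover have "d \<in> gram_eigenvalues A" using u by (auto simp: gram_eigenvalues_def)
  ultimately have "sqrt d \<in># singular_values A" unfolding set by auto
  then have "singular_value CARD('r) A * norm x \<le> sqrt d * norm x"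
    by (intro mult_right_mono le) auto
  also have "\<dots> \<le> norm (A *v x)"
    by (rule power2_le_imp_le) (use u in \<open>auto simp: power_mult_distrib\<close>)
  finally show "singular_value CARD('r) A * norm x \<le> norm (A *v x)" .
qed

section \<open>Laplace transforms of Gaussian quadratic forms\<close>

lemma nn_integral_exp_std_normal:
  "(\<integral>\<^sup>+x. ennreal (exp (t * x)) \<partial>std_normal_distribution) = ennreal (exp (t\<^sup>2 / 2))"
proof -
  have "(\<integral>\<^sup>+x. ennreal (exp (t * x)) \<partial>std_normal_distribution)
      = (\<integral>\<^sup>+x. ennreal (exp (t\<^sup>2 / 2) * normal_density t 1 x) \<partial>lborel)"
  proof (subst nn_integral_density)
    show "(\<integral>\<^sup>+x. ennreal (std_normal_density x) * ennreal (exp (t * x)) \<partial>lborel) =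
      (\<integral>\<^sup>+x. ennreal (exp (t\<^sup>2 / 2) * normal_density t 1 x) \<partial>lborel)"
    proof (intro nn_integral_cong)
      fix x
      have "- x\<^sup>2 / 2 + t * x = t\<^sup>2 / 2 + - (x - t)\<^sup>2 / 2"
        by (simp add: power2_eq_square field_simps)
      then have "exp (- x\<^sup>2 / 2) * exp (t * x) = exp (t\<^sup>2 / 2) * exp (- (x - t)\<^sup>2 / 2)"
        by (metis exp_add)
      then show "ennreal (std_normal_density x) * ennreal (exp (t * x)) =
          ennreal (exp (t\<^sup>2 / 2) * normal_density t 1 x)"
        by (simp add: normal_density_def ennreal_mult'[symmetric])
    qed
  qed auto
  also have "\<dots> = ennreal (exp (t\<^sup>2 / 2)) * (\<integral>\<^sup>+x. ennreal (normal_density t 1 x) \<partial>lborel)"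
    by (subst nn_integral_cmult[symmetric]) (auto simp: ennreal_mult)
  also have "(\<integral>\<^sup>+x. ennreal (normal_density t 1 x) \<partial>lborel) = 1"
    by (subst nn_integral_eq_integral) auto
  finally show ?thesis by simp
qed

lemma nn_integral_exp_sq_std_normal:
  assumes "s < 1 / 2"
  shows "(\<integral>\<^sup>+x. ennreal (exp (s * x\<^sup>2)) \<partial>std_normal_distribution) = ennreal (1 / sqrt (1 - 2 * s))"
proof -
  define k where "k = 1 / sqrt (1 - 2 * s)"
  have k: "k > 0" "k\<^sup>2 = 1 / (1 - 2 * s)" using assms by (auto simp: k_def power_divide)
  have "(\<integral>\<^sup>+x. ennreal (exp (s * x\<^sup>2)) \<partial>std_normal_distribution)
      = (\<integral>\<^sup>+x. ennreal (k * normal_density 0 k x) \<partial>lborel)"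
  proof (subst nn_integral_density)
    show "(\<integral>\<^sup>+x. ennreal (std_normal_density x) * ennreal (exp (s * x\<^sup>2)) \<partial>lborel) =
      (\<integral>\<^sup>+x. ennreal (k * normal_density 0 k x) \<partial>lborel)"
    proof (intro nn_integral_cong)
      fix x
      have "- x\<^sup>2 / 2 + s * x\<^sup>2 = - x\<^sup>2 / (2 * k\<^sup>2)"
        using assms by (simp add: k(2) field_simps)
      then have "exp (- x\<^sup>2 / 2) * exp (s * x\<^sup>2) = exp (- x\<^sup>2 / (2 * k\<^sup>2))"
        by (metis exp_add)
      moreover have "sqrt (2 * pi * k\<^sup>2) = sqrt (2 * pi) * k"
        using k(1) by (simp add: real_sqrt_mult)
      ultimately show "ennreal (std_normal_density x) * ennreal (exp (s * x\<^sup>2)) =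
          ennreal (k * normal_density 0 k x)"
        using k(1) by (simp add: normal_density_def ennreal_mult'[symmetric])
    qed
  qed auto
  also have "\<dots> = ennreal k * (\<integral>\<^sup>+x. ennreal (normal_density 0 k x) \<partial>lborel)"
    using k(1) by (subst nn_integral_cmult[symmetric]) (auto simp: ennreal_mult)
  also have "(\<integral>\<^sup>+x. ennreal (normal_density 0 k x) \<partial>lborel) = 1"
    using k(1) by (subst nn_integral_eq_integral) auto
  finally show ?thesis by (simp add: k_def)
qed

lemma inner_matrix: "(X :: real^'n^'r) \<bullet> a = (\<Sum>(i, j)\<in>UNIV. X $ i $ j * a $ i $ j)"
  by (simp add: inner_vec_def sum.cartesian_product UNIV_Times_UNIV)

lemma norm_matrix_sq_entries: "(norm (a :: real^'n^'r))\<^sup>2 = (\<Sum>(i, j)\<in>UNIV. (a $ i $ j)\<^sup>2)"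
  unfolding power2_norm_eq_inner inner_matrix by (simp add: power2_eq_square)

lemma gaussian_entry:
  assumes "gaussian_matrix P G"
  shows "distr P lborel (\<lambda>\<omega>. G \<omega> $ i $ j) = std_normal_distribution"
    and "(\<lambda>\<omega>. G \<omega> $ i $ j) \<in> borel_measurable P"
  using assms unfolding gaussian_matrix_def distributed_def by auto

lemma gaussian_measurable [measurable]:
  fixes G :: "'a \<Rightarrow> real^'n^'r"
  assumes "gaussian_matrix P G"
  shows "G \<in> borel_measurable P"
proof -
  have "(\<lambda>\<omega>. G \<omega> \<bullet> b) \<in> borel_measurable P" for b :: "real^'n^'r"
    unfolding inner_matrix split_def
    by (intro borel_measurable_sum borel_measurable_times gaussian_entry(2)[OF assms]) simp
  then show ?thesis by (subst borel_measurable_euclidean_space) auto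
qed

lemma nn_integral_exp_gaussian:
  fixes G :: "'a \<Rightarrow> real^'n^'r"
  assumes "prob_space P" and G: "gaussian_matrix P G"
  shows "(\<integral>\<^sup>+\<omega>. ennreal (exp (G \<omega> \<bullet> a)) \<partial>P) = ennreal (exp ((norm a)\<^sup>2 / 2))"
proof -
  interpret prob_space P by fact
  let ?X = "\<lambda>(i, j) \<omega>. ennreal (exp (G \<omega> $ i $ j * a $ i $ j))"
  have "indep_vars (\<lambda>_. borel) (\<lambda>(i, j) \<omega>. G \<omega> $ i $ j) UNIV"
    using G by (simp add: gaussian_matrix_def)
  from indep_vars_compose2[OF this, of "\<lambda>(i, j) x. ennreal (exp (x * a $ i $ j))" "\<lambda>_. borel"]
  have ind: "indep_vars (\<lambda>_. borel) ?X UNIV"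
    by (simp add: split_def)
  have one: "(\<integral>\<^sup>+\<omega>. ennreal (exp (G \<omega> $ i $ j * a $ i $ j)) \<partial>P) = ennreal (exp ((a $ i $ j)\<^sup>2 / 2))" for i j
  proof -
    have "(\<integral>\<^sup>+\<omega>. ennreal (exp (G \<omega> $ i $ j * a $ i $ j)) \<partial>P)
        = (\<integral>\<^sup>+x. ennreal (exp (a $ i $ j * x)) \<partial>distr P lborel (\<lambda>\<omega>. G \<omega> $ i $ j))"
      by (subst nn_integral_distr) (auto simp: gaussian_entry(2)[OF G] mult.commute)
    then show ?thesis by (simp add: gaussian_entry(1)[OF G] nn_integral_exp_std_normal)
  qed
  have "(\<integral>\<^sup>+\<omega>. ennreal (exp (G \<omega> \<bullet> a)) \<partial>P) = (\<integral>\<^sup>+\<omega>. (\<Prod>p\<in>UNIV. ?X p \<omega>) \<partial>P)"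
    by (simp add: inner_matrix exp_sum split_def prod_ennreal)
  also have "\<dots> = (\<Prod>p\<in>UNIV. \<integral>\<^sup>+\<omega>. ?X p \<omega> \<partial>P)"
    by (rule indep_vars_nn_integral[OF _ ind]) auto
  also have "\<dots> = (\<Prod>(i, j)\<in>UNIV. ennreal (exp ((a $ i $ j)\<^sup>2 / 2)))"
    by (intro prod.cong refl) (auto simp: one)
  also have "\<dots> = ennreal (exp ((norm a)\<^sup>2 / 2))"
    by (simp add: norm_matrix_sq_entries split_def prod_ennreal exp_sum[symmetric] sum_divide_distrib)
  finally show ?thesis .
qed

lemma integral_iexp_gaussian:
  fixes G :: "'a \<Rightarrow> real^'n^'r"
  assumes "prob_space P" and G: "gaussian_matrix P G"
  shows "(CLINT \<omega>|P. iexp (G \<omega> \<bullet> a)) = complex_of_real (exp (- (norm a)\<^sup>2 / 2))"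
proof -
  interpret prob_space P by fact
  let ?X = "\<lambda>(i, j) \<omega>. iexp (G \<omega> $ i $ j * a $ i $ j)"
  have "indep_vars (\<lambda>_. borel) (\<lambda>(i, j) \<omega>. G \<omega> $ i $ j) UNIV"
    using G by (simp add: gaussian_matrix_def)
  from indep_vars_compose2[OF this, of "\<lambda>(i, j) x. iexp (x * a $ i $ j)" "\<lambda>_. borel"]
  have ind: "indep_vars (\<lambda>_. borel) ?X UNIV"
    by (simp add: split_def)
  have int: "integrable P (\<lambda>\<omega>. iexp (G \<omega> $ i $ j * a $ i $ j))" for i j
  proof (rule integrable_const_bound[of _ 1])
    note [measurable] = gaussian_entry(2)[OF G]
    show "(\<lambda>\<omega>. iexp (G \<omega> $ i $ j * a $ i $ j)) \<in> borel_measurable P" by measurable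
  qed auto
  have one: "(CLINT \<omega>|P. iexp (G \<omega> $ i $ j * a $ i $ j)) = complex_of_real (exp (- (a $ i $ j)\<^sup>2 / 2))" for i j
  proof -
    have "(CLINT \<omega>|P. iexp (G \<omega> $ i $ j * a $ i $ j))
        = char (distr P lborel (\<lambda>\<omega>. G \<omega> $ i $ j)) (a $ i $ j)"
      unfolding char_def by (subst integral_distr) (auto simp: gaussian_entry(2)[OF G] mult.commute)
    then show ?thesis by (simp add: gaussian_entry(1)[OF G] char_std_normal_distribution)
  qed
  have "(CLINT \<omega>|P. iexp (G \<omega> \<bullet> a)) = (CLINT \<omega>|P. (\<Prod>p\<in>UNIV. ?X p \<omega>))"
    by (simp add: inner_matrix exp_sum split_def sum_distrib_left)
  also have "\<dots> = (\<Prod>p\<in>UNIV. CLINT \<omega>|P. ?X p \<omega>)"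
    by (rule indep_vars_lebesgue_integral[OF _ ind]) (use int in auto)
  also have "\<dots> = (\<Prod>(i, j)\<in>UNIV. complex_of_real (exp (- (a $ i $ j)\<^sup>2 / 2)))"
    by (intro prod.cong refl) (use one in auto)
  also have "\<dots> = complex_of_real (exp (- (norm a)\<^sup>2 / 2))"
    by (simp add: norm_matrix_sq_entries split_def of_real_prod[symmetric] exp_sum[symmetric]
        sum_divide_distrib sum_negf del: of_real_prod)
  finally show ?thesis .
qed

lemma norm_sq_add_orthogonal_scaled:
  assumes "orthogonal a d" "norm d = 1"
  shows "(norm (a + c *\<^sub>R d))\<^sup>2 = (norm a)\<^sup>2 + c\<^sup>2"
  using norm_add_Pythagorean[of a "c *\<^sub>R d"] assms by (simp add: orthogonal_clauses power_mult_distrib)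

text \<open>
  One square at a time is traded for a linear term: \<open>exp (s v\<^sup>2)\<close> is the mean of \<open>exp (\<surd>(2s) h v)\<close>
  over a standard normal \<open>h\<close>. The linear term \<open>G \<bullet> a\<close> is there for the induction; since \<open>d\<close> is
  orthogonal to \<open>a\<close> and to the rest of \<open>D\<close>, the norm of \<open>a + \<surd>(2s) h d\<close> splits.
\<close>

lemma nn_integral_exp_quadratic_gaussian_pos:
  fixes G :: "'a \<Rightarrow> real^'n^'r"
  assumes "prob_space P" and G: "gaussian_matrix P G" and s: "0 \<le> s" "s < 1 / 2"
    and "finite D" "pairwise orthogonal D" "\<And>d. d \<in> D \<Longrightarrow> norm d = 1" "\<And>d. d \<in> D \<Longrightarrow> orthogonal a d"
  shows "(\<integral>\<^sup>+\<omega>. ennreal (exp (s * (\<Sum>d\<in>D. (G \<omega> \<bullet> d)\<^sup>2) + G \<omega> \<bullet> a)) \<partial>P)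
     = ennreal ((1 / sqrt (1 - 2 * s)) ^ card D * exp ((norm a)\<^sup>2 / 2))"
  using assms(5-)
proof (induction D arbitrary: a rule: finite_induct)
  case empty
  then show ?case using nn_integral_exp_gaussian[OF assms(1) G, of a] by simp
next
  case (insert d D)
  interpret P: prob_space P by fact
  note [measurable] = gaussian_measurable[OF G]
  let ?N = std_normal_distribution
  interpret N: prob_space ?N using real_dist_normal_dist real_distribution_def by blast
  interpret pair_sigma_finite ?N P by unfold_locales
  let ?k = "1 / sqrt (1 - 2 * s)"
  define Q where "Q \<omega> = (\<Sum>d\<in>D. (G \<omega> \<bullet> d)\<^sup>2)" for \<omega>
  have [measurable]: "Q \<in> borel_measurable P" unfolding Q_def by measurable
  have ad: "orthogonal a d" "norm d = 1" using insert.prems by auto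
  have IH: "(\<integral>\<^sup>+\<omega>. ennreal (exp (s * Q \<omega> + G \<omega> \<bullet> (a + c *\<^sub>R d))) \<partial>P)
     = ennreal (?k ^ card D * exp ((norm a)\<^sup>2 / 2) * exp (c\<^sup>2 / 2))" for c
  proof -
    have "orthogonal (a + c *\<^sub>R d) e" if "e \<in> D" for e
      using insert.prems insert.hyps that
      by (auto simp: pairwise_insert intro!: orthogonal_clauses) 
    then show ?thesis
      using insert.IH[of "a + c *\<^sub>R d"] insert.prems norm_sq_add_orthogonal_scaled[OF ad, of c]
      by (simp add: Q_def pairwise_insert add_divide_distrib exp_add mult_ac)
  qed
  have "(\<integral>\<^sup>+\<omega>. ennreal (exp (s * (\<Sum>d\<in>insert d D. (G \<omega> \<bullet> d)\<^sup>2) + G \<omega> \<bullet> a)) \<partial>P)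
      = (\<integral>\<^sup>+\<omega>. (\<integral>\<^sup>+h. ennreal (exp (s * Q \<omega> + G \<omega> \<bullet> (a + (sqrt (2 * s) * h) *\<^sub>R d))) \<partial>?N) \<partial>P)"
  proof (intro nn_integral_cong)
    fix \<omega>
    let ?v = "G \<omega> \<bullet> d"
    have "ennreal (exp (s * (\<Sum>d\<in>insert d D. (G \<omega> \<bullet> d)\<^sup>2) + G \<omega> \<bullet> a))
        = ennreal (exp (s * Q \<omega> + G \<omega> \<bullet> a)) * ennreal (exp ((sqrt (2 * s) * ?v)\<^sup>2 / 2))"
      using insert.hyps s
      by (simp add: Q_def ennreal_mult'[symmetric] exp_add[symmetric] power_mult_distrib algebra_simps)
    also have "\<dots> = (\<integral>\<^sup>+h. ennreal (exp (s * Q \<omega> + G \<omega> \<bullet> a)) * ennreal (exp (sqrt (2 * s) * ?v * h)) \<partial>?N)"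
      by (subst nn_integral_cmult) (auto simp: nn_integral_exp_std_normal)
    also have "\<dots> = (\<integral>\<^sup>+h. ennreal (exp (s * Q \<omega> + G \<omega> \<bullet> (a + (sqrt (2 * s) * h) *\<^sub>R d))) \<partial>?N)"
      by (intro nn_integral_cong)
         (simp add: ennreal_mult'[symmetric] exp_add[symmetric] inner_add_right algebra_simps)
    finally show "ennreal (exp (s * (\<Sum>d\<in>insert d D. (G \<omega> \<bullet> d)\<^sup>2) + G \<omega> \<bullet> a)) = \<dots>" .
  qed
  also have "\<dots> = (\<integral>\<^sup>+h. (\<integral>\<^sup>+\<omega>. ennreal (exp (s * Q \<omega> + G \<omega> \<bullet> (a + (sqrt (2 * s) * h) *\<^sub>R d))) \<partial>P) \<partial>?N)"
    by (rule Fubini') measurable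
  also have "\<dots> = (\<integral>\<^sup>+h. ennreal (?k ^ card D * exp ((norm a)\<^sup>2 / 2)) * ennreal (exp (s * h\<^sup>2)) \<partial>?N)"
    unfolding IH using s
    by (intro nn_integral_cong) (simp add: ennreal_mult'[symmetric] power_mult_distrib)
  also have "\<dots> = ennreal (?k ^ card D * exp ((norm a)\<^sup>2 / 2)) * ennreal ?k"
    by (subst nn_integral_cmult) (auto simp: nn_integral_exp_sq_std_normal[OF s(2)])
  also have "\<dots> = ennreal (?k ^ card (insert d D) * exp ((norm a)\<^sup>2 / 2))"
    using insert.hyps s by (simp add: ennreal_mult'[symmetric] mult_ac)
  finally show ?case .
qed

text \<open>
  The same induction with Fourier instead of Laplace transforms: \<open>exp (- s v\<^sup>2)\<close> is the mean of
  \<open>exp (i \<surd>(2s) h v)\<close>.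
\<close>

lemma integral_exp_quadratic_gaussian_neg:
  fixes G :: "'a \<Rightarrow> real^'n^'r"
  assumes "prob_space P" and G: "gaussian_matrix P G" and s: "0 \<le> s"
    and "finite D" "pairwise orthogonal D" "\<And>d. d \<in> D \<Longrightarrow> norm d = 1" "\<And>d. d \<in> D \<Longrightarrow> orthogonal a d"
  shows "(CLINT \<omega>|P. complex_of_real (exp (- s * (\<Sum>d\<in>D. (G \<omega> \<bullet> d)\<^sup>2))) * iexp (G \<omega> \<bullet> a))
     = complex_of_real ((1 / sqrt (1 + 2 * s)) ^ card D * exp (- (norm a)\<^sup>2 / 2))"
  using assms(4-)
proof (induction D arbitrary: a rule: finite_induct)
  case empty
  then show ?case using integral_iexp_gaussian[OF assms(1) G, of a] by simp
next
  case (insert d D)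
  interpret P: prob_space P by fact
  note [measurable] = gaussian_measurable[OF G]
  let ?N = std_normal_distribution
  interpret N: prob_space ?N using real_dist_normal_dist real_distribution_def by blast
  interpret NP: pair_prob_space ?N P by unfold_locales
  let ?k = "1 / sqrt (1 + 2 * s)"
  define Q where "Q \<omega> = (\<Sum>d\<in>D. (G \<omega> \<bullet> d)\<^sup>2)" for \<omega>
  have Q0: "0 \<le> Q \<omega>" for \<omega> by (simp add: Q_def sum_nonneg)
  have [measurable]: "Q \<in> borel_measurable P" unfolding Q_def by measurable
  have ad: "orthogonal a d" "norm d = 1" using insert.prems by auto
  have IH: "(CLINT \<omega>|P. complex_of_real (exp (- s * Q \<omega>)) * iexp (G \<omega> \<bullet> (a + c *\<^sub>R d)))
     = complex_of_real (?k ^ card D * exp (- (norm a)\<^sup>2 / 2) * exp (- c\<^sup>2 / 2))" for c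
  proof -
    have "orthogonal (a + c *\<^sub>R d) e" if "e \<in> D" for e
      using insert.prems insert.hyps that
      by (auto simp: pairwise_insert intro!: orthogonal_clauses) 
    then have "(CLINT \<omega>|P. complex_of_real (exp (- s * Q \<omega>)) * iexp (G \<omega> \<bullet> (a + c *\<^sub>R d)))
     = complex_of_real (?k ^ card D * exp (- (norm (a + c *\<^sub>R d))\<^sup>2 / 2))"
      unfolding Q_def by (intro insert.IH) (use insert.prems in \<open>auto simp: pairwise_insert\<close>)
    also have "exp (- (norm (a + c *\<^sub>R d))\<^sup>2 / 2) = exp (- (norm a)\<^sup>2 / 2) * exp (- c\<^sup>2 / 2)"
      unfolding norm_sq_add_orthogonal_scaled[OF ad] exp_add[symmetric] by (simp add: field_simps)
    finally show ?thesis by (simp only: mult.assoc)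
  qed
  let ?f = "\<lambda>h \<omega>. complex_of_real (exp (- s * Q \<omega>)) * iexp (G \<omega> \<bullet> (a + (sqrt (2 * s) * h) *\<^sub>R d))"
  have "(CLINT \<omega>|P. complex_of_real (exp (- s * (\<Sum>d\<in>insert d D. (G \<omega> \<bullet> d)\<^sup>2))) * iexp (G \<omega> \<bullet> a))
      = (CLINT \<omega>|P. (CLINT h|?N. ?f h \<omega>))"
  proof (intro Bochner_Integration.integral_cong refl)
    fix \<omega>
    let ?v = "G \<omega> \<bullet> d" and ?c = "complex_of_real (exp (- s * Q \<omega>)) * iexp (G \<omega> \<bullet> a)"
    have "- s * (\<Sum>d\<in>insert d D. (G \<omega> \<bullet> d)\<^sup>2) = - s * Q \<omega> + - (sqrt (2 * s) * ?v)\<^sup>2 / 2"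
      using insert.hyps s by (simp add: Q_def power_mult_distrib algebra_simps)
    then have "complex_of_real (exp (- s * (\<Sum>d\<in>insert d D. (G \<omega> \<bullet> d)\<^sup>2))) * iexp (G \<omega> \<bullet> a)
        = ?c * complex_of_real (exp (- (sqrt (2 * s) * ?v)\<^sup>2 / 2))"
      by (simp only: exp_add of_real_mult mult_ac)
    also have "complex_of_real (exp (- (sqrt (2 * s) * ?v)\<^sup>2 / 2)) = char ?N (sqrt (2 * s) * ?v)"
      unfolding char_std_normal_distribution ..
    also have "?c * \<dots> = (CLINT h|?N. ?c * iexp (sqrt (2 * s) * ?v * h))"
      by (simp add: char_def)
    also have "\<dots> = (CLINT h|?N. ?f h \<omega>)"
      by (intro Bochner_Integration.integral_cong refl)
         (simp add: exp_add[symmetric] inner_add_right algebra_simps)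
    finally show "complex_of_real (exp (- s * (\<Sum>d\<in>insert d D. (G \<omega> \<bullet> d)\<^sup>2))) * iexp (G \<omega> \<bullet> a) = \<dots>" .
  qed
  also have "\<dots> = (CLINT h|?N. (CLINT \<omega>|P. ?f h \<omega>))"
  proof (rule NP.Fubini_integral)
    show "integrable (?N \<Otimes>\<^sub>M P) (case_prod ?f)"
      by (rule NP.P.integrable_const_bound[of _ 1])
         (use Q0 s in \<open>auto simp: norm_mult split_def mult_nonneg_nonneg\<close>)
  qed
  also have "\<dots> = (CLINT h|?N. complex_of_real (?k ^ card D * exp (- (norm a)\<^sup>2 / 2) * exp (- s * h\<^sup>2)))"
    unfolding IH using s by (simp add: power_mult_distrib)
  also have "\<dots> = complex_of_real (?k ^ card D * exp (- (norm a)\<^sup>2 / 2) * (LINT h|?N. exp (- s * h\<^sup>2)))"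
    unfolding integral_complex_of_real by simp
  also have "(LINT h|?N. exp (- s * h\<^sup>2)) = ?k"
    using nn_integral_exp_sq_std_normal[of "- s"] s
    by (subst integral_eq_nn_integral) (auto simp: less_imp_le)
  finally show ?case using insert.hyps by (simp add: mult_ac)
qed

lemma nn_integral_exp_quadratic_gaussian:
  fixes G :: "'a \<Rightarrow> real^'n^'r"
  assumes "prob_space P" and G: "gaussian_matrix P G" and s: "s < 1 / 2"
    and D: "finite D" "pairwise orthogonal D" "\<And>d. d \<in> D \<Longrightarrow> norm d = 1"
  shows "(\<integral>\<^sup>+\<omega>. ennreal (exp (s * (\<Sum>d\<in>D. (G \<omega> \<bullet> d)\<^sup>2))) \<partial>P)
     = ennreal ((1 / sqrt (1 - 2 * s)) ^ card D)"
proof (cases "s \<ge> 0")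
  case True
  then show ?thesis
    using nn_integral_exp_quadratic_gaussian_pos[OF assms(1) G _ s D, of 0]
    by (simp add: orthogonal_clauses)
next
  case False
  interpret P: prob_space P by fact
  note [measurable] = gaussian_measurable[OF G]
  let ?Q = "\<lambda>\<omega>. \<Sum>d\<in>D. (G \<omega> \<bullet> d)\<^sup>2"
  have "(CLINT \<omega>|P. complex_of_real (exp (s * ?Q \<omega>))) = complex_of_real ((1 / sqrt (1 - 2 * s)) ^ card D)"
    using integral_exp_quadratic_gaussian_neg[OF assms(1) G, of "- s" D 0] D False
    by (simp add: orthogonal_clauses)
  then have "(LINT \<omega>|P. exp (s * ?Q \<omega>)) = (1 / sqrt (1 - 2 * s)) ^ card D"
    unfolding integral_complex_of_real of_real_eq_iff .
  moreover have "integrable P (\<lambda>\<omega>. exp (s * ?Q \<omega>))"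
    by (rule P.integrable_const_bound[of _ 1])
       (use False in \<open>auto intro!: mult_nonpos_nonneg sum_nonneg\<close>)
  ultimately show ?thesis by (subst nn_integral_eq_integral) auto
qed

section \<open>Extreme values of a Gaussian quadratic form on the sphere\<close>

text \<open>
  For orthonormal \<open>D\<close>, the squared length of the orthogonal projection of \<open>y v* G\<close> to the span of \<open>D\<close>.
\<close>

definition proj_energy :: "(real^'n) set \<Rightarrow> real^'n^'r \<Rightarrow> real^'r \<Rightarrow> real" where
  "proj_energy D G y = (\<Sum>e\<in>D. (e \<bullet> (y v* G))\<^sup>2)"

lemma proj_energy_nonneg: "0 \<le> proj_energy D G y"
  by (simp add: proj_energy_def sum_nonneg)

lemma proj_energy_scaleR: "proj_energy D G (c *\<^sub>R y) = c\<^sup>2 * proj_energy D G y"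
  by (simp add: proj_energy_def scaleR_vector_matrix_assoc power_mult_distrib sum_distrib_left)

lemma proj_energy_parallelogram:
  "proj_energy D G (x + u) + proj_energy D G (x - u) = 2 * proj_energy D G x + 2 * proj_energy D G u"
  by (simp add: proj_energy_def vector_matrix_mult_diff_distrib vector_matrix_mult_add_rdistrib
      inner_add_right inner_diff_right sum.distrib[symmetric] sum_distrib_left power2_eq_square algebra_simps
      vector_matrix_left_distrib)

lemma proj_energy_Basis: "proj_energy Basis G y = (norm (y v* G))\<^sup>2"
  unfolding proj_energy_def power2_norm_eq_inner euclidean_inner[of "y v* G" "y v* G"]
  by (simp add: inner_commute power2_eq_square)

lemma continuous_proj_energy: "continuous_on UNIV (\<lambda>(G :: real^'n^'r, y). proj_energy D G y)"
  unfolding proj_energy_def split_def vector_matrix_mult_def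
  by (intro continuous_intros)

text \<open>
  For a unit vector \<open>u\<close> the matrices \<open>u e\<^sup>T\<close> with \<open>e \<in> D\<close> are again orthonormal.
\<close>

lemma nn_integral_exp_proj_energy:
  fixes G :: "'a \<Rightarrow> real^'n^'r"
  assumes "prob_space P" and G: "gaussian_matrix P G"
    and D: "finite D" "pairwise orthogonal D" "\<And>d. d \<in> D \<Longrightarrow> norm d = 1"
    and s: "2 * s * (norm y)\<^sup>2 < 1"
  shows "(\<integral>\<^sup>+\<omega>. ennreal (exp (s * proj_energy D (G \<omega>) y)) \<partial>P)
     = ennreal ((1 / sqrt (1 - 2 * s * (norm y)\<^sup>2)) ^ card D)"
proof (cases "y = 0")
  case True
  interpret prob_space P by fact
  show ?thesis using True by (simp add: proj_energy_def emeasure_space_1)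
next
  case False
  define u where "u = y /\<^sub>R norm y"
  have u: "norm u = 1" "y = norm y *\<^sub>R u" using False by (auto simp: u_def)
  define f :: "real^'n \<Rightarrow> real^'n^'r" where "f e = (\<chi> i. (u $ i) *\<^sub>R e)" for e
  have ff: "f d \<bullet> f e = d \<bullet> e" for d e
  proof -
    have "f d \<bullet> f e = (u \<bullet> u) * (d \<bullet> e)"
      unfolding inner_vec_def[of "f d" "f e"] inner_vec_def[of u u] by (simp add: f_def sum_distrib_left sum_distrib_right mult_ac)
    then show ?thesis using u by (simp add: norm_eq_1)
  qed
  have inj: "inj_on f D"
  proof (rule inj_onI)
    fix d e assume "d \<in> D" "e \<in> D" "f d = f e"
    then have "d \<bullet> e = 1" using ff[of d e] ff[of e e] D(3) by (simp add: norm_eq_1)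
    then show "d = e" using \<open>d \<in> D\<close> \<open>e \<in> D\<close> D(2)
      unfolding pairwise_def orthogonal_def by (metis zero_neq_one)
  qed
  have Gf: "X \<bullet> f e = e \<bullet> (u v* X)" for X e
    unfolding inner_vec_def[of X "f e"]
    by (simp add: f_def inner_commute[of e] dot_lmul_matrix inner_vec_def[of u] matrix_vector_mul_component)
  have "proj_energy D (G \<omega>) y = (norm y)\<^sup>2 * (\<Sum>d\<in>f ` D. (G \<omega> \<bullet> d)\<^sup>2)" for \<omega>
    by (subst u(2), simp only: proj_energy_scaleR)
       (simp add: sum.reindex[OF inj] Gf proj_energy_def)
  then have "(\<integral>\<^sup>+\<omega>. ennreal (exp (s * proj_energy D (G \<omega>) y)) \<partial>P)
      = (\<integral>\<^sup>+\<omega>. ennreal (exp (s * (norm y)\<^sup>2 * (\<Sum>d\<in>f ` D. (G \<omega> \<bullet> d)\<^sup>2))) \<partial>P)"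
    by (simp add: mult.assoc)
  also have "\<dots> = ennreal ((1 / sqrt (1 - 2 * (s * (norm y)\<^sup>2))) ^ card (f ` D))"
  proof (rule nn_integral_exp_quadratic_gaussian[OF assms(1) G])
    show "pairwise orthogonal (f ` D)"
      using D(2) ff by (auto simp: pairwise_def orthogonal_def)
  qed (use s D ff in \<open>auto simp: norm_eq_1\<close>)
  finally show ?thesis by (simp add: card_image[OF inj] mult_ac)
qed

lemma nn_integral_lborel_affine_unit:
  fixes f :: "'v::euclidean_space \<Rightarrow> ennreal"
  assumes [measurable]: "f \<in> borel_measurable borel" and "\<bar>c\<bar> = 1"
  shows "(\<integral>\<^sup>+y. f y \<partial>lborel) = (\<integral>\<^sup>+u. f (x + c *\<^sub>R u) \<partial>lborel)"
proof -
  have "c \<noteq> 0" using assms(2) by auto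
  show ?thesis
    by (subst lborel_affine[OF \<open>c \<noteq> 0\<close>, of x])
       (simp add: nn_integral_density nn_integral_distr assms(2))
qed

lemma two_exp_mean_le: "2 * exp ((a + b) / 2) \<le> exp a + exp (b::real)"
proof -
  have "0 \<le> (exp (a / 2) - exp (b / 2))\<^sup>2" by simp
  also have "\<dots> = exp (a / 2) * exp (a / 2) + exp (b / 2) * exp (b / 2) - 2 * (exp (a / 2) * exp (b / 2))"
    by (simp add: power2_eq_square algebra_simps)
  also have "\<dots> = exp a + exp b - 2 * exp ((a + b) / 2)"
    by (simp only: exp_add[symmetric]) (simp add: add_divide_distrib)
  finally show ?thesis by simp
qed

text \<open>
  The points \<open>x + u\<close> and \<open>x - u\<close> are averaged in pairs, where convexity of \<open>exp\<close> applies.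
\<close>

lemma ball_average_exp:
  fixes f :: "'v::euclidean_space \<Rightarrow> real"
  assumes [measurable]: "f \<in> borel_measurable borel"
    and f: "\<And>u. norm u \<le> \<epsilon> \<Longrightarrow> 2 * c \<le> f (x + u) + f (x - u)"
  shows "ennreal (exp c) * emeasure lborel (cball (0::'v) \<epsilon>)
    \<le> (\<integral>\<^sup>+y. ennreal (exp (f y)) * indicator (cball x \<epsilon>) y \<partial>lborel)"
proof -
  define g where "g = (\<lambda>y. ennreal (exp (f y)) * indicator (cball x \<epsilon>) y)"
  have [measurable]: "cball x \<epsilon> \<in> sets borel" by (simp add: borel_closed)
  have [measurable]: "g \<in> borel_measurable borel" unfolding g_def by measurable
  let ?I = "\<integral>\<^sup>+y. g y \<partial>lborel"
  have "2 * (ennreal (exp c) * emeasure lborel (cball (0::'v) \<epsilon>))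
      = (\<integral>\<^sup>+u. 2 * ennreal (exp c) * indicator (cball (0::'v) \<epsilon>) u \<partial>lborel)"
    by (subst nn_integral_cmult_indicator) (auto simp: mult.assoc)
  also have "\<dots> \<le> (\<integral>\<^sup>+u. g (x + 1 *\<^sub>R u) + g (x + (-1) *\<^sub>R u) \<partial>lborel)"
  proof (intro nn_integral_mono)
    fix u :: 'v
    show "2 * ennreal (exp c) * indicator (cball 0 \<epsilon>) u \<le> g (x + 1 *\<^sub>R u) + g (x + (-1) *\<^sub>R u)"
    proof (cases "norm u \<le> \<epsilon>")
      case True
      have "2 * exp c \<le> 2 * exp ((f (x + u) + f (x - u)) / 2)"
        using f[OF True] by simp
      also have "\<dots> \<le> exp (f (x + u)) + exp (f (x - u))" by (rule two_exp_mean_le)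
      finally have "ennreal (2 * exp c) \<le> ennreal (exp (f (x + u)) + exp (f (x - u)))"
        by (rule ennreal_leI)
      then show ?thesis using True by (simp add: g_def dist_norm ennreal_mult ennreal_plus)
    qed simp
  qed
  also have "\<dots> = (\<integral>\<^sup>+u. g (x + 1 *\<^sub>R u) \<partial>lborel) + (\<integral>\<^sup>+u. g (x + (-1) *\<^sub>R u) \<partial>lborel)"
    by (intro nn_integral_add) measurable
  also have "\<dots> = ?I + ?I"
    using nn_integral_lborel_affine_unit[of g 1 x] nn_integral_lborel_affine_unit[of g "-1" x] by simp
  also have "\<dots> = 2 * ?I" by (simp add: mult_2)
  finally show ?thesis by (simp add: ennreal_mult_le_mult_iff g_def)
qed

text \<open>
  A continuous substitute for the union bound over a net. If the conclusion fails for a unit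
  vector \<open>x\<close>, then by \<open>ball_average_exp\<close> the integral of \<open>exp Q\<close> over the shell of radii \<open>1 - \<epsilon>\<close> to
  \<open>1 + \<epsilon>\<close> is at least \<open>exp c\<close> times the volume of a ball of radius \<open>\<epsilon>\<close>. Its expectation is at most
  \<open>K\<close> times the volume of the ball of radius \<open>1 + \<epsilon>\<close>, so Markov's inequality applies.
\<close>

lemma random_exp_cover_bound:
  fixes Q :: "'a \<Rightarrow> real^'r \<Rightarrow> real"
  assumes "prob_space P"
    and [measurable]: "case_prod Q \<in> borel_measurable (P \<Otimes>\<^sub>M borel)"
    and \<epsilon>: "0 < \<epsilon>" and K: "0 \<le> K"
    and mgf: "\<And>y. 1 - \<epsilon> \<le> norm y \<Longrightarrow> norm y \<le> 1 + \<epsilon> \<Longrightarrow>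
       (\<integral>\<^sup>+\<omega>. ennreal (exp (Q \<omega> y)) \<partial>P) \<le> ennreal K"
  obtains Bad where "Bad \<in> sets P" "measure P Bad \<le> (1 + 1 / \<epsilon>) ^ CARD('r) * K * exp (- c)"
    "\<And>\<omega> x. \<omega> \<in> space P \<Longrightarrow> \<omega> \<notin> Bad \<Longrightarrow> norm x = 1 \<Longrightarrow>
       \<exists>u. norm u \<le> \<epsilon> \<and> Q \<omega> (x + u) + Q \<omega> (x - u) < 2 * c"
proof -
  interpret prob_space P by fact
  interpret pair_sigma_finite P "lborel :: (real^'r) measure" by unfold_locales
  define S :: "(real^'r) set" where "S = {y. 1 - \<epsilon> \<le> norm y \<and> norm y \<le> 1 + \<epsilon>}"
  have [measurable]: "S \<in> sets borel" unfolding S_def by measurable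
  have [measurable]: "case_prod Q \<in> borel_measurable (P \<Otimes>\<^sub>M lborel)"
    by (subst measurable_cong_sets[OF sets_pair_measure_cong[OF refl sets_lborel] refl]) fact
  define v where "v = unit_ball_vol (real CARD('r))"
  have v: "v > 0" unfolding v_def by simp
  have vol: "emeasure lborel (cball (0::real^'r) \<rho>) = ennreal (v * \<rho> ^ CARD('r))" if "\<rho> \<ge> 0" for \<rho>
    using emeasure_cball[OF that, of "0::real^'r"] by (simp add: v_def)
  define \<Phi> where "\<Phi> \<omega> = (\<integral>\<^sup>+y. ennreal (exp (Q \<omega> y)) * indicator S y \<partial>lborel)" for \<omega>
  have \<Phi>m [measurable]: "\<Phi> \<in> borel_measurable P" unfolding \<Phi>_def by measurable
  define \<theta> where "\<theta> = exp c * (v * \<epsilon> ^ CARD('r))"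
  have \<theta>: "\<theta> > 0" using v \<epsilon> by (simp add: \<theta>_def)
  define Bad where "Bad = {\<omega> \<in> space P. 1 \<le> ennreal (1 / \<theta>) * \<Phi> \<omega>}"
  have "(\<integral>\<^sup>+\<omega>. \<Phi> \<omega> \<partial>P) = (\<integral>\<^sup>+y. (\<integral>\<^sup>+\<omega>. ennreal (exp (Q \<omega> y)) * indicator S y \<partial>P) \<partial>lborel)"
    unfolding \<Phi>_def by (rule Fubini'[symmetric]) measurable
  also have "\<dots> \<le> (\<integral>\<^sup>+y. ennreal K * indicator (cball 0 (1 + \<epsilon>)) y \<partial>(lborel :: (real^'r) measure))"
  proof (intro nn_integral_mono)
    fix y :: "real^'r"
    show "(\<integral>\<^sup>+\<omega>. ennreal (exp (Q \<omega> y)) * indicator S y \<partial>P) \<le> ennreal K * indicator (cball 0 (1 + \<epsilon>)) y"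
      using mgf[of y] by (cases "y \<in> S") (auto simp: S_def)
  qed
  also have "\<dots> = ennreal K * ennreal (v * (1 + \<epsilon>) ^ CARD('r))"
    using \<epsilon> by (subst nn_integral_cmult_indicator) (auto simp: vol)
  finally have E\<Phi>: "(\<integral>\<^sup>+\<omega>. \<Phi> \<omega> \<partial>P) \<le> ennreal (K * (v * (1 + \<epsilon>) ^ CARD('r)))"
    using K v \<epsilon> by (simp add: ennreal_mult)
  show ?thesis
  proof
    show "Bad \<in> sets P" unfolding Bad_def by measurable
    have "emeasure P Bad \<le> ennreal (1 / \<theta>) * (\<integral>\<^sup>+\<omega>. \<Phi> \<omega> * indicator (space P) \<omega> \<partial>P)"
      unfolding Bad_def by (rule nn_integral_Markov_inequality) measurable
    also have "(\<integral>\<^sup>+\<omega>. \<Phi> \<omega> * indicator (space P) \<omega> \<partial>P) = (\<integral>\<^sup>+\<omega>. \<Phi> \<omega> \<partial>P)"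
      by (intro nn_integral_cong) simp
    also have "ennreal (1 / \<theta>) * \<dots> \<le> ennreal (1 / \<theta>) * ennreal (K * (v * (1 + \<epsilon>) ^ CARD('r)))"
      by (intro mult_left_mono E\<Phi>) simp
    also have "\<dots> = ennreal (1 / \<theta> * (K * (v * (1 + \<epsilon>) ^ CARD('r))))"
      using \<theta> K v \<epsilon> by (simp add: ennreal_mult[symmetric])
    also have "1 / \<theta> * (K * (v * (1 + \<epsilon>) ^ CARD('r))) = ((1 + \<epsilon>) / \<epsilon>) ^ CARD('r) * K * exp (- c)"
      using v \<epsilon> by (simp add: \<theta>_def exp_minus power_divide field_simps)
    also have "(1 + \<epsilon>) / \<epsilon> = 1 + 1 / \<epsilon>" using \<epsilon> by (simp add: field_simps)
    finally show "measure P Bad \<le> (1 + 1 / \<epsilon>) ^ CARD('r) * K * exp (- c)"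
      using \<epsilon> K by (simp add: emeasure_eq_measure)
    fix \<omega> and x :: "real^'r" assume \<omega>: "\<omega> \<in> space P" "\<omega> \<notin> Bad" and x: "norm x = 1"
    show "\<exists>u. norm u \<le> \<epsilon> \<and> Q \<omega> (x + u) + Q \<omega> (x - u) < 2 * c"
    proof (rule ccontr)
      assume "\<not> ?thesis"
      then have "\<And>u. norm u \<le> \<epsilon> \<Longrightarrow> 2 * c \<le> Q \<omega> (x + u) + Q \<omega> (x - u)" by (simp add: not_less)
      moreover have "Q \<omega> \<in> borel_measurable borel" using \<omega>(1) by measurable
      ultimately have "ennreal (exp c) * emeasure lborel (cball (0::real^'r) \<epsilon>)
          \<le> (\<integral>\<^sup>+y. ennreal (exp (Q \<omega> y)) * indicator (cball x \<epsilon>) y \<partial>lborel)"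
        by (intro ball_average_exp)
      also have "\<dots> \<le> \<Phi> \<omega>"
        unfolding \<Phi>_def
      proof (intro nn_integral_mono mult_left_mono)
        fix y
        have "y \<in> S" if "norm (x - y) \<le> \<epsilon>"
          using that x norm_triangle_ineq2[of x y] norm_triangle_ineq2[of y x]
          by (auto simp: S_def norm_minus_commute)
        then show "indicator (cball x \<epsilon>) y \<le> (indicator S y :: ennreal)"
          by (auto simp: indicator_def dist_norm)
      qed simp
      also have "ennreal (exp c) * emeasure lborel (cball (0::real^'r) \<epsilon>) = ennreal \<theta>"
        using \<epsilon> v by (simp add: vol \<theta>_def ennreal_mult)
      finally have "ennreal (1 / \<theta>) * ennreal \<theta> \<le> ennreal (1 / \<theta>) * \<Phi> \<omega>"
        by (intro mult_left_mono) auto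
      then have "1 \<le> ennreal (1 / \<theta>) * \<Phi> \<omega>" using \<theta> by (simp add: ennreal_mult[symmetric])
      with \<omega> show False by (simp add: Bad_def)
    qed
  qed
qed

lemma chernoff_bound:
  assumes "prob_space P" and [measurable]: "X \<in> borel_measurable P"
    and K: "(\<integral>\<^sup>+\<omega>. ennreal (exp (X \<omega>)) \<partial>P) \<le> ennreal K" "0 \<le> K"
  shows "measure P {\<omega> \<in> space P. c \<le> X \<omega>} \<le> K * exp (- c)"
proof -
  interpret prob_space P by fact
  have "{\<omega> \<in> space P. c \<le> X \<omega>} = {\<omega> \<in> space P. 1 \<le> ennreal (exp (- c)) * ennreal (exp (X \<omega>))}"
    by (auto simp: ennreal_mult[symmetric] exp_add[symmetric] simp flip: ennreal_1)
  also have "emeasure P \<dots> \<le> ennreal (exp (- c)) * (\<integral>\<^sup>+\<omega>. ennreal (exp (X \<omega>)) * indicator (space P) \<omega> \<partial>P)"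
    by (rule nn_integral_Markov_inequality) measurable
  also have "(\<integral>\<^sup>+\<omega>. ennreal (exp (X \<omega>)) * indicator (space P) \<omega> \<partial>P) = (\<integral>\<^sup>+\<omega>. ennreal (exp (X \<omega>)) \<partial>P)"
    by (intro nn_integral_cong) simp
  also have "ennreal (exp (- c)) * \<dots> \<le> ennreal (exp (- c)) * ennreal K"
    by (intro mult_left_mono K) simp
  finally show ?thesis using K(2) by (simp add: emeasure_eq_measure ennreal_mult[symmetric] mult_ac)
qed

lemma proj_energy_measurable:
  fixes G :: "'a \<Rightarrow> real^'n^'r"
  assumes "gaussian_matrix P G"
  shows "(\<lambda>(\<omega>, y). proj_energy D (G \<omega>) y) \<in> borel_measurable (P \<Otimes>\<^sub>M borel)"
proof -
  note [measurable] = gaussian_measurable[OF assms]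
  have "(\<lambda>(G :: real^'n^'r, y). proj_energy D G y) \<in> borel_measurable (borel \<Otimes>\<^sub>M borel)"
    using borel_measurable_continuous_onI[OF continuous_proj_energy] by (simp add: borel_prod)
  from measurable_compose[OF _ this, of "\<lambda>(\<omega>, y). (G \<omega>, y)" "P \<Otimes>\<^sub>M borel"]
  show ?thesis by (simp add: split_def)
qed

lemma proj_energy_sphere_bounds:
  assumes "\<And>x. norm x = 1 \<Longrightarrow> lo \<le> proj_energy D G x \<and> proj_energy D G x \<le> hi"
  shows "lo * (norm y)\<^sup>2 \<le> proj_energy D G y \<and> proj_energy D G y \<le> hi * (norm y)\<^sup>2"
proof (cases "y = 0")
  case True
  then show ?thesis by (simp add: proj_energy_def)
next
  case False
  define x where "x = y /\<^sub>R norm y"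
  have x: "norm x = 1" "y = norm y *\<^sub>R x" using False by (auto simp: x_def)
  have "proj_energy D G y = (norm y)\<^sup>2 * proj_energy D G x"
    by (subst x(2)) (simp add: proj_energy_scaleR)
  with assms[OF x(1)] show ?thesis by (auto simp: mult.commute intro!: mult_right_mono)
qed

text \<open>
  By the parallelogram law, the mean of the form \<open>q\<close> over \<open>x + u\<close> and \<open>x - u\<close> is \<open>q(x) + q(u)\<close>. For
  the upper bound \<open>q(u) \<ge> 0\<close> is harmless, and for the lower bound the loss \<open>q(u) \<le> \<epsilon>\<^sup>2 hi\<close> is of second
  order in \<open>\<epsilon>\<close>, whereas a net loses to first order.
\<close>

theorem gaussian_extreme_energy:
  fixes G :: "'a \<Rightarrow> real^'n^'r"
  assumes P: "prob_space P" and G: "gaussian_matrix P G"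
    and D: "finite D" "pairwise orthogonal D" "\<And>d. d \<in> D \<Longrightarrow> norm d = 1"
    and \<epsilon>: "0 < \<epsilon>" "\<epsilon> < 1" and s: "0 < s" "2 * s * (1 + \<epsilon>)\<^sup>2 < 1" and \<mu>: "0 < \<mu>"
  obtains Bad where "Bad \<in> sets P"
    "measure P Bad \<le> (1 + 1 / \<epsilon>) ^ CARD('r) *
       ((1 / sqrt (1 - 2 * s * (1 + \<epsilon>)\<^sup>2)) ^ card D * exp (- (s * hi)) +
        (1 / sqrt (1 + 2 * \<mu> * (1 - \<epsilon>)\<^sup>2)) ^ card D * exp (\<mu> * (lo + \<epsilon>\<^sup>2 * hi)))"
    "\<And>\<omega> y. \<omega> \<in> space P \<Longrightarrow> \<omega> \<notin> Bad \<Longrightarrow>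
       lo * (norm y)\<^sup>2 \<le> proj_energy D (G \<omega>) y \<and> proj_energy D (G \<omega>) y \<le> hi * (norm y)\<^sup>2"
proof -
  interpret prob_space P by fact
  let ?q = "\<lambda>\<omega>. proj_energy D (G \<omega>)"
  let ?K1 = "(1 / sqrt (1 - 2 * s * (1 + \<epsilon>)\<^sup>2)) ^ card D"
  let ?K2 = "(1 / sqrt (1 + 2 * \<mu> * (1 - \<epsilon>)\<^sup>2)) ^ card D"
  note [measurable] = proj_energy_measurable[OF G, of D, unfolded split_def]
  have meas: "case_prod (\<lambda>\<omega> y. t * ?q \<omega> y) \<in> borel_measurable (P \<Otimes>\<^sub>M borel)" for t
    unfolding split_def by measurable
  obtain B1 where B1: "B1 \<in> sets P" "measure P B1 \<le> (1 + 1 / \<epsilon>) ^ CARD('r) * ?K1 * exp (- (s * hi))"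
    "\<And>\<omega> x. \<omega> \<in> space P \<Longrightarrow> \<omega> \<notin> B1 \<Longrightarrow> norm x = 1 \<Longrightarrow>
       \<exists>u. norm u \<le> \<epsilon> \<and> s * ?q \<omega> (x + u) + s * ?q \<omega> (x - u) < 2 * (s * hi)"
  proof (rule random_exp_cover_bound[OF P meas \<epsilon>(1), of ?K1])
    show "0 \<le> ?K1" using s by simp
    fix y :: "real^'r" assume y: "1 - \<epsilon> \<le> norm y" "norm y \<le> 1 + \<epsilon>"
    have "(norm y)\<^sup>2 \<le> (1 + \<epsilon>)\<^sup>2" using y by (intro power_mono) auto
    then have le: "2 * s * (norm y)\<^sup>2 \<le> 2 * s * (1 + \<epsilon>)\<^sup>2" using s by simp
    then have "(\<integral>\<^sup>+\<omega>. ennreal (exp (s * ?q \<omega> y)) \<partial>P) = ennreal ((1 / sqrt (1 - 2 * s * (norm y)\<^sup>2)) ^ card D)"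
      using s(2) by (intro nn_integral_exp_proj_energy P G D) auto
    also have "\<dots> \<le> ennreal ?K1"
    proof -
      have "0 < 1 - 2 * s * (norm y)\<^sup>2" using le s(2) by linarith
      then show ?thesis
        using le s(2) by (intro ennreal_leI power_mono divide_left_mono mult_pos_pos) (simp_all del: mult_le_cancel_left_pos)
    qed
    finally show "(\<integral>\<^sup>+\<omega>. ennreal (exp (s * ?q \<omega> y)) \<partial>P) \<le> ennreal ?K1" .
  qed blast
  obtain B2 where B2: "B2 \<in> sets P"
    "measure P B2 \<le> (1 + 1 / \<epsilon>) ^ CARD('r) * ?K2 * exp (- (- (\<mu> * (lo + \<epsilon>\<^sup>2 * hi))))"
    "\<And>\<omega> x. \<omega> \<in> space P \<Longrightarrow> \<omega> \<notin> B2 \<Longrightarrow> norm x = 1 \<Longrightarrow>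
       \<exists>u. norm u \<le> \<epsilon> \<and> - \<mu> * ?q \<omega> (x + u) + - \<mu> * ?q \<omega> (x - u) < 2 * - (\<mu> * (lo + \<epsilon>\<^sup>2 * hi))"
  proof (rule random_exp_cover_bound[OF P meas \<epsilon>(1), of ?K2 "- \<mu>"])
    show "0 \<le> ?K2" using \<mu> by (intro zero_le_power divide_nonneg_nonneg) auto
    fix y :: "real^'r" assume y: "1 - \<epsilon> \<le> norm y" "norm y \<le> 1 + \<epsilon>"
    have "(1 - \<epsilon>)\<^sup>2 \<le> (norm y)\<^sup>2" using y \<epsilon> by (intro power_mono) auto
    then have le: "2 * \<mu> * (1 - \<epsilon>)\<^sup>2 \<le> 2 * \<mu> * (norm y)\<^sup>2" using \<mu> by simp
    have pos: "0 \<le> 2 * \<mu> * (norm y)\<^sup>2" "0 \<le> 2 * \<mu> * (1 - \<epsilon>)\<^sup>2" using \<mu> by auto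
    have "(\<integral>\<^sup>+\<omega>. ennreal (exp (- \<mu> * ?q \<omega> y)) \<partial>P) = ennreal ((1 / sqrt (1 - 2 * - \<mu> * (norm y)\<^sup>2)) ^ card D)"
      using pos by (intro nn_integral_exp_proj_energy P G D) auto
    also have "\<dots> \<le> ennreal ?K2"
      using le pos by (intro ennreal_leI power_mono divide_left_mono mult_pos_pos) auto
    finally show "(\<integral>\<^sup>+\<omega>. ennreal (exp (- \<mu> * ?q \<omega> y)) \<partial>P) \<le> ennreal ?K2" .
  qed blast
  show ?thesis
  proof
    show "B1 \<union> B2 \<in> sets P" using B1 B2 by auto
    have "measure P (B1 \<union> B2) \<le> measure P B1 + measure P B2" by (rule measure_Un_le) fact+
    also have "\<dots> \<le> (1 + 1 / \<epsilon>) ^ CARD('r) * ?K1 * exp (- (s * hi)) +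
        (1 + 1 / \<epsilon>) ^ CARD('r) * ?K2 * exp (- (- (\<mu> * (lo + \<epsilon>\<^sup>2 * hi))))"
      by (intro add_mono B1 B2)
    finally show "measure P (B1 \<union> B2) \<le> (1 + 1 / \<epsilon>) ^ CARD('r) *
       (?K1 * exp (- (s * hi)) + ?K2 * exp (\<mu> * (lo + \<epsilon>\<^sup>2 * hi)))"
      by (simp only: distrib_left mult.assoc minus_minus)
    fix \<omega> y assume \<omega>: "\<omega> \<in> space P" "\<omega> \<notin> B1 \<union> B2"
    have up: "?q \<omega> x \<le> hi" if "norm x = 1" for x
    proof -
      obtain u where u: "s * ?q \<omega> (x + u) + s * ?q \<omega> (x - u) < 2 * (s * hi)"
        using B1(3)[OF \<omega>(1) _ \<open>norm x = 1\<close>] \<omega>(2) by blast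
      then have "s * (?q \<omega> (x + u) + ?q \<omega> (x - u)) < s * (2 * hi)" by (simp add: algebra_simps)
      then show ?thesis using s(1) proj_energy_nonneg[of D "G \<omega>" u]
        by (simp add: proj_energy_parallelogram)
    qed
    have lo: "lo \<le> ?q \<omega> x" if "norm x = 1" for x
    proof -
      obtain u where u: "norm u \<le> \<epsilon>"
        "- \<mu> * ?q \<omega> (x + u) + - \<mu> * ?q \<omega> (x - u) < 2 * - (\<mu> * (lo + \<epsilon>\<^sup>2 * hi))"
        using B2(3)[OF \<omega>(1) _ \<open>norm x = 1\<close>] \<omega>(2) by blast
      then have "\<mu> * (2 * (lo + \<epsilon>\<^sup>2 * hi)) < \<mu> * (?q \<omega> (x + u) + ?q \<omega> (x - u))" by (simp add: algebra_simps)
      then have 1: "lo + \<epsilon>\<^sup>2 * hi < ?q \<omega> x + ?q \<omega> u" using \<mu>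
        by (simp add: proj_energy_parallelogram)
      have "?q \<omega> u \<le> hi * (norm u)\<^sup>2"
        using proj_energy_sphere_bounds[of 0 D "G \<omega>" hi u] up proj_energy_nonneg by auto
      also have "\<dots> \<le> \<epsilon>\<^sup>2 * hi"
      proof -
        have "0 \<le> hi" using up[of "axis undefined 1"] proj_energy_nonneg[of D "G \<omega>"]
          by (metis norm_axis_1 order_trans)
        moreover have "(norm u)\<^sup>2 \<le> \<epsilon>\<^sup>2" using u(1) by (intro power_mono) auto
        ultimately show ?thesis by (simp add: mult.commute[of hi] mult_right_mono)
      qed
      finally show ?thesis using 1 by simp
    qed
    show "lo * (norm y)\<^sup>2 \<le> ?q \<omega> y \<and> ?q \<omega> y \<le> hi * (norm y)\<^sup>2"
      by (rule proj_energy_sphere_bounds) (use up lo in auto)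
  qed
qed

text \<open>
  For one row the unit sphere is a pair of antipodal points, and the factor \<open>(1 + 1/\<epsilon>)\<^sup>r\<close> can be
  avoided.
\<close>

theorem gaussian_extreme_energy_single_row:
  fixes G :: "'a \<Rightarrow> real^'n^'r"
  assumes P: "prob_space P" and G: "gaussian_matrix P G" and r: "CARD('r) = 1"
    and D: "finite D" "pairwise orthogonal D" "\<And>d. d \<in> D \<Longrightarrow> norm d = 1"
    and s: "0 < s" "2 * s < 1" and \<mu>: "0 < \<mu>"
  obtains Bad where "Bad \<in> sets P"
    "measure P Bad \<le> (1 / sqrt (1 - 2 * s)) ^ card D * exp (- (s * hi)) +
        (1 / sqrt (1 + 2 * \<mu>)) ^ card D * exp (\<mu> * lo)"
    "\<And>\<omega> y. \<omega> \<in> space P \<Longrightarrow> \<omega> \<notin> Bad \<Longrightarrow>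
       lo * (norm y)\<^sup>2 \<le> proj_energy D (G \<omega>) y \<and> proj_energy D (G \<omega>) y \<le> hi * (norm y)\<^sup>2"
proof -
  interpret prob_space P by fact
  obtain i :: 'r where i: "\<And>j. j = i" using r by (metis card_1_singletonE UNIV_I singletonD)
  define e :: "real^'r" where "e = axis i 1"
  have e: "norm e = 1" by (simp add: e_def)
  have y_eq: "y = (y $ i) *\<^sub>R e" for y
    by (simp add: vec_eq_iff e_def axis_def) (metis i)
  let ?q = "\<lambda>\<omega>. proj_energy D (G \<omega>)"
  have [measurable]: "(\<lambda>\<omega>. ?q \<omega> e) \<in> borel_measurable P"
    using measurable_compose[OF measurable_Pair2' proj_energy_measurable[OF G, of D], of e]
    by simp
  define B1 where "B1 = {\<omega> \<in> space P. s * hi \<le> s * ?q \<omega> e}"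
  define B2 where "B2 = {\<omega> \<in> space P. - \<mu> * lo \<le> - \<mu> * ?q \<omega> e}"
  have [measurable]: "B1 \<in> sets P" "B2 \<in> sets P" unfolding B1_def B2_def by measurable
  have 1: "measure P B1 \<le> (1 / sqrt (1 - 2 * s)) ^ card D * exp (- (s * hi))"
    unfolding B1_def using s nn_integral_exp_proj_energy[OF P G D, of s e]
    by (intro chernoff_bound[OF P]) (auto simp: e)
  have 2: "measure P B2 \<le> (1 / sqrt (1 + 2 * \<mu>)) ^ card D * exp (- (- \<mu> * lo))"
    unfolding B2_def using \<mu> nn_integral_exp_proj_energy[OF P G D, of "- \<mu>" e]
    by (intro chernoff_bound[OF P]) (auto simp: e)
  show ?thesis
  proof
    show "B1 \<union> B2 \<in> sets P" by measurable
    show "measure P (B1 \<union> B2) \<le> (1 / sqrt (1 - 2 * s)) ^ card D * exp (- (s * hi)) +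
        (1 / sqrt (1 + 2 * \<mu>)) ^ card D * exp (\<mu> * lo)"
      using 1 2 measure_Un_le[of B1 P B2] by simp
    fix \<omega> y assume \<omega>: "\<omega> \<in> space P" "\<omega> \<notin> B1 \<union> B2"
    then have q: "lo < ?q \<omega> e" "?q \<omega> e < hi" using s \<mu> by (auto simp: B1_def B2_def not_le)
    have "?q \<omega> x = ?q \<omega> e" if "norm x = 1" for x
    proof -
      have "\<bar>x $ i\<bar> = 1" using that by (subst (asm) y_eq) (simp add: e)
      then show ?thesis by (subst y_eq) (simp add: proj_energy_scaleR abs_square_eq_1 power2_eq_1_iff abs_if split: if_splits)
    qed
    with q show "lo * (norm y)\<^sup>2 \<le> ?q \<omega> y \<and> ?q \<omega> y \<le> hi * (norm y)\<^sup>2"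
      by (intro proj_energy_sphere_bounds) auto
  qed
qed

text \<open>
  \<open>\<parallel>G F\<^sup>T\<parallel>\<^sup>2 / \<parallel>F\<parallel>\<^sup>2\<close> is a convex combination of the \<open>\<parallel>G f\<parallel>\<^sup>2\<close> for the normalised rows \<open>f\<close> of \<open>F\<close>. These
  are dependent, but by Jensen's inequality the combination has no larger exponential moments than one
  of them, which is a sum of \<open>r\<close> independent squares.
\<close>

theorem gaussian_product_bound:
  fixes G :: "'a \<Rightarrow> real^'n^'r" and F :: "real^'n^'m"
  assumes P: "prob_space P" and G: "gaussian_matrix P G" and s: "0 < s" "2 * s < 1"
  obtains Bad where "Bad \<in> sets P"
    "measure P Bad \<le> (1 / sqrt (1 - 2 * s)) ^ CARD('r) * exp (- (s * t))"
    "\<And>\<omega>. \<omega> \<in> space P \<Longrightarrow> \<omega> \<notin> Bad \<Longrightarrow> (norm (G \<omega> ** transpose F))\<^sup>2 \<le> t * (norm F)\<^sup>2"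
proof (cases "F = 0")
  case True
  show ?thesis by (rule that[of "{}"]) (use s in \<open>auto simp: True transpose_def zero_vec_def[symmetric] matrix_matrix_mult_def\<close>)
next
  case False
  interpret prob_space P by fact
  note [measurable] = gaussian_measurable[OF G]
  define f where "f i = (if F $ i = 0 then axis undefined 1 else (F $ i) /\<^sub>R norm (F $ i))" for i
  have f: "norm (f i) = 1" "F $ i = norm (F $ i) *\<^sub>R f i" for i by (auto simp: f_def)
  define d :: "'m \<Rightarrow> 'r \<Rightarrow> real^'n^'r" where "d i j = axis j (f i)" for i j
  define Q where "Q i \<omega> = (\<Sum>x\<in>range (d i). (G \<omega> \<bullet> x)\<^sup>2)" for i \<omega>
  have inj: "inj (d i)" for i
  proof (rule injI)
    fix j k assume "d i j = d i k"
    then have "d i j $ j = d i k $ j" by simp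
    then show "j = k" using f(1)[of i] by (auto simp: d_def axis_def split: if_splits)
  qed
  have Qf: "Q i \<omega> = (norm (G \<omega> *v f i))\<^sup>2" for i \<omega>
    unfolding Q_def sum.reindex[OF inj] power2_norm_eq_inner[of "G \<omega> *v f i"] inner_vec_def[of "G \<omega> *v f i"]
    by (simp add: d_def inner_axis matrix_vector_mul_component power2_eq_square)
  have EQ: "(\<integral>\<^sup>+\<omega>. ennreal (exp (s * Q i \<omega>)) \<partial>P) = ennreal ((1 / sqrt (1 - 2 * s)) ^ CARD('r))" for i
  proof -
    have "pairwise orthogonal (range (d i))"
      by (auto simp: pairwise_def orthogonal_def d_def inner_axis_axis)
    moreover have "norm x = 1" if "x \<in> range (d i)" for x
      using that f by (auto simp: d_def norm_eq_1 inner_axis_axis)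
    ultimately show ?thesis
      unfolding Q_def using s nn_integral_exp_quadratic_gaussian[OF P G, of s "range (d i)"]
      by (simp add: card_image[OF inj])
  qed
  define p where "p i = (norm (F $ i))\<^sup>2 / (norm F)\<^sup>2" for i
  have nF: "(norm F)\<^sup>2 > 0" using False by simp
  have p0: "0 \<le> p i" for i by (simp add: p_def)
  have p1: "(\<Sum>i\<in>UNIV. p i) = 1"
    using nF by (simp add: p_def sum_divide_distrib[symmetric] norm_matrix_sq[symmetric])
  define X where "X \<omega> = (norm (G \<omega> ** transpose F))\<^sup>2 / (norm F)\<^sup>2" for \<omega>
  have Xp: "X \<omega> = (\<Sum>i\<in>UNIV. p i * Q i \<omega>)" for \<omega>
  proof -
    have "norm (G \<omega> ** transpose F) = norm (F ** transpose (G \<omega>))"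
      by (metis matrix_transpose_mul norm_transpose transpose_transpose)
    moreover have "(norm (F ** transpose (G \<omega>)))\<^sup>2 = (\<Sum>i\<in>UNIV. (norm (F $ i))\<^sup>2 * Q i \<omega>)"
      unfolding norm_matrix_sq[of "F ** transpose (G \<omega>)"] row_matrix_mul
    proof (intro sum.cong refl)
      fix i
      show "(norm ((F $ i) v* transpose (G \<omega>)))\<^sup>2 = (norm (F $ i))\<^sup>2 * Q i \<omega>"
        by (subst f(2)) (simp add: Qf matrix_vector_mult_scaleR power_mult_distrib)
    qed
    ultimately show ?thesis by (simp add: X_def p_def sum_divide_distrib)
  qed
  have Qm [measurable]: "Q i \<in> borel_measurable P" for i unfolding Q_def by measurable
  have Xm [measurable]: "(\<lambda>\<omega>. s * X \<omega>) \<in> borel_measurable P" unfolding Xp by measurable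
  have "(\<integral>\<^sup>+\<omega>. ennreal (exp (s * X \<omega>)) \<partial>P) \<le> (\<integral>\<^sup>+\<omega>. (\<Sum>i\<in>UNIV. ennreal (p i) * ennreal (exp (s * Q i \<omega>))) \<partial>P)"
  proof (intro nn_integral_mono)
    fix \<omega>
    have "exp (\<Sum>i\<in>UNIV. p i *\<^sub>R (s * Q i \<omega>)) \<le> (\<Sum>i\<in>UNIV. p i * exp (s * Q i \<omega>))"
      by (rule convex_on_sum[OF _ _ exp_convex]) (auto simp: p0 p1)
    then have "exp (s * X \<omega>) \<le> (\<Sum>i\<in>UNIV. p i * exp (s * Q i \<omega>))"
      by (simp add: Xp sum_distrib_left mult_ac)
    then have "ennreal (exp (s * X \<omega>)) \<le> ennreal (\<Sum>i\<in>UNIV. p i * exp (s * Q i \<omega>))" by (rule ennreal_leI)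
    also have "\<dots> = (\<Sum>i\<in>UNIV. ennreal (p i) * ennreal (exp (s * Q i \<omega>)))"
      by (simp add: sum_ennreal[symmetric] p0 ennreal_mult)
    finally show "ennreal (exp (s * X \<omega>)) \<le> \<dots>" .
  qed
  also have "\<dots> = (\<Sum>i\<in>UNIV. ennreal (p i) * ennreal ((1 / sqrt (1 - 2 * s)) ^ CARD('r)))"
    by (simp add: nn_integral_sum nn_integral_cmult EQ)
  also have "\<dots> = ennreal ((1 / sqrt (1 - 2 * s)) ^ CARD('r))"
    by (simp add: sum_distrib_right[symmetric] sum_ennreal p0 p1)
  finally have mgf: "(\<integral>\<^sup>+\<omega>. ennreal (exp (s * X \<omega>)) \<partial>P) \<le> ennreal ((1 / sqrt (1 - 2 * s)) ^ CARD('r))" .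
  show ?thesis
  proof
    show "{\<omega> \<in> space P. s * t \<le> s * X \<omega>} \<in> sets P" by measurable
    show "measure P {\<omega> \<in> space P. s * t \<le> s * X \<omega>} \<le> (1 / sqrt (1 - 2 * s)) ^ CARD('r) * exp (- (s * t))"
      by (rule chernoff_bound[OF P Xm mgf]) (use s in simp)
    fix \<omega> assume "\<omega> \<in> space P" "\<omega> \<notin> {\<omega> \<in> space P. s * t \<le> s * X \<omega>}"
    then have "X \<omega> < t" using s by simp
    then show "(norm (G \<omega> ** transpose F))\<^sup>2 \<le> t * (norm F)\<^sup>2"
      using nF by (simp add: X_def field_simps)
  qed
qed

section \<open>Numerical tail bounds\<close>

text \<open>
  The Lagrange remainder is nonnegative.
\<close>

lemma exp_ge_Taylor:
  assumes "even n \<or> 0 \<le> (x::real)"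
  shows "(\<Sum>m<n. x ^ m / fact m) \<le> exp x"
proof -
  obtain t where "exp x = (\<Sum>m<n. x ^ m / fact m) + exp t / fact n * x ^ n"
    using Maclaurin_exp_le[of x n] by blast
  moreover have "0 \<le> x ^ n" using assms by (auto simp: zero_le_power_eq)
  ultimately show ?thesis by simp
qed

text \<open>
  The first two entries bound the covering factors \<open>21\<close> and \<open>11\<close>. Entries 3 to 7 fix the share of the
  failure probability that a tail may take, and the remaining ones bound the moment factors.
\<close>

lemma exp_numerals:
  "21 \<le> exp (61 / 20 :: real)"
  "11 \<le> exp (12 / 5 :: real)"
  "5 \<le> exp (17 / 10 :: real)"
  "5 / 3 \<le> exp (57 / 100 :: real)"
  "2 \<le> exp (1 :: real)"
  "6 / 5 \<le> exp (195 / 1000 :: real)"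
  "6 \<le> exp (4 :: real)"
  "1000 / 559 \<le> exp (583 / 1000 :: real)"
  "2 \<le> exp (694 / 1000 :: real)"
  "5 \<le> exp (162 / 100 :: real)"
  "1000 / 395 \<le> exp (93 / 100 :: real)"
  "10000 / 22635 \<le> exp (- (814 / 1000) :: real)"
  "10 / 24 \<le> exp (- (86 / 100) :: real)"
  "100 / 424 \<le> exp (- (1438 / 1000) :: real)"
  "1 / 3 \<le> exp (- (109 / 100) :: real)"
  subgoal by (rule order_trans[OF _ exp_ge_Taylor[where n = 12]]) (simp_all add: lessThan_nat_numeral lessThan_Suc fact_numeral power_divide)
  subgoal by (rule order_trans[OF _ exp_ge_Taylor[where n = 12]]) (simp_all add: lessThan_nat_numeral lessThan_Suc fact_numeral power_divide)
  subgoal by (rule order_trans[OF _ exp_ge_Taylor[where n = 8]]) (simp_all add: lessThan_nat_numeral lessThan_Suc fact_numeral power_divide)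
  subgoal by (rule order_trans[OF _ exp_ge_Taylor[where n = 8]]) (simp_all add: lessThan_nat_numeral lessThan_Suc fact_numeral power_divide)
  subgoal by (rule order_trans[OF _ exp_ge_Taylor[where n = 8]]) (simp_all add: lessThan_nat_numeral lessThan_Suc fact_numeral power_divide)
  subgoal by (rule order_trans[OF _ exp_ge_Taylor[where n = 8]]) (simp_all add: lessThan_nat_numeral lessThan_Suc fact_numeral power_divide)
  subgoal by (rule order_trans[OF _ exp_ge_Taylor[where n = 8]]) (simp_all add: lessThan_nat_numeral lessThan_Suc fact_numeral power_divide)
  subgoal by (rule order_trans[OF _ exp_ge_Taylor[where n = 8]]) (simp_all add: lessThan_nat_numeral lessThan_Suc fact_numeral power_divide)
  subgoal by (rule order_trans[OF _ exp_ge_Taylor[where n = 8]]) (simp_all add: lessThan_nat_numeral lessThan_Suc fact_numeral power_divide)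
  subgoal by (rule order_trans[OF _ exp_ge_Taylor[where n = 12]]) (simp_all add: lessThan_nat_numeral lessThan_Suc fact_numeral power_divide)
  subgoal by (rule order_trans[OF _ exp_ge_Taylor[where n = 8]]) (simp_all add: lessThan_nat_numeral lessThan_Suc fact_numeral power_divide)
  subgoal by (rule order_trans[OF _ exp_ge_Taylor[where n = 8]]) (simp_all add: lessThan_nat_numeral lessThan_Suc fact_numeral power_divide)
  subgoal by (rule order_trans[OF _ exp_ge_Taylor[where n = 8]]) (simp_all add: lessThan_nat_numeral lessThan_Suc fact_numeral power_divide)
  subgoal by (rule order_trans[OF _ exp_ge_Taylor[where n = 8]]) (simp_all add: lessThan_nat_numeral lessThan_Suc fact_numeral power_divide)
  subgoal by (rule order_trans[OF _ exp_ge_Taylor[where n = 8]]) (simp_all add: lessThan_nat_numeral lessThan_Suc fact_numeral power_divide)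
  done

text \<open>
  Puts the moment factor of a quadratic form into exponential shape, so that tail bounds become linear
  inequalities between exponents.
\<close>

lemma inverse_sqrt_power_le:
  assumes "exp (- (2 * c)) \<le> a"
  shows "(1 / sqrt a) ^ k \<le> exp (c * real k)"
proof -
  have "exp (- c) = sqrt (exp (- (2 * c)))"
    by (rule real_sqrt_unique[symmetric]) (simp_all add: exp_double[symmetric])
  also have "\<dots> \<le> sqrt a" using assms by simp
  finally have "1 / sqrt a \<le> 1 / exp (- c)" by (intro divide_left_mono) (auto intro: mult_pos_pos less_le_trans[OF exp_gt_zero])
  then have "1 / sqrt a \<le> exp c" by (simp add: exp_minus field_simps)
  moreover have "0 \<le> 1 / sqrt a" using order_trans[OF exp_ge_zero assms] by simp
  ultimately have "(1 / sqrt a) ^ k \<le> exp c ^ k" by (intro power_mono)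
  also have "\<dots> = exp (c * real k)" by (simp add: exp_of_nat_mult[symmetric] mult.commute)
  finally show ?thesis .
qed

lemma exp_le_share:
  assumes "K \<le> exp d" "0 < K" "x + d \<le> y"
  shows "exp x \<le> 1 / K * exp (y :: real)"
proof -
  have "K * exp x \<le> exp d * exp x" using assms by (intro mult_right_mono) auto
  also have "\<dots> \<le> exp y" using assms by (simp add: exp_add[symmetric] add.commute)
  finally show ?thesis using assms by (simp add: field_simps)
qed

lemma power_mult_exp_le:
  assumes "0 \<le> a" "a \<le> exp b" "x \<le> exp c" "0 \<le> x"
  shows "a ^ k * (x * exp y) \<le> exp (b * real k + c + y)"
proof -
  have "a ^ k \<le> exp b ^ k" using assms by (intro power_mono)
  also have "\<dots> = exp (b * real k)" by (simp add: exp_of_nat_mult[symmetric] mult.commute)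
  finally have "a ^ k * (x * exp y) \<le> exp (b * real k) * (exp c * exp y)"
    using assms by (intro mult_mono) auto
  then show ?thesis by (simp add: exp_add)
qed

lemma orthonormal_Basis: "pairwise orthogonal (Basis :: 'v::euclidean_space set)"
  by (auto simp: pairwise_def orthogonal_def inner_not_same_Basis)

text \<open>
  \<open>gaussian_extreme_energy\<close> with \<open>\<epsilon> = 1/20\<close>. The covering factor \<open>21\<^sup>r\<close> is at most
  \<open>exp (3.05 r)\<close>, thus below \<open>exp (0.085 n)\<close>. For \<open>s = 1/5\<close> and \<open>\<mu> = 7/10\<close> the two tails beat it with
  exponents \<open>- 0.128 n\<close> and \<open>- 0.123 n\<close>. Each side takes a fifth of \<open>exp (- n / 72)\<close>; for this
  \<open>n \<ge> 73\<close> suffices. If \<open>r = 1\<close>, only \<open>n \<ge> 37\<close> is known, and the bound for a single row is used.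
\<close>

theorem wide_gaussian_well_conditioned:
  fixes G :: "'a \<Rightarrow> real^'n^'r"
  assumes P: "prob_space P" and G: "gaussian_matrix P G" and nr: "36 * CARD('r) < CARD('n)"
  obtains Bad where "Bad \<in> sets P" "measure P Bad \<le> 2 / 5 * exp (- (real CARD('n) / 72))"
    "\<And>\<omega> y. \<omega> \<in> space P \<Longrightarrow> \<omega> \<notin> Bad \<Longrightarrow>
       4 / 10 * real CARD('n) * (norm y)\<^sup>2 \<le> (norm (y v* G \<omega>))\<^sup>2 \<and>
       (norm (y v* G \<omega>))\<^sup>2 \<le> 21 / 10 * real CARD('n) * (norm y)\<^sup>2"
proof -
  define n r where "n = real CARD('n)" and "r = real CARD('r)"
  have nr': "36 * r + 1 \<le> n" using nr unfolding n_def r_def by linarith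
  have card: "real (card (Basis :: (real^'n) set)) = n" by (simp add: n_def)
  have D: "finite (Basis :: (real^'n) set)" "pairwise orthogonal (Basis :: (real^'n) set)"
    "\<And>d. d \<in> (Basis :: (real^'n) set) \<Longrightarrow> norm d = 1"
    by (auto simp: orthonormal_Basis)
  show ?thesis
  proof (cases "CARD('r) = 1")
    case True
    obtain Bad where Bad: "Bad \<in> sets P"
      "measure P Bad \<le> (1 / sqrt (1 - 2 * (1 / 4))) ^ card (Basis :: (real^'n) set) * exp (- (1 / 4 * (21 / 10 * n))) +
        (1 / sqrt (1 + 2 * (7 / 10))) ^ card (Basis :: (real^'n) set) * exp (7 / 10 * (4 / 10 * n))"
      "\<And>\<omega> y. \<omega> \<in> space P \<Longrightarrow> \<omega> \<notin> Bad \<Longrightarrow>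
         4 / 10 * n * (norm y)\<^sup>2 \<le> proj_energy Basis (G \<omega>) y \<and> proj_energy Basis (G \<omega>) y \<le> 21 / 10 * n * (norm y)\<^sup>2"
      by (rule gaussian_extreme_energy_single_row[OF P G True D, of "1 / 4" "7 / 10" "21 / 10 * n" "4 / 10 * n"]) auto
    have n37: "37 \<le> n" using nr' True by (simp add: r_def)
    have "(1 / sqrt (1 - 2 * (1 / 4))) ^ card (Basis :: (real^'n) set) * exp (- (1 / 4 * (21 / 10 * n)))
        \<le> exp (347 / 1000 * n) * exp (- (1 / 4 * (21 / 10 * n)))"
      using inverse_sqrt_power_le[of "347 / 1000" "1 - 2 * (1 / 4)" "card (Basis :: (real^'n) set)"]
        exp_numerals(9) unfolding card
      by (intro mult_right_mono) (auto simp: exp_minus field_simps)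
    also have "\<dots> \<le> 1 / 5 * exp (- (n / 72))"
      unfolding exp_add[symmetric] by (rule exp_le_share[OF exp_numerals(3)]) (use n37 in auto)
    finally have 1: "(1 / sqrt (1 - 2 * (1 / 4))) ^ card (Basis :: (real^'n) set) * exp (- (1 / 4 * (21 / 10 * n)))
        \<le> 1 / 5 * exp (- (n / 72))" .
    have "(1 / sqrt (1 + 2 * (7 / 10))) ^ card (Basis :: (real^'n) set) * exp (7 / 10 * (4 / 10 * n))
        \<le> exp (- 43 / 100 * n) * exp (7 / 10 * (4 / 10 * n))"
      using inverse_sqrt_power_le[of "- 43 / 100" "1 + 2 * (7 / 10)" "card (Basis :: (real^'n) set)"]
        exp_numerals(13) unfolding card
      by (intro mult_right_mono) (auto simp: exp_minus field_simps)
    also have "\<dots> \<le> 1 / 5 * exp (- (n / 72))"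
      unfolding exp_add[symmetric] by (rule exp_le_share[OF exp_numerals(3)]) (use n37 in auto)
    finally have "measure P Bad \<le> 2 / 5 * exp (- (n / 72))" using 1 Bad(2) by simp
    then show ?thesis using that[OF Bad(1)] Bad(3) by (simp add: proj_energy_Basis n_def)
  next
    case False
    then have "CARD('r) \<ge> 2" using zero_less_card_finite[where 'a = 'r] by linarith
    then have r2: "r \<ge> 2" by (simp add: r_def)
    let ?K1 = "(1 / sqrt (1 - 2 * (1 / 5) * (1 + 1 / 20)\<^sup>2)) ^ card (Basis :: (real^'n) set)"
    let ?K2 = "(1 / sqrt (1 + 2 * (7 / 10) * (1 - 1 / 20)\<^sup>2)) ^ card (Basis :: (real^'n) set)"
    obtain Bad where Bad: "Bad \<in> sets P"
      "measure P Bad \<le> (1 + 1 / (1 / 20)) ^ CARD('r) *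
         (?K1 * exp (- (1 / 5 * (21 / 10 * n))) + ?K2 * exp (7 / 10 * (4 / 10 * n + (1 / 20)\<^sup>2 * (21 / 10 * n))))"
      "\<And>\<omega> y. \<omega> \<in> space P \<Longrightarrow> \<omega> \<notin> Bad \<Longrightarrow>
         4 / 10 * n * (norm y)\<^sup>2 \<le> proj_energy Basis (G \<omega>) y \<and> proj_energy Basis (G \<omega>) y \<le> 21 / 10 * n * (norm y)\<^sup>2"
      by (rule gaussian_extreme_energy[OF P G D, of "1 / 20" "1 / 5" "7 / 10" "21 / 10 * n" "4 / 10 * n"])
        (auto simp: power2_eq_square)
    have K1: "?K1 \<le> exp (2915 / 10000 * n)"
      using inverse_sqrt_power_le[of "2915 / 10000" "1 - 2 * (1 / 5) * (1 + 1 / 20)\<^sup>2" "card (Basis :: (real^'n) set)"]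
        exp_numerals(8) unfolding card
      by (auto simp: exp_minus field_simps power2_eq_square)
    have K2: "?K2 \<le> exp (- 407 / 1000 * n)"
      using inverse_sqrt_power_le[of "- 407 / 1000" "1 + 2 * (7 / 10) * (1 - 1 / 20)\<^sup>2" "card (Basis :: (real^'n) set)"]
        exp_numerals(12) unfolding card
      by (auto simp: exp_minus field_simps power2_eq_square)
    have base: "1 + 1 / (1 / 20) \<le> exp (61 / 20 :: real)" using exp_numerals(1) by simp
    have "(1 + 1 / (1 / 20)) ^ CARD('r) * (?K1 * exp (- (1 / 5 * (21 / 10 * n))))
        \<le> exp (61 / 20 * real CARD('r) + 2915 / 10000 * n + - (1 / 5 * (21 / 10 * n)))"
      by (rule power_mult_exp_le[OF _ base K1]) (auto simp: power2_eq_square)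
    also have "\<dots> \<le> 1 / 5 * exp (- (n / 72))"
      by (rule exp_le_share[OF exp_numerals(3)]) (use r2 nr' in \<open>auto simp: r_def\<close>)
    finally have 1: "(1 + 1 / (1 / 20)) ^ CARD('r) * (?K1 * exp (- (1 / 5 * (21 / 10 * n)))) \<le> 1 / 5 * exp (- (n / 72))" .
    have "(1 + 1 / (1 / 20)) ^ CARD('r) * (?K2 * exp (7 / 10 * (4 / 10 * n + (1 / 20)\<^sup>2 * (21 / 10 * n))))
        \<le> exp (61 / 20 * real CARD('r) + - 407 / 1000 * n + 7 / 10 * (4 / 10 * n + (1 / 20)\<^sup>2 * (21 / 10 * n)))"
      by (rule power_mult_exp_le[OF _ base K2]) (auto simp: power2_eq_square)
    also have "\<dots> \<le> 1 / 5 * exp (- (n / 72))"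
      by (rule exp_le_share[OF exp_numerals(3)]) (use r2 nr' in \<open>auto simp: r_def power2_eq_square\<close>)
    finally have "measure P Bad \<le> 2 / 5 * exp (- (n / 72))" using 1 Bad(2) by (simp only: distrib_left)
    then show ?thesis using that[OF Bad(1)] Bad(3) by (simp add: proj_energy_Basis n_def)
  qed
qed

text \<open>
  With \<open>k = l - r\<close>, the assumption on \<open>l\<close> gives \<open>k \<ge> 21 (r - 1)\<close>. For \<open>r \<ge> 2\<close> this yields
  \<open>r \<le> 2 k / 21\<close>, and \<open>\<epsilon> = 1/10\<close> with covering factor \<open>11\<^sup>r\<close> works. For \<open>r = 1\<close> the dimension \<open>k\<close> may be
  as small as \<open>1\<close>; the generous upper limit \<open>20 k\<close> makes the upper tail negligible there.
\<close>

theorem sketched_gaussian_lower_bound: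
  fixes G :: "'a \<Rightarrow> real^'n^'r" and l :: nat
  assumes P: "prob_space P" and G: "gaussian_matrix P G"
    and D: "finite D" "pairwise orthogonal D" "\<And>d. d \<in> D \<Longrightarrow> norm d = 1"
    and card: "card D = l - CARD('r)" and l: "CARD('r) < l" "22 * (CARD('r) - 1) < l"
  obtains Bad where "Bad \<in> sets P" "measure P Bad \<le> exp (- ((real l - real CARD('r)) / 20))"
    "\<And>\<omega> y. \<omega> \<in> space P \<Longrightarrow> \<omega> \<notin> Bad \<Longrightarrow>
       15 / 100 * real l * (norm y)\<^sup>2 \<le> proj_energy D (G \<omega>) y"
proof -
  define k r where "k = real l - real CARD('r)" and "r = real CARD('r)"
  have cardk: "real (card D) = k" using card l by (simp add: k_def)
  show ?thesis
  proof (cases "CARD('r) = 1")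
    case True
    have k1: "k \<ge> 1" using l True by (simp add: k_def)
    have lk: "real l = k + 1" using True by (simp add: k_def)
    obtain Bad where Bad: "Bad \<in> sets P"
      "measure P Bad \<le> (1 / sqrt (1 - 2 * (1 / 4))) ^ card D * exp (- (1 / 4 * (20 * k))) +
        (1 / sqrt (1 + 2 * 1)) ^ card D * exp (1 * (15 / 100 * real l))"
      "\<And>\<omega> y. \<omega> \<in> space P \<Longrightarrow> \<omega> \<notin> Bad \<Longrightarrow>
         15 / 100 * real l * (norm y)\<^sup>2 \<le> proj_energy D (G \<omega>) y \<and> proj_energy D (G \<omega>) y \<le> 20 * k * (norm y)\<^sup>2"
      by (rule gaussian_extreme_energy_single_row[OF P G True D, of "1 / 4" 1 "20 * k" "15 / 100 * real l"]) auto
    have "(1 / sqrt (1 - 2 * (1 / 4))) ^ card D * exp (- (1 / 4 * (20 * k)))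
        \<le> exp (347 / 1000 * k) * exp (- (1 / 4 * (20 * k)))"
      using inverse_sqrt_power_le[of "347 / 1000" "1 - 2 * (1 / 4)" "card D"] exp_numerals(9) unfolding cardk
      by (intro mult_right_mono) (auto simp: exp_minus field_simps)
    also have "\<dots> \<le> 1 / 6 * exp (- (k / 20))"
      unfolding exp_add[symmetric] by (rule exp_le_share[OF exp_numerals(7)]) (use k1 in auto)
    finally have 1: "(1 / sqrt (1 - 2 * (1 / 4))) ^ card D * exp (- (1 / 4 * (20 * k))) \<le> 1 / 6 * exp (- (k / 20))" .
    have "(1 / sqrt (1 + 2 * 1)) ^ card D * exp (1 * (15 / 100 * real l))
        \<le> exp (- 545 / 1000 * k) * exp (1 * (15 / 100 * real l))"
      using inverse_sqrt_power_le[of "- 545 / 1000" "1 + 2 * 1" "card D"] exp_numerals(15) unfolding cardk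
      by (intro mult_right_mono) (auto simp: exp_minus field_simps)
    also have "\<dots> \<le> 1 / (6 / 5) * exp (- (k / 20))"
      unfolding exp_add[symmetric] by (rule exp_le_share[OF exp_numerals(6)]) (simp, use k1 lk in linarith)
    finally have "measure P Bad \<le> exp (- (k / 20))" using 1 Bad(2) by simp
    then show ?thesis using that[OF Bad(1)] Bad(3) by (auto simp: k_def)
  next
    case False
    then have "CARD('r) \<ge> 2" using zero_less_card_finite[where 'a = 'r] by linarith
    then have r2: "r \<ge> 2" by (simp add: r_def)
    have "22 * (CARD('r) - 1) + 1 \<le> l" using l by linarith
    then have "real (22 * (CARD('r) - 1) + 1) \<le> real l" by (rule of_nat_mono)
    then have kr: "21 * r - 21 \<le> k" using \<open>CARD('r) \<ge> 2\<close> by (simp add: k_def r_def of_nat_diff)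
    have lk: "real l = k + r" by (simp add: k_def r_def)
    let ?K1 = "(1 / sqrt (1 - 2 * (1 / 4) * (1 + 1 / 10)\<^sup>2)) ^ card D"
    let ?K2 = "(1 / sqrt (1 + 2 * 2 * (1 - 1 / 10)\<^sup>2)) ^ card D"
    obtain Bad where Bad: "Bad \<in> sets P"
      "measure P Bad \<le> (1 + 1 / (1 / 10)) ^ CARD('r) *
         (?K1 * exp (- (1 / 4 * (32 / 10 * k))) + ?K2 * exp (2 * (15 / 100 * real l + (1 / 10)\<^sup>2 * (32 / 10 * k))))"
      "\<And>\<omega> y. \<omega> \<in> space P \<Longrightarrow> \<omega> \<notin> Bad \<Longrightarrow>
         15 / 100 * real l * (norm y)\<^sup>2 \<le> proj_energy D (G \<omega>) y \<and> proj_energy D (G \<omega>) y \<le> 32 / 10 * k * (norm y)\<^sup>2"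
      by (rule gaussian_extreme_energy[OF P G D, of "1 / 10" "1 / 4" 2 "32 / 10 * k" "15 / 100 * real l"])
        (auto simp: power2_eq_square)
    have K1: "?K1 \<le> exp (465 / 1000 * k)"
      using inverse_sqrt_power_le[of "465 / 1000" "1 - 2 * (1 / 4) * (1 + 1 / 10)\<^sup>2" "card D"]
        exp_numerals(11) unfolding cardk
      by (auto simp: exp_minus field_simps power2_eq_square)
    have K2: "?K2 \<le> exp (- 719 / 1000 * k)"
      using inverse_sqrt_power_le[of "- 719 / 1000" "1 + 2 * 2 * (1 - 1 / 10)\<^sup>2" "card D"]
        exp_numerals(14) unfolding cardk
      by (auto simp: exp_minus field_simps power2_eq_square)
    have base: "1 + 1 / (1 / 10) \<le> exp (12 / 5 :: real)" using exp_numerals(2) by simp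
    have "(1 + 1 / (1 / 10)) ^ CARD('r) * (?K1 * exp (- (1 / 4 * (32 / 10 * k))))
        \<le> exp (12 / 5 * real CARD('r) + 465 / 1000 * k + - (1 / 4 * (32 / 10 * k)))"
      by (rule power_mult_exp_le[OF _ base K1]) (auto simp: power2_eq_square)
    also have "\<dots> \<le> 1 / 2 * exp (- (k / 20))"
      by (rule exp_le_share[OF exp_numerals(5)]) (use r2 kr in \<open>auto simp: r_def\<close>)
    finally have 1: "(1 + 1 / (1 / 10)) ^ CARD('r) * (?K1 * exp (- (1 / 4 * (32 / 10 * k)))) \<le> 1 / 2 * exp (- (k / 20))" .
    have "(1 + 1 / (1 / 10)) ^ CARD('r) * (?K2 * exp (2 * (15 / 100 * real l + (1 / 10)\<^sup>2 * (32 / 10 * k))))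
        \<le> exp (12 / 5 * real CARD('r) + - 719 / 1000 * k + 2 * (15 / 100 * real l + (1 / 10)\<^sup>2 * (32 / 10 * k)))"
      by (rule power_mult_exp_le[OF _ base K2]) (auto simp: power2_eq_square)
    also have "\<dots> \<le> 1 / 2 * exp (- (k / 20))"
    proof (rule exp_le_share[OF exp_numerals(5)])
      have "540 * r + 200 \<le> 61 * k" using r2 kr by linarith
      then show "12 / 5 * real CARD('r) + - 719 / 1000 * k + 2 * (15 / 100 * real l + (1 / 10)\<^sup>2 * (32 / 10 * k)) + 1
          \<le> - (k / 20)"
        unfolding lk r_def[symmetric] power2_eq_square by (simp add: field_simps)
    qed simp
    finally have "measure P Bad \<le> exp (- (k / 20))" using 1 Bad(2) by (simp only: distrib_left)
    then show ?thesis using that[OF Bad(1)] Bad(3) by (auto simp: k_def)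
  qed
qed

text \<open>
  The mean of \<open>\<parallel>G F\<^sup>T\<parallel>\<^sup>2 / \<parallel>F\<parallel>\<^sup>2\<close> is \<open>r < n / 36\<close>, well below \<open>0.13 n\<close>.
\<close>

theorem wide_gaussian_product_bound:
  fixes G :: "'a \<Rightarrow> real^'n^'r" and F :: "real^'n^'m"
  assumes P: "prob_space P" and G: "gaussian_matrix P G" and nr: "36 * CARD('r) < CARD('n)"
  obtains Bad where "Bad \<in> sets P" "measure P Bad \<le> 3 / 5 * exp (- (real CARD('n) / 72))"
    "\<And>\<omega>. \<omega> \<in> space P \<Longrightarrow> \<omega> \<notin> Bad \<Longrightarrow>
       (norm (G \<omega> ** transpose F))\<^sup>2 \<le> 13 / 100 * real CARD('n) * (norm F)\<^sup>2"
proof -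
  define n r where "n = real CARD('n)" and "r = real CARD('r)"
  have nr': "36 * r + 1 \<le> n" using nr unfolding n_def r_def by linarith
  have r1: "r \<ge> 1" by (simp add: r_def Suc_leI)
  obtain Bad where Bad: "Bad \<in> sets P"
    "measure P Bad \<le> (1 / sqrt (1 - 2 * (2 / 5))) ^ CARD('r) * exp (- (2 / 5 * (13 / 100 * n)))"
    "\<And>\<omega>. \<omega> \<in> space P \<Longrightarrow> \<omega> \<notin> Bad \<Longrightarrow> (norm (G \<omega> ** transpose F))\<^sup>2 \<le> 13 / 100 * n * (norm F)\<^sup>2"
    by (rule gaussian_product_bound[OF P G, of "2 / 5" "13 / 100 * n" F]) auto
  have "(1 / sqrt (1 - 2 * (2 / 5))) ^ CARD('r) * exp (- (2 / 5 * (13 / 100 * n)))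
      \<le> exp (81 / 100 * r) * exp (- (2 / 5 * (13 / 100 * n)))"
    using inverse_sqrt_power_le[of "81 / 100" "1 - 2 * (2 / 5)" "CARD('r)"] exp_numerals(10)
    by (intro mult_right_mono) (auto simp: exp_minus field_simps r_def)
  also have "\<dots> \<le> 1 / (5 / 3) * exp (- (n / 72))"
    unfolding exp_add[symmetric] by (rule exp_le_share[OF exp_numerals(4)]) (use r1 nr' in auto)
  finally have "measure P Bad \<le> 3 / 5 * exp (- (n / 72))" using Bad(2) by simp
  then show ?thesis using that[OF Bad(1)] Bad(3) by (simp add: n_def)
qed

section \<open>The probability of success\<close>

lemma tau_lipschitz:
  assumes nrm: "spectral_or_frobenius nrm" and k: "k > 0"
  shows "tau nrm k A \<le> tau nrm k B + norm (A - B)"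
proof -
  have "tau nrm k A - norm (A - B) \<le> tau nrm k B"
    unfolding tau_def[of _ _ B]
  proof (rule cInf_greatest)
    show "{nrm (B - N) |N. rank N < k} \<noteq> {}" using k by (auto intro!: exI[of _ 0])
    fix t assume "t \<in> {nrm (B - N) |N. rank N < k}"
    then obtain N where N: "t = nrm (B - N)" "rank N < k" by blast
    have "tau nrm k A \<le> nrm (A - N)"
      unfolding tau_def using N(2) by (intro cInf_lower bdd_belowI[of _ 0]) (auto simp: nrm_nonneg[OF nrm])
    then show "tau nrm k A - norm (A - B) \<le> t"
      using nrm_diff_le[OF nrm, of "A - N" "B - N"] N(1) by simp
  qed
  then show ?thesis by simp
qed

lemma continuous_tau:
  assumes nrm: "spectral_or_frobenius nrm" and k: "k > 0"
  shows "continuous_on UNIV (tau nrm k :: real^'n^'m \<Rightarrow> real)"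
proof -
  have "1-lipschitz_on UNIV (tau nrm k :: real^'n^'m \<Rightarrow> real)"
  proof (rule lipschitz_onI)
    fix A B :: "real^'n^'m"
    show "dist (tau nrm k A) (tau nrm k B) \<le> 1 * dist A B"
      using tau_lipschitz[OF nrm k, of A B] tau_lipschitz[OF nrm k, of B A]
      by (simp add: dist_norm norm_minus_commute abs_le_iff)
  qed simp
  then show ?thesis by (rule lipschitz_on_continuous_on)
qed

text \<open>
  As a function of \<open>M\<close>, the error is the infimum over \<open>N\<close> of the continuous functions
  \<open>|||M - M H N|||\<close>, and \<open>\<tau>\<close> is continuous. The event is therefore the preimage under \<open>M\<close> of the
  \<open>G\<^sub>\<delta>\<close> set \<open>S\<close>.
\<close>

lemma range_finder_event_measurable:
  fixes M :: "'a \<Rightarrow> real^'n^'m" and H :: "real^'l^'n" and T :: "'a \<Rightarrow> real^'l^'l"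
  assumes nrm: "spectral_or_frobenius nrm" and k: "k > 0" and M: "M \<in> borel_measurable P"
    and T: "\<And>\<omega>. invertible (T \<omega>)" and X: "\<And>\<omega>. X \<omega> = M \<omega> ** H ** matrix_inv (T \<omega>)"
  shows "{\<omega> \<in> space P. nrm (M \<omega> - X \<omega> ** (pinv (X \<omega>) ** M \<omega>)) \<le> c * tau nrm k (M \<omega>)} \<in> sets P"
proof -
  define g where "g N W = nrm (W - W ** H ** N) - c * tau nrm k W" for N :: "real^'n^'l" and W :: "real^'n^'m"
  define S where "S = (\<Inter>j::nat. \<Union>N. {W. g N W < 1 / real (Suc j)})"
  have "continuous_on UNIV (g N)" for N
  proof -
    have "linear (\<lambda>W :: real^'n^'m. W - W ** H ** N)"
      by (rule linearI) (simp_all add: matrix_add_rdistrib scalar_matrix_assoc[symmetric] scaleR_diff_right)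
    then have "continuous_on UNIV (\<lambda>W :: real^'n^'m. W - W ** H ** N)"
      by (intro linear_continuous_on) (simp add: linear_conv_bounded_linear)
    from continuous_on_compose2[OF continuous_nrm[OF nrm] this]
    show ?thesis unfolding g_def by (intro continuous_intros continuous_tau[OF nrm k]) auto
  qed
  then have "open {W. g N W < t}" for N t
    using open_Collect_less[of "g N" "\<lambda>_. t"] by simp
  then have S: "S \<in> sets borel"
    unfolding S_def by (intro sets.countable_INT) (auto simp del: of_nat_Suc intro!: borel_open open_UN)
  have "nrm (M \<omega> - X \<omega> ** (pinv (X \<omega>) ** M \<omega>)) \<le> c * tau nrm k (M \<omega>) \<longleftrightarrow> M \<omega> \<in> S" for \<omega>
  proof
    assume le: "nrm (M \<omega> - X \<omega> ** (pinv (X \<omega>) ** M \<omega>)) \<le> c * tau nrm k (M \<omega>)"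
    \<comment> \<open>The infimum over \<open>N\<close> is attained.\<close>
    have "M \<omega> ** H ** (matrix_inv (T \<omega>) ** pinv (X \<omega>) ** M \<omega>) = X \<omega> ** (pinv (X \<omega>) ** M \<omega>)"
      by (simp add: X matrix_mul_assoc)
    with le have "g (matrix_inv (T \<omega>) ** pinv (X \<omega>) ** M \<omega>) (M \<omega>) \<le> 0" by (simp add: g_def)
    then have "g (matrix_inv (T \<omega>) ** pinv (X \<omega>) ** M \<omega>) (M \<omega>) < 1 / real (Suc j)" for j
      by (rule le_less_trans) simp
    then show "M \<omega> \<in> S" by (auto simp: S_def)
  next
    assume "M \<omega> \<in> S"
    then have *: "\<exists>N. g N (M \<omega>) < 1 / real (Suc j)" for j by (auto simp: S_def)
    show "nrm (M \<omega> - X \<omega> ** (pinv (X \<omega>) ** M \<omega>)) \<le> c * tau nrm k (M \<omega>)"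
    proof (rule field_le_epsilon)
      fix e :: real assume "e > 0"
      then obtain j where j: "1 / real (Suc j) < e" using nat_approx_posE by blast
      obtain N where "g N (M \<omega>) < 1 / real (Suc j)" using * by blast
      then show "nrm (M \<omega> - X \<omega> ** (pinv (X \<omega>) ** M \<omega>)) \<le> c * tau nrm k (M \<omega>) + e"
        using range_finder_error_le_sketch[OF nrm T X, of \<omega> N] j by (simp add: g_def)
    qed
  qed
  then have "{\<omega> \<in> space P. nrm (M \<omega> - X \<omega> ** (pinv (X \<omega>) ** M \<omega>)) \<le> c * tau nrm k (M \<omega>)} = M -` S \<inter> space P"
    by auto
  then show ?thesis using measurable_sets[OF M S] by simp
qed

text \<open>
  If \<open>r = l\<close>, the asserted lower bound is not positive. Otherwise the three exceptional sets have total
  measure at most \<open>exp (- (l - r) / 20) + (2/5 + 3/5) exp (- n / 72)\<close>.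
\<close>

theorem range_finder_success_probability:
  fixes G :: "'a \<Rightarrow> real^'n^'r" and A :: "real^'r^'m" and E :: "real^'n^'m" and H :: "real^'l^'n"
    and T :: "'a \<Rightarrow> real^'l^'l"
  assumes P: "prob_space P" and G: "gaussian_matrix P G"
    and rl: "CARD('r) \<le> CARD('l)" and ln: "CARD('l) \<le> CARD('n)"
    and nr: "36 * CARD('r) < CARD('n)" and lr: "22 * (CARD('r) - 1) < CARD('l)"
    and nrm: "spectral_or_frobenius nrm"
    and A: "\<sigma> > 0" "\<And>x. \<sigma> * norm x \<le> norm (A *v x)"
    and E: "norm E \<le> \<sigma> / 12" and H: "inj ((*v) H)"
    and M: "\<And>\<omega>. M \<omega> = A ** ((1 / sqrt (real CARD('n))) *\<^sub>R G \<omega>) + E"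
    and T: "\<And>\<omega>. invertible (T \<omega>)" and X: "\<And>\<omega>. X \<omega> = M \<omega> ** H ** matrix_inv (T \<omega>)"
    and c: "sqrt (1 + 100 * (real CARD('n) / real CARD('l))) \<le> c"
  shows "1 - exp (- (real CARD('l) - real CARD('r)) / 20) - exp (- real CARD('n) / 72)
     \<le> measure P {\<omega> \<in> space P. nrm (M \<omega> - X \<omega> ** (pinv (X \<omega>) ** M \<omega>)) \<le> c * tau nrm (CARD('r) + 1) (M \<omega>)}"
    (is "_ \<le> measure P ?S")
proof (cases "CARD('r) = CARD('l)")
  case True
  then have "1 - exp (- (real CARD('l) - real CARD('r)) / 20) - exp (- real CARD('n) / 72) \<le> 0" by simp
  also have "0 \<le> measure P ?S" by simp
  finally show ?thesis .
next
  case False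
  with rl have rl': "CARD('r) < CARD('l)" by simp
  interpret prob_space P by fact
  note [measurable] = gaussian_measurable[OF G]
  let ?b = "1 / sqrt (real CARD('n))"
  have "linear (\<lambda>X :: real^'n^'r. A ** (?b *\<^sub>R X))"
    by (rule linearI) (simp_all add: matrix_add_ldistrib matrix_scalar_ac scalar_matrix_assoc[symmetric] scaleR_add_right)
  then have cont: "continuous_on UNIV (\<lambda>X :: real^'n^'r. A ** (?b *\<^sub>R X) + E)"
    by (intro continuous_intros linear_continuous_on) (simp add: linear_conv_bounded_linear)
  have "(\<lambda>\<omega>. A ** (?b *\<^sub>R G \<omega>) + E) \<in> borel_measurable P"
    by (rule measurable_compose[OF gaussian_measurable[OF G] borel_measurable_continuous_onI[OF cont]])
  then have Mm: "M \<in> borel_measurable P" unfolding M[abs_def] .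
  have S: "?S \<in> sets P"
    by (rule range_finder_event_measurable[OF nrm _ Mm T X]) simp
  obtain D and F' :: "real^'n^'m" where D: "finite D" "pairwise orthogonal D" "\<And>e. e \<in> D \<Longrightarrow> norm e = 1"
    "card D = CARD('l) - CARD('r)"
    and bound: "\<And>B. \<lbrakk>\<And>y. (norm (y v* B))\<^sup>2 \<le> 21 / 10 * (norm y)\<^sup>2;
         \<And>y. 4 / 10 * (norm y)\<^sup>2 \<le> (norm (y v* B))\<^sup>2;
         \<And>y. 15 / 100 * (real CARD('l) / real CARD('n)) * (norm y)\<^sup>2 \<le> (\<Sum>e\<in>D. (e \<bullet> (y v* B))\<^sup>2);
         (norm (B ** transpose F'))\<^sup>2 \<le> 13 / 100 * (norm F')\<^sup>2\<rbrakk>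
       \<Longrightarrow> \<exists>N. nrm ((A ** B + E) - (A ** B + E) ** H ** N)
             \<le> 10 * sqrt (real CARD('n) / real CARD('l)) * tau nrm (CARD('r) + 1) (A ** B + E)"
    using perturbed_factor_sketch_error[OF nrm A E H ln] by metis
  obtain B1 where B1: "B1 \<in> sets P" "measure P B1 \<le> 2 / 5 * exp (- (real CARD('n) / 72))"
    "\<And>\<omega> y. \<omega> \<in> space P \<Longrightarrow> \<omega> \<notin> B1 \<Longrightarrow>
       4 / 10 * real CARD('n) * (norm y)\<^sup>2 \<le> (norm (y v* G \<omega>))\<^sup>2 \<and>
       (norm (y v* G \<omega>))\<^sup>2 \<le> 21 / 10 * real CARD('n) * (norm y)\<^sup>2"
    using wide_gaussian_well_conditioned[OF P G nr] by metis
  obtain B2 where B2: "B2 \<in> sets P" "measure P B2 \<le> 3 / 5 * exp (- (real CARD('n) / 72))"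
    "\<And>\<omega>. \<omega> \<in> space P \<Longrightarrow> \<omega> \<notin> B2 \<Longrightarrow>
       (norm (G \<omega> ** transpose F'))\<^sup>2 \<le> 13 / 100 * real CARD('n) * (norm F')\<^sup>2"
    using wide_gaussian_product_bound[OF P G nr, of F'] by metis
  obtain B3 where B3: "B3 \<in> sets P" "measure P B3 \<le> exp (- ((real CARD('l) - real CARD('r)) / 20))"
    "\<And>\<omega> y. \<omega> \<in> space P \<Longrightarrow> \<omega> \<notin> B3 \<Longrightarrow>
       15 / 100 * real CARD('l) * (norm y)\<^sup>2 \<le> proj_energy D (G \<omega>) y"
    using sketched_gaussian_lower_bound[OF P G D(1-3) D(4) rl' lr] by metis
  have "space P - (B1 \<union> B2 \<union> B3) \<subseteq> ?S"
  proof safe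
    fix \<omega> assume \<omega>: "\<omega> \<in> space P" "\<omega> \<notin> B1" "\<omega> \<notin> B2" "\<omega> \<notin> B3"
    let ?B = "?b *\<^sub>R G \<omega>" and ?n = "real CARD('n)"
    have b2: "?b\<^sup>2 = 1 / ?n" by (simp add: power_divide)
    have n0: "?n > 0" by simp
    have yB: "y v* ?B = ?b *\<^sub>R (y v* G \<omega>)" for y by (rule vector_scaleR_matrix_ac)
    have nB: "(norm (y v* ?B))\<^sup>2 = (norm (y v* G \<omega>))\<^sup>2 / ?n" for y
      unfolding yB norm_scaleR power_mult_distrib by (simp add: power_divide)
    have "?B ** transpose F' = ?b *\<^sub>R (G \<omega> ** transpose F')" by (simp add: scalar_matrix_assoc)
    then have nBF: "(norm (?B ** transpose F'))\<^sup>2 = (norm (G \<omega> ** transpose F'))\<^sup>2 / ?n"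
      by (simp add: power_mult_distrib power_divide)
    have DB: "(\<Sum>e\<in>D. (e \<bullet> (y v* ?B))\<^sup>2) = proj_energy D (G \<omega>) y / ?n" for y
      unfolding yB proj_energy_def inner_scaleR_right power_mult_distrib b2
      by (simp add: sum_divide_distrib)
    obtain N where N: "nrm (M \<omega> - M \<omega> ** H ** N)
        \<le> 10 * sqrt (?n / real CARD('l)) * tau nrm (CARD('r) + 1) (M \<omega>)"
    proof -
      have "\<exists>N. nrm ((A ** ?B + E) - (A ** ?B + E) ** H ** N)
             \<le> 10 * sqrt (?n / real CARD('l)) * tau nrm (CARD('r) + 1) (A ** ?B + E)"
      proof (rule bound)
        show "(norm (?B ** transpose F'))\<^sup>2 \<le> 13 / 100 * (norm F')\<^sup>2"
          unfolding nBF using B2(3)[OF \<omega>(1,3)] n0 by (simp add: field_simps)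
        fix y
        show "(norm (y v* ?B))\<^sup>2 \<le> 21 / 10 * (norm y)\<^sup>2" "4 / 10 * (norm y)\<^sup>2 \<le> (norm (y v* ?B))\<^sup>2"
          unfolding nB using B1(3)[OF \<omega>(1,2), of y] n0 by (simp_all add: field_simps)
        show "15 / 100 * (real CARD('l) / ?n) * (norm y)\<^sup>2 \<le> (\<Sum>e\<in>D. (e \<bullet> (y v* ?B))\<^sup>2)"
          unfolding DB using B3(3)[OF \<omega>(1,4), of y] n0 by (simp add: field_simps)
      qed
      then show ?thesis using that unfolding M by blast
    qed
    have "10 * sqrt (?n / real CARD('l)) = sqrt (100 * (?n / real CARD('l)))"
      unfolding real_sqrt_mult by simp
    also have "\<dots> \<le> c" by (rule order_trans[OF _ c]) simp
    finally have "10 * sqrt (?n / real CARD('l)) * tau nrm (CARD('r) + 1) (M \<omega>) \<le> c * tau nrm (CARD('r) + 1) (M \<omega>)"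
      by (intro mult_right_mono tau_nonneg[OF nrm]) auto
    with N range_finder_error_le_sketch[OF nrm T X, of \<omega> N]
    show "nrm (M \<omega> - X \<omega> ** (pinv (X \<omega>) ** M \<omega>)) \<le> c * tau nrm (CARD('r) + 1) (M \<omega>)" by linarith
  qed
  then have "prob (space P - (B1 \<union> B2 \<union> B3)) \<le> prob ?S" by (intro finite_measure_mono S)
  moreover have "prob (space P - (B1 \<union> B2 \<union> B3)) = 1 - prob (B1 \<union> B2 \<union> B3)"
    using B1(1) B2(1) B3(1) by (intro prob_compl) auto
  moreover have "prob (B1 \<union> B2 \<union> B3) \<le> prob B1 + prob B2 + prob B3"
    using B1(1) B2(1) B3(1) measure_Un_le[of "B1 \<union> B2" P B3] measure_Un_le[of B1 P B2] by auto
  moreover have "exp (- (real CARD('l) - real CARD('r)) / 20) = exp (- ((real CARD('l) - real CARD('r)) / 20))"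
    "exp (- real CARD('n) / 72) = exp (- (real CARD('n) / 72))" by (simp_all only: minus_divide_left)
  ultimately show ?thesis using B1(2) B2(2) B3(2) by linarith
qed

lemma orthonormal_columns_full_rank:
  fixes H :: "real^'l^'n"
  assumes "orthonormal_columns H" shows "rank H = CARD('l)"
proof -
  have "transpose H ** H = mat 1"
    using assms unfolding orthonormal_columns_def matrix_mult_transpose_dot_column
    by (auto simp: vec_eq_iff mat_def orthogonal_def norm_eq_1)
  then show ?thesis
    unfolding full_rank_injective using matrix_left_invertible_injective by blast
qed

text \<open>
  \<open>H\<^sup>+ H = 1\<close> for injective \<open>H\<close>.
\<close>

lemma cond_number_ge_1:
  fixes H :: "real^'l^'n"
  assumes "rank H = CARD('l)" shows "1 \<le> cond_number H"
proof -
  have inj: "inj ((*v) H)" using assms by (simp add: full_rank_injective)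
  have "H *v (pinv H *v (H *v x)) = (H ** pinv H ** H) *v x" for x
    by (simp add: matrix_vector_mul_assoc matrix_mul_assoc)
  then have "H *v (pinv H *v (H *v x)) = H *v x" for x by (simp add: pinv_mul_mul)
  then have id: "pinv H *v (H *v x) = x" for x using inj by (meson injD)
  let ?e = "axis undefined 1 :: real^'l"
  have "1 = norm (pinv H *v (H *v ?e))" unfolding id by simp
  also have "\<dots> \<le> spectral_norm (pinv H) * norm (H *v ?e)" by (rule spectral_norm_bound)
  also have "\<dots> \<le> spectral_norm (pinv H) * (spectral_norm H * norm ?e)"
    by (intro mult_left_mono spectral_norm_bound spectral_norm_nonneg)
  finally show ?thesis by (simp add: cond_number_def mult.commute)
qed

theorem theorem9p2:
  fixes r l m n :: nat
    and P :: "'a measure"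
    and G B :: "'a \<Rightarrow> real^'n^'r"
    and H :: "real^'l^'n"
    and A :: "real^'r^'m"
    and E :: "real^'n^'m"
    and Mt M :: "'a \<Rightarrow> real^'n^'m"
    and T :: "'a \<Rightarrow> real^'l^'l"
    and X :: "'a \<Rightarrow> real^'l^'m"
    and Y :: "'a \<Rightarrow> real^'n^'l"
    and nrm :: "real^'n^'m \<Rightarrow> real"
  assumes dims: "CARD('r) = r" "CARD('l) = l" "CARD('m) = m" "CARD('n) = n"
    and "r \<le> l" and "l < min m n" and "n > 36 * r" and "l > 22 * (r - 1)"
    and "prob_space P"
    and "gaussian_matrix P G"
    and "rank A = r"
    and B: "\<And>\<omega>. B \<omega> = (1 / sqrt (real n)) *\<^sub>R G \<omega>"
    and Mt: "\<And>\<omega>. Mt \<omega> = A ** B \<omega>"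
    and M: "\<And>\<omega>. M \<omega> = Mt \<omega> + E"
    and "\<And>\<omega>. invertible (T \<omega>)"
    and X: "\<And>\<omega>. X \<omega> = M \<omega> ** H ** matrix_inv (T \<omega>)"
    and Y: "\<And>\<omega>. Y \<omega> = pinv (X \<omega>) ** M \<omega>"
    and nrm: "nrm = spectral_norm \<or> nrm = frobenius_norm"
  shows "(orthonormal_columns H \<and>
          frobenius_norm E \<le> singular_value r A / (48 * sqrt (real n / real l) + 6)
          \<longrightarrow> measure P {\<omega> \<in> space P. nrm (M \<omega> - X \<omega> ** Y \<omega>)
                  \<le> sqrt (1 + 100 * (real n / real l)) * tau nrm (r + 1) (M \<omega>)}
              \<ge> 1 - exp (- (real l - real r) / 20) - exp (- (real n - real r) / 20)
                  - exp (- real n / 72)) \<and>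
         (rank H = l \<and>
          frobenius_norm E \<le> singular_value r A / 12 *
            min 1 (1 / (4 * sqrt (real n / real l) * singular_value l H + 1 / 2))
          \<longrightarrow> measure P {\<omega> \<in> space P. nrm (M \<omega> - X \<omega> ** Y \<omega>)
                  \<le> sqrt (1 + 100 * (cond_number H)\<^sup>2 * (real n / real l)) * tau nrm (r + 1) (M \<omega>)}
              \<ge> 1 - exp (- (real l - real r) / 20) - exp (- (real n - real r) / 20)
                  - exp (- real n / 72))"
proof -
  let ?\<sigma> = "singular_value r A"
  have \<sigma>: "?\<sigma> > 0" "\<And>x. ?\<sigma> * norm x \<le> norm (A *v x)"
    using last_singular_value_full_rank[of A] \<open>rank A = r\<close> dims by auto
  have success: "1 - exp (- (real l - real r) / 20) - exp (- (real n - real r) / 20) - exp (- real n / 72)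
      \<le> measure P {\<omega> \<in> space P. nrm (M \<omega> - X \<omega> ** Y \<omega>) \<le> c * tau nrm (r + 1) (M \<omega>)}"
    if E: "frobenius_norm E \<le> ?\<sigma> / 12" and H: "rank H = l"
      and c: "sqrt (1 + 100 * (real n / real l)) \<le> c" for c
  proof -
    have inj: "inj ((*v) H)" using H dims(2) by (metis full_rank_injective)
    have "1 - exp (- (real l - real r) / 20) - exp (- real n / 72)
        \<le> measure P {\<omega> \<in> space P. nrm (M \<omega> - X \<omega> ** (pinv (X \<omega>) ** M \<omega>)) \<le> c * tau nrm (r + 1) (M \<omega>)}"
      unfolding dims[symmetric]
      by (rule range_finder_success_probability[where G = G and A = A and E = E and H = H and T = T and \<sigma> = ?\<sigma>])
        (use assms \<sigma> E inj c in \<open>auto simp: dims spectral_or_frobenius_def frobenius_norm_eq_norm\<close>)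
    then show ?thesis
      unfolding Y using exp_ge_zero[of "- (real n - real r) / 20"] by linarith
  qed
  show ?thesis
  proof (intro conjI impI; elim conjE)
    assume H: "orthonormal_columns H" and E: "frobenius_norm E \<le> ?\<sigma> / (48 * sqrt (real n / real l) + 6)"
    have "1 \<le> sqrt (real n / real l)"
      using \<open>l < min m n\<close> dims(2) zero_less_card_finite[where 'a = 'l] by simp
    then have "12 \<le> 48 * sqrt (real n / real l) + 6" by linarith
    then have "?\<sigma> / (48 * sqrt (real n / real l) + 6) \<le> ?\<sigma> / 12"
      using \<sigma>(1) by (intro divide_left_mono mult_pos_pos) linarith+
    with E have "frobenius_norm E \<le> ?\<sigma> / 12" by linarith
    moreover have "rank H = l" using orthonormal_columns_full_rank[OF H] dims(2) by simp
    ultimately show "measure P {\<omega> \<in> space P. nrm (M \<omega> - X \<omega> ** Y \<omega>)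
                  \<le> sqrt (1 + 100 * (real n / real l)) * tau nrm (r + 1) (M \<omega>)}
              \<ge> 1 - exp (- (real l - real r) / 20) - exp (- (real n - real r) / 20)
                  - exp (- real n / 72)" by (intro success) auto
  next
    assume H: "rank H = l" and E: "frobenius_norm E \<le> ?\<sigma> / 12 *
            min 1 (1 / (4 * sqrt (real n / real l) * singular_value l H + 1 / 2))"
    have "?\<sigma> / 12 * min 1 (1 / (4 * sqrt (real n / real l) * singular_value l H + 1 / 2)) \<le> ?\<sigma> / 12 * 1"
      using \<sigma>(1) by (intro mult_left_mono) auto
    with E have "frobenius_norm E \<le> ?\<sigma> / 12" by linarith
    moreover have "sqrt (1 + 100 * (real n / real l)) \<le> sqrt (1 + 100 * (cond_number H)\<^sup>2 * (real n / real l))"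
    proof -
      have "1 * (real n / real l) \<le> (cond_number H)\<^sup>2 * (real n / real l)"
        using cond_number_ge_1[of H] H dims(2) by (intro mult_right_mono one_le_power) auto
      then show ?thesis by simp
    qed
    ultimately show "measure P {\<omega> \<in> space P. nrm (M \<omega> - X \<omega> ** Y \<omega>)
                  \<le> sqrt (1 + 100 * (cond_number H)\<^sup>2 * (real n / real l)) * tau nrm (r + 1) (M \<omega>)}
              \<ge> 1 - exp (- (real l - real r) / 20) - exp (- (real n - real r) / 20)
                  - exp (- real n / 72)" using H by (intro success)
  qed
qed

end
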